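(* Let $1\le r,p,p_{1},\dots,p_{m}\le\infty$ with $\frac1p=\frac1{p_{1}}+\dots+\frac1{p_{m}}+\frac1r$, let $r^{*}$ be the conjugate exponent of $r$, and let $E_{1},\dots,E_{m},F$ be Banach lattices. Then $T\in\mathcal{L}(E_{1},\dots,E_{m};F)$ is positive $(p_{1},\dots,p_{m};r)$-dominated if and only if there exist Banach spaces $X_{1},\dots,X_{m}$, a Cohen positive strongly $r^{*}$-summing $m$-linear operator $A:X_{1}\times\dots\times X_{m}\to F$ and linear operators $u_{j}\in\Pi_{p_{j}}^{+}(E_{j};X_{j})$ $(1\le j\le m)$ such that $T=A\circ(u_{1},\dots,u_{m})$; that is, $$\mathcal{D}_{(p_{1},\dots,p_{m};r)}^{+}(E_{1},\dots,E_{m};F)=\mathcal{D}_{r^{*}}^{m+}\left(\Pi_{p_{1}}^{+},\dots,\Pi_{p_{m}}^{+}\right)(E_{1},\dots,E_{m};F).$$ Moreover, $$d_{(p_{1},\dots,p_{m};r)}^{+}(T)=\inf\left\{d_{r^{*}}^{m+}(A)\prod_{j=1}^{m}\pi_{p_{j}}^{+}(u_{j}):T=A\circ(u_{1},\dots,u_{m})\right\},$$ the infimum being over all such factorizations.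
   Context: $\mathcal{L}(E_{1},\dots,E_{m};F)$ is the space of bounded $m$-linear operators. $E^{+}$ is the positive cone of a Banach lattice $E$; $E^{*}$ has its natural Banach lattice order. $\|\cdot\|_{q}$ denotes the $\ell_{q}^{n}$-norm of scalars, or of the norms of vectors, and $\|(x_{i})_{i=1}^{n}\|_{q,w}=\sup_{x^{*}\in B_{X^{*}}}\left(\sum_{i=1}^{n}|\langle x^{*},x_{i}\rangle|^{q}\right)^{1/q}$ for a finite sequence in a Banach space $X$. When an exponent is $\infty$, sums are replaced by maxima in the usual way. The conjugate exponent $q^{*}$ satisfies $1/q+1/q^{*}=1$. $\Pi_{q}^{+}(E;X)$ is the space of positive $q$-summing operators: bounded linear $u:E\to X$ from a Banach lattice to a Banach space for which there is $C>0$ with $\|(u(x_{i}))_{i=1}^{n}\|_{q}\le C\|(x_{i})_{i=1}^{n}\|_{q,w}$ for all $n$ and $x_{1},\dots,x_{n}\in E^{+}$; $\pi_{q}^{+}(u)$ is the infimum of such $C$. $\mathcal{D}_{q}^{m+}(X_{1},\dots,X_{m};F)$ is the space of Cohen positive strongly $q$-summing $m$-linear operators: bounded $m$-linear $A:X_{1}\times\dots\times X_{m}\to F$ (Banach spaces $X_{j}$, Banach lattice $F$) for which there is $C>0$ such that for all $n$, $(x_{i}^{1},\dots,x_{i}^{m})\in X_{1}\times\dots\times X_{m}$ and $y_{i}^{*}\in F^{*+}$ $(1\le i\le n)$, $$\sum_{i=1}^{n}|\langle A(x_{i}^{1},\dots,x_{i}^{m}),y_{i}^{*}\rangle|\le C\left(\sum_{i=1}^{n}\prod_{j=1}^{m}\|x_{i}^{j}\|^{q}\right)^{1/q}\|(y_{i}^{*})_{i=1}^{n}\|_{q^{*},w};$$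 $d_{q}^{m+}(A)$ is the infimum of such $C$. $T\in\mathcal{L}(E_{1},\dots,E_{m};F)$ is positive $(p_{1},\dots,p_{m};r)$-dominated (written $T\in\mathcal{D}_{(p_{1},\dots,p_{m};r)}^{+}(E_{1},\dots,E_{m};F)$) if there is $C>0$ such that for every $n$, all $(x_{i}^{1},\dots,x_{i}^{m})\in E_{1}^{+}\times\dots\times E_{m}^{+}$ and $y_{i}^{*}\in F^{*+}$ $(1\le i\le n)$, $$\left\|\left(\langle T(x_{i}^{1},\dots,x_{i}^{m}),y_{i}^{*}\rangle\right)_{i=1}^{n}\right\|_{p}\le C\prod_{j=1}^{m}\left\|(x_{i}^{j})_{i=1}^{n}\right\|_{p_{j},w}\left\|(y_{i}^{*})_{i=1}^{n}\right\|_{r,w};$$ $d_{(p_{1},\dots,p_{m};r)}^{+}(T)$ is the infimum of such $C$. $\mathcal{D}_{r^{*}}^{m+}(\Pi_{p_{1}}^{+},\dots,\Pi_{p_{m}}^{+})(E_{1},\dots,E_{m};F)$ is the set of all $T=A\circ(u_{1},\dots,u_{m})$ with $u_{j}\in\Pi_{p_{j}}^{+}(E_{j};X_{j})$ and $A\in\mathcal{D}_{r^{*}}^{m+}(X_{1},\dots,X_{m};F)$ for some Banach spaces $X_{1},\dots,X_{m}$. *)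

theory Defs
  imports "HOL-Analysis.Analysis" "HOL-Algebra.Module" "HOL-Algebra.Lattice"
begin

text \<open>
  The theorem speaks about finite families of Banach spaces and Banach lattices and quantifies over
  Banach spaces, so these are structures with an explicit carrier, in the style of HOL-Algebra: a
  real vector space is a HOL-Algebra module over the field of reals. The field is taken from
  \<open>real_line\<close>, which also serves as the target of linear functionals; in the other structures the
  record fields \<open>mult\<close> and \<open>one\<close> carry no meaning.
\<close>

record 'a normed = "(real, 'a) module" +
  nrm :: "'a \<Rightarrow> real"

record 'a normed_lattice = "'a normed" +
  leq :: "'a \<Rightarrow> 'a \<Rightarrow> bool"

definition real_line :: "real normed" where
  "real_line = \<lparr>carrier = UNIV, mult = (*), one = 1, zero = 0, add = (+), smult = (*), nrm = abs\<rparr>"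

locale banach_space = Module.module real_line V
  for V :: "('a, 'z) normed_scheme" (structure) +
  assumes nrm_nonneg: "x \<in> carrier V \<Longrightarrow> 0 \<le> nrm V x"
    and nrm_eq_0: "x \<in> carrier V \<Longrightarrow> nrm V x = 0 \<longleftrightarrow> x = \<zero>\<^bsub>V\<^esub>"
    and nrm_smult: "x \<in> carrier V \<Longrightarrow> nrm V (a \<odot>\<^bsub>V\<^esub> x) = \<bar>a\<bar> * nrm V x"
    and nrm_triangle: "\<lbrakk>x \<in> carrier V; y \<in> carrier V\<rbrakk> \<Longrightarrow> nrm V (x \<oplus>\<^bsub>V\<^esub> y) \<le> nrm V x + nrm V y"
    and nrm_complete:
      "\<lbrakk>\<And>n::nat. s n \<in> carrier V;
        \<And>e::real. 0 < e \<Longrightarrow> \<exists>N. \<forall>k\<ge>N. \<forall>l\<ge>N. nrm V (s k \<ominus>\<^bsub>V\<^esub> s l) < e\<rbrakk>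
       \<Longrightarrow> \<exists>x\<in>carrier V. (\<lambda>n. nrm V (s n \<ominus>\<^bsub>V\<^esub> x)) \<longlonglongrightarrow> 0"

definition order_of :: "('a, 'z) normed_lattice_scheme \<Rightarrow> 'a gorder" where
  "order_of E = \<lparr>carrier = carrier E, eq = (=), le = leq E\<rparr>"

definition modulus :: "('a, 'z) normed_lattice_scheme \<Rightarrow> 'a \<Rightarrow> 'a" where
  "modulus E x = x \<squnion>\<^bsub>order_of E\<^esub> (\<ominus>\<^bsub>E\<^esub> x)"

locale banach_lattice = banach_space E
  for E :: "('a, 'z) normed_lattice_scheme" (structure) +
  assumes lattice_order: "Lattice.lattice (order_of E)"
    and leq_add: "\<lbrakk>x \<in> carrier E; y \<in> carrier E; z \<in> carrier E; leq E x y\<rbrakk>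
      \<Longrightarrow> leq E (x \<oplus>\<^bsub>E\<^esub> z) (y \<oplus>\<^bsub>E\<^esub> z)"
    and leq_smult: "\<lbrakk>x \<in> carrier E; leq E \<zero>\<^bsub>E\<^esub> x; 0 \<le> a\<rbrakk> \<Longrightarrow> leq E \<zero>\<^bsub>E\<^esub> (a \<odot>\<^bsub>E\<^esub> x)"
    and nrm_mono: "\<lbrakk>x \<in> carrier E; y \<in> carrier E; leq E (modulus E x) (modulus E y)\<rbrakk>
      \<Longrightarrow> nrm E x \<le> nrm E y"

definition pos_cone :: "('a, 'z) normed_lattice_scheme \<Rightarrow> 'a set" where
  "pos_cone E = {x \<in> carrier E. leq E \<zero>\<^bsub>E\<^esub> x}"

text \<open>
  A linear operator is a HOL function of which only the values on the carrier matter. Likewise an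
  \<open>m\<close>-linear operator is only considered on the product of the carriers, i.e. on the extensional
  functions \<open>x\<close> on \<open>{1..m}\<close> with \<open>x j \<in> carrier (E j)\<close>.
\<close>

definition bounded_ops ::
    "('a, 'y) normed_scheme \<Rightarrow> ('b, 'z) normed_scheme \<Rightarrow> ('a \<Rightarrow> 'b) set" where
  "bounded_ops V W = {u.
     (\<forall>x\<in>carrier V. u x \<in> carrier W) \<and>
     (\<forall>x\<in>carrier V. \<forall>y\<in>carrier V. u (x \<oplus>\<^bsub>V\<^esub> y) = u x \<oplus>\<^bsub>W\<^esub> u y) \<and>
     (\<forall>a. \<forall>x\<in>carrier V. u (a \<odot>\<^bsub>V\<^esub> x) = a \<odot>\<^bsub>W\<^esub> u x) \<and>
     (\<exists>K. \<forall>x\<in>carrier V. nrm W (u x) \<le> K * nrm V x)}"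

definition tuples :: "nat \<Rightarrow> (nat \<Rightarrow> ('a, 'z) normed_scheme) \<Rightarrow> (nat \<Rightarrow> 'a) set" where
  "tuples m E = (\<Pi>\<^sub>E j\<in>{1..m}. carrier (E j))"

definition bounded_multilinear_ops ::
    "nat \<Rightarrow> (nat \<Rightarrow> ('a, 'y) normed_scheme) \<Rightarrow> ('b, 'z) normed_scheme \<Rightarrow> ((nat \<Rightarrow> 'a) \<Rightarrow> 'b) set" where
  "bounded_multilinear_ops m E F = {T.
     (\<forall>x\<in>tuples m E. T x \<in> carrier F) \<and>
     (\<forall>x\<in>tuples m E. \<forall>j\<in>{1..m}. \<forall>y\<in>carrier (E j). \<forall>z\<in>carrier (E j).
        T (x(j := y \<oplus>\<^bsub>E j\<^esub> z)) = T (x(j := y)) \<oplus>\<^bsub>F\<^esub> T (x(j := z))) \<and>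
     (\<forall>x\<in>tuples m E. \<forall>j\<in>{1..m}. \<forall>a. \<forall>y\<in>carrier (E j).
        T (x(j := a \<odot>\<^bsub>E j\<^esub> y)) = a \<odot>\<^bsub>F\<^esub> T (x(j := y))) \<and>
     (\<exists>K. \<forall>x\<in>tuples m E. nrm F (T x) \<le> K * (\<Prod>j=1..m. nrm (E j) (x j)))}"

text \<open>Functionals are made extensional, so that equality in the dual is equality of functions.\<close>

definition dual_space :: "('a, 'z) normed_scheme \<Rightarrow> ('a \<Rightarrow> real) normed" where
  "dual_space V =
     \<lparr>carrier = bounded_ops V real_line \<inter> extensional (carrier V),
      mult = undefined, one = undefined,
      zero = (\<lambda>x\<in>carrier V. 0),
      add = (\<lambda>f g. \<lambda>x\<in>carrier V. f x + g x),
      smult = (\<lambda>a f. \<lambda>x\<in>carrier V. a * f x),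
      nrm = (\<lambda>f. SUP x\<in>{x \<in> carrier V. nrm V x \<le> 1}. \<bar>f x\<bar>)\<rparr>"

definition dual_lattice :: "('a, 'z) normed_lattice_scheme \<Rightarrow> ('a \<Rightarrow> real) normed_lattice" where
  "dual_lattice E = normed.extend (dual_space E)
     (normed_lattice.fields (\<lambda>f g. \<forall>x\<in>pos_cone E. f x \<le> g x))"

text \<open>
  Exponents are extended nonnegative reals with \<open>1 / \<infinity> = 0\<close>. In \<open>ell_norm\<close> the inserted \<open>0\<close> only
  matters for the empty sequence.
\<close>

definition conj_exp :: "ennreal \<Rightarrow> ennreal" where
  "conj_exp q = 1 / (1 - 1 / q)"

lemma conj_exp:
  assumes "1 \<le> q"
  shows "1 / q + 1 / conj_exp q = 1" and "conj_exp (conj_exp q) = q"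
proof -
  have le: "1 / q \<le> 1"
    using assms by (metis divide_le_posI_ennreal mult.right_neutral not_gr_zero not_one_le_zero)
  have inv: "1 / (1 / y) = y" for y :: ennreal
  proof (cases y)
    case (real a)
    then show ?thesis
      by (cases "a = 0") (auto simp: divide_ennreal_def inverse_ennreal)
  next
    case top
    then show ?thesis
      by (simp add: divide_ennreal_def)
  qed
  show "1 / q + 1 / conj_exp q = 1"
    using le by (simp add: conj_exp_def inv)
  show "conj_exp (conj_exp q) = q"
    using le by (simp add: conj_exp_def inv diff_diff_ennreal)
qed

definition ell_norm :: "ennreal \<Rightarrow> nat \<Rightarrow> (nat \<Rightarrow> real) \<Rightarrow> real" where
  "ell_norm q n a =
     (if q = \<infinity> then Max (insert 0 ((\<lambda>i. \<bar>a i\<bar>) ` {1..n}))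
      else (\<Sum>i=1..n. \<bar>a i\<bar> powr enn2real q) powr (1 / enn2real q))"

definition weak_norm :: "('a, 'z) normed_scheme \<Rightarrow> ennreal \<Rightarrow> nat \<Rightarrow> (nat \<Rightarrow> 'a) \<Rightarrow> real" where
  "weak_norm V q n x =
     (SUP f\<in>{f \<in> carrier (dual_space V). nrm (dual_space V) f \<le> 1}. ell_norm q n (\<lambda>i. f (x i)))"

definition positive_summing_bound ::
    "ennreal \<Rightarrow> ('e, 'y) normed_lattice_scheme \<Rightarrow> ('x, 'z) normed_scheme \<Rightarrow> ('e \<Rightarrow> 'x) \<Rightarrow> real \<Rightarrow> bool"
  where
  "positive_summing_bound q E X u C \<longleftrightarrow>
     (\<forall>n x. (\<forall>i\<in>{1..n}. x i \<in> pos_cone E) \<longrightarrow>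
        ell_norm q n (\<lambda>i. nrm X (u (x i))) \<le> C * weak_norm E q n x)"

definition positive_summing ::
    "ennreal \<Rightarrow> ('e, 'y) normed_lattice_scheme \<Rightarrow> ('x, 'z) normed_scheme \<Rightarrow> ('e \<Rightarrow> 'x) set" where
  "positive_summing q E X = {u \<in> bounded_ops E X. \<exists>C>0. positive_summing_bound q E X u C}"

definition positive_summing_norm ::
    "ennreal \<Rightarrow> ('e, 'y) normed_lattice_scheme \<Rightarrow> ('x, 'z) normed_scheme \<Rightarrow> ('e \<Rightarrow> 'x) \<Rightarrow> real" where
  "positive_summing_norm q E X u = Inf {C. 0 < C \<and> positive_summing_bound q E X u C}"

definition cohen_positive_bound ::
    "nat \<Rightarrow> ennreal \<Rightarrow> (nat \<Rightarrow> ('x, 'y) normed_scheme) \<Rightarrow> ('f, 'z) normed_lattice_scheme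
      \<Rightarrow> ((nat \<Rightarrow> 'x) \<Rightarrow> 'f) \<Rightarrow> real \<Rightarrow> bool" where
  "cohen_positive_bound m q X F A C \<longleftrightarrow>
     (\<forall>n x y. (\<forall>i\<in>{1..n}. x i \<in> tuples m X) \<and> (\<forall>i\<in>{1..n}. y i \<in> pos_cone (dual_lattice F)) \<longrightarrow>
        (\<Sum>i=1..n. \<bar>y i (A (x i))\<bar>)
          \<le> C * ell_norm q n (\<lambda>i. \<Prod>j=1..m. nrm (X j) (x i j))
              * weak_norm (dual_lattice F) (conj_exp q) n y)"

definition cohen_positive ::
    "nat \<Rightarrow> ennreal \<Rightarrow> (nat \<Rightarrow> ('x, 'y) normed_scheme) \<Rightarrow> ('f, 'z) normed_lattice_scheme
      \<Rightarrow> ((nat \<Rightarrow> 'x) \<Rightarrow> 'f) set" where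
  "cohen_positive m q X F =
     {A \<in> bounded_multilinear_ops m X F. \<exists>C>0. cohen_positive_bound m q X F A C}"

definition cohen_positive_norm ::
    "nat \<Rightarrow> ennreal \<Rightarrow> (nat \<Rightarrow> ('x, 'y) normed_scheme) \<Rightarrow> ('f, 'z) normed_lattice_scheme
      \<Rightarrow> ((nat \<Rightarrow> 'x) \<Rightarrow> 'f) \<Rightarrow> real" where
  "cohen_positive_norm m q X F A = Inf {C. 0 < C \<and> cohen_positive_bound m q X F A C}"

text \<open>
  Below, \<open>p\<close> is the exponent of the left-hand side; in the notion of a positive
  \<open>(p\<^sub>1,\<dots>,p\<^sub>m;r)\<close>-dominated operator it is determined by \<open>1/p = 1/p\<^sub>1 + \<dots> + 1/p\<^sub>m + 1/r\<close>.
\<close>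

definition positive_dominated_bound ::
    "nat \<Rightarrow> ennreal \<Rightarrow> (nat \<Rightarrow> ennreal) \<Rightarrow> ennreal \<Rightarrow> (nat \<Rightarrow> ('e, 'y) normed_lattice_scheme)
      \<Rightarrow> ('f, 'z) normed_lattice_scheme \<Rightarrow> ((nat \<Rightarrow> 'e) \<Rightarrow> 'f) \<Rightarrow> real \<Rightarrow> bool" where
  "positive_dominated_bound m p ps r E F T C \<longleftrightarrow>
     (\<forall>n x y. (\<forall>i\<in>{1..n}. x i \<in> (\<Pi>\<^sub>E j\<in>{1..m}. pos_cone (E j))) \<and>
              (\<forall>i\<in>{1..n}. y i \<in> pos_cone (dual_lattice F)) \<longrightarrow>
        ell_norm p n (\<lambda>i. y i (T (x i)))
          \<le> C * (\<Prod>j=1..m. weak_norm (E j) (ps j) n (\<lambda>i. x i j)) * weak_norm (dual_lattice F) r n y)"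

definition positive_dominated ::
    "nat \<Rightarrow> ennreal \<Rightarrow> (nat \<Rightarrow> ennreal) \<Rightarrow> ennreal \<Rightarrow> (nat \<Rightarrow> ('e, 'y) normed_lattice_scheme)
      \<Rightarrow> ('f, 'z) normed_lattice_scheme \<Rightarrow> ((nat \<Rightarrow> 'e) \<Rightarrow> 'f) set" where
  "positive_dominated m p ps r E F =
     {T \<in> bounded_multilinear_ops m E F. \<exists>C>0. positive_dominated_bound m p ps r E F T C}"

definition positive_dominated_norm ::
    "nat \<Rightarrow> ennreal \<Rightarrow> (nat \<Rightarrow> ennreal) \<Rightarrow> ennreal \<Rightarrow> (nat \<Rightarrow> ('e, 'y) normed_lattice_scheme)
      \<Rightarrow> ('f, 'z) normed_lattice_scheme \<Rightarrow> ((nat \<Rightarrow> 'e) \<Rightarrow> 'f) \<Rightarrow> real" where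
  "positive_dominated_norm m p ps r E F T = Inf {C. 0 < C \<and> positive_dominated_bound m p ps r E F T C}"

text \<open>
  \<open>factorization m q ps E F T X A u\<close>: \<open>T = A \<circ> (u\<^sub>1,\<dots>,u\<^sub>m)\<close> with \<open>u\<^sub>j\<close> positive \<open>p\<^sub>j\<close>-summing into a
  Banach space \<open>X\<^sub>j\<close> and \<open>A\<close> Cohen positive strongly \<open>q\<close>-summing.

  HOL cannot quantify existentially over types, so "there are Banach spaces \<open>X\<^sub>j\<close>" is to be read
  as: there are Banach spaces whose carriers are subsets of a given type \<open>'x\<close>. The theorem is
  stated for every type \<open>'x\<close> into which \<open>nat \<Rightarrow> 'e\<close> injects, where \<open>'e\<close> is the type of the elements
  of the \<open>E\<^sub>j\<close>. This is no restriction on the spaces: spaces over any type \<open>'y\<close> can be copied into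
  \<open>'y + (nat \<Rightarrow> 'e)\<close>.
\<close>

definition factorization ::
    "nat \<Rightarrow> ennreal \<Rightarrow> (nat \<Rightarrow> ennreal) \<Rightarrow> (nat \<Rightarrow> ('e, 'y) normed_lattice_scheme)
      \<Rightarrow> ('f, 'z) normed_lattice_scheme \<Rightarrow> ((nat \<Rightarrow> 'e) \<Rightarrow> 'f)
      \<Rightarrow> (nat \<Rightarrow> 'x normed) \<Rightarrow> ((nat \<Rightarrow> 'x) \<Rightarrow> 'f) \<Rightarrow> (nat \<Rightarrow> 'e \<Rightarrow> 'x) \<Rightarrow> bool" where
  "factorization m q ps E F T X A u \<longleftrightarrow>
     (\<forall>j\<in>{1..m}. banach_space (X j)) \<and>
     A \<in> cohen_positive m q X F \<and>
     (\<forall>j\<in>{1..m}. u j \<in> positive_summing (ps j) (E j) (X j)) \<and>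
     (\<forall>x\<in>tuples m E. T x = A (\<lambda>j\<in>{1..m}. u j (x j)))"

end

theory Submission
  imports Defs
begin

text \<open>
  For one direction, let \<open>T = A \<circ> (u\<^sub>1, \<dots>, u\<^sub>m)\<close>. Multiplying the first arguments by
  nonnegative numbers \<open>l\<^sub>i\<close> turns the Cohen inequality of \<open>A\<close> into an estimate of the weighted sums
  \<open>\<Sum>\<^sub>i l\<^sub>i \<bar>y\<^sub>i (T x\<^sub>i)\<bar>\<close>. The converse of Hoelder's inequality (\<open>ell_norm_le_by_duality\<close>) recovers from it the
  \<open>\<ell>\<^sub>p\<close>-norm of \<open>y\<^sub>i (T x\<^sub>i)\<close>, and Hoelder's inequality (\<open>ell_norm_prod_le\<close>) separates the factors
  \<open>nrm (u\<^sub>j x\<^sub>i\<^sub>j)\<close>, which are controlled by the summing inequalities (\<open>dominated_of_factorization\<close>).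

  For the other direction, the idea is Pietsch's: replace the suprema over dual unit balls that
  occur in the weak norms by averages. By the inequality of the weighted means, the defining
  inequality of a dominated operator implies that sums of values \<open>\<bar>y (T x)\<bar>\<^sup>p\<close> are bounded by a sum of
  suprema, one for each component. A sum of suprema is a sublinear functional on the bounded
  functions on the disjoint union of the dual balls, and the Hahn--Banach theorem for a convex cone
  of constraints (\<open>hahn_banach_cone\<close>) yields a mean on each dual ball such that the inequality with the
  suprema replaced by means holds for every single \<open>(x, y)\<close> (\<open>exists_dominating_means\<close>). Scaling the
  components restores the product (\<open>domination\<close>), so that
  \<open>\<bar>y (T x)\<bar> \<le> C * (\<Prod>\<^sub>j g\<^sub>j x\<^sub>j) * H y\<close> for positive \<open>x\<^sub>j\<close> and \<open>y\<close>, with seminorms \<open>g\<^sub>j\<close> and a function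
  \<open>H\<close> that satisfy the summing inequalities with constant \<open>1\<close>
  (\<open>dominated_by_summing_functions\<close>).

  The estimate holds on the positive cones only. Replacing \<open>g\<^sub>j\<close> by the infimum of \<open>g\<^sub>j a + g\<^sub>j b\<close> over the
  decompositions \<open>x\<^sub>j = a - b\<close> into positive vectors extends it to all \<open>x\<^sub>j\<close> with the same constant and
  does not increase the seminorms on the cones (\<open>multilinear_cone_norm_bound\<close>). Since the positive
  functionals determine the norm of \<open>F\<close> up to a factor \<open>2\<close>, \<open>T\<close> is bounded in these seminorms and
  extends to the completions \<open>X\<^sub>j\<close> of \<open>E\<^sub>j\<close> (\<open>extension_to_completions\<close>). The extension is \<open>A\<close>, with
  Cohen constant at most \<open>C\<close>, and the canonical maps \<open>E\<^sub>j \<rightarrow> X\<^sub>j\<close> are the \<open>u\<^sub>j\<close>, with summing constants at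
  most \<open>1\<close> (\<open>factorization_of_dominated\<close>). As no constants are lost in either direction, the formula
  for the norm follows. The points of \<open>X\<^sub>j\<close> are represented by sequences in \<open>E\<^sub>j\<close>, which is where the
  injection \<open>\<iota>\<close> is used.
\<close>

section \<open>Exponents and the Hoelder inequality\<close>

(* The index sets {1..n} and {1..m} would otherwise be rewritten to {Suc 0..n} and {Suc 0..m}. *)
declare One_nat_def [simp del]

text \<open>
  In terms of the real number \<open>1 / q\<close>, which is \<open>0\<close> for \<open>q = \<infinity>\<close>, the relations between exponents
  become linear equations.
\<close>

definition recip :: "ennreal \<Rightarrow> real" where
  "recip q = enn2real (1 / q)"

lemma exponent_cases:
  assumes "1 \<le> q"
  obtains (infinite) "q = \<infinity>" "recip q = 0"
  | (finite) "q \<noteq> \<infinity>" "0 < recip q" "recip q \<le> 1" "enn2real q = 1 / recip q"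
proof (cases q)
  case top
  then show ?thesis using infinite by (simp add: recip_def)
next
  case (real a)
  then have "1 \<le> a" using assms by (metis ennreal_1 ennreal_le_iff)
  moreover have "recip q = 1 / a"
    using real \<open>1 \<le> a\<close> unfolding recip_def
    by (metis divide_ennreal enn2real_ennreal ennreal_1 less_le_trans zero_le_divide_1_iff zero_le_one zero_less_one)
  ultimately show ?thesis using finite real by simp
qed

lemma recip_bounds:
  assumes "1 \<le> q" shows "0 \<le> recip q" "recip q \<le> 1"
  using assms by (auto elim: exponent_cases)

lemma recip_eq_0_iff:
  assumes "1 \<le> q" shows "recip q = 0 \<longleftrightarrow> q = \<infinity>"
  using assms by (auto elim: exponent_cases)

lemma inverse_exponent_le_1:
  fixes q :: ennreal
  assumes "1 \<le> q" shows "1 / q \<le> 1"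
  using assms by (metis divide_le_posI_ennreal mult.right_neutral not_gr_zero not_one_le_zero)

lemma inverse_exponent:
  assumes "1 \<le> q" shows "1 / q = ennreal (recip q)"
  unfolding recip_def using inverse_exponent_le_1[OF assms]
  by (metis ennreal_enn2real ennreal_one_less_top le_less_trans)

lemma conj_exp_ge_1:
  assumes "1 \<le> q" shows "1 \<le> conj_exp q"
proof (rule ccontr)
  assume "\<not> 1 \<le> conj_exp q"
  then have lt: "conj_exp q < 1" by simp
  have le: "1 / conj_exp q \<le> 1"
    using conj_exp(1)[OF assms] by (metis add_increasing2 add.commute order_refl zero_le)
  show False
  proof (cases "conj_exp q")
    case top then show False using lt by simp
  next
    case (real a)
    then have a: "0 \<le> a" "a < 1" using lt by (auto simp: ennreal_less_one_iff)
    show False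
    proof (cases "a = 0")
      case True
        then have "1 / conj_exp q = \<infinity>" using real by (simp add: divide_ennreal_def)
        then show False using le by (metis ennreal_one_less_top infinity_ennreal_def leD)
    next
      case False
      then have "1 / conj_exp q = ennreal (1 / a)"
        using real a by (metis divide_ennreal ennreal_1 le_less zero_le_one)
      then have "1 / a \<le> 1" using le by (simp add: ennreal_le_1)
      then show False using a False by (simp add: field_simps)
    qed
  qed
qed

lemma recip_conj_exp:
  assumes "1 \<le> q" shows "recip (conj_exp q) = 1 - recip q"
proof -
  have "ennreal (recip q + recip (conj_exp q)) = ennreal 1"
    using conj_exp(1)[OF assms] recip_bounds[OF assms] recip_bounds[OF conj_exp_ge_1[OF assms]]
    by (simp add: inverse_exponent assms conj_exp_ge_1)
  then have "recip q + recip (conj_exp q) = 1"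
    using recip_bounds[OF assms] recip_bounds[OF conj_exp_ge_1[OF assms]]
    by (metis add_nonneg_nonneg ennreal_inj zero_le_one)
  then show ?thesis by simp
qed

lemma ell_norm_infinity: "ell_norm \<infinity> n a = Max (insert 0 ((\<lambda>i. \<bar>a i\<bar>) ` {1..n}))"
  by (simp add: ell_norm_def)

lemma ell_norm_finite:
  assumes "1 \<le> q" "recip q \<noteq> 0"
  shows "ell_norm q n a = (\<Sum>i=1..n. \<bar>a i\<bar> powr (1 / recip q)) powr recip q"
  using assms(1)
proof (cases rule: exponent_cases)
  case finite
  then show ?thesis unfolding ell_norm_def finite(4) by simp
qed (use assms in simp)

lemma ell_norm_nonneg: "0 \<le> ell_norm q n a"
  by (simp add: ell_norm_def)

lemma abs_le_ell_norm_infinity: "i \<in> {1..n} \<Longrightarrow> \<bar>a i\<bar> \<le> ell_norm \<infinity> n a"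
  unfolding ell_norm_infinity by (intro Max_ge) auto

lemma ell_norm_infinity_le:
  assumes "0 \<le> D" "\<And>i. i \<in> {1..n} \<Longrightarrow> \<bar>a i\<bar> \<le> D"
  shows "ell_norm \<infinity> n a \<le> D"
  unfolding ell_norm_infinity using assms by auto

lemma ell_norm_mono:
  assumes "1 \<le> q" "\<And>i. i \<in> {1..n} \<Longrightarrow> \<bar>a i\<bar> \<le> \<bar>b i\<bar>"
  shows "ell_norm q n a \<le> ell_norm q n b"
  using assms(1)
proof (cases rule: exponent_cases)
  case infinite
  have "ell_norm \<infinity> n a \<le> ell_norm \<infinity> n b"
    using assms(2) abs_le_ell_norm_infinity[of _ n b]
    by (intro ell_norm_infinity_le ell_norm_nonneg) force
  then show ?thesis using infinite by simp
next
  case finite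
  then show ?thesis
    using assms by (auto simp: ell_norm_finite intro!: powr_mono2 sum_mono sum_nonneg)
qed

lemma ell_norm_cong:
  "(\<And>i. i \<in> {1..n} \<Longrightarrow> \<bar>a i\<bar> = \<bar>b i\<bar>) \<Longrightarrow> ell_norm q n a = ell_norm q n b"
  by (simp add: ell_norm_def cong: image_cong_simp)

lemma ell_norm_single:
  assumes "1 \<le> q" shows "ell_norm q 1 a = \<bar>a 1\<bar>"
  using assms
proof (cases rule: exponent_cases)
  case infinite
  then show ?thesis using ell_norm_infinity[of 1 a] by (simp add: max_def)
next
  case finite
  then show ?thesis using assms by (simp add: ell_norm_finite powr_powr)
qed

lemma recip_1 [simp]: "recip 1 = 1"
  by (simp add: recip_def)

lemma ell_norm_1: "ell_norm 1 n a = (\<Sum>i=1..n. \<bar>a i\<bar>)"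
  by (simp add: ell_norm_finite sum_nonneg)

text \<open>The weighted inequality of the means is the convexity of the exponential function.\<close>

lemma weighted_arith_geo_mean:
  fixes \<theta> u :: "'i \<Rightarrow> real"
  assumes "finite J" and \<theta>: "\<And>j. j \<in> J \<Longrightarrow> 0 < \<theta> j" and sum1: "sum \<theta> J = 1"
    and u: "\<And>j. j \<in> J \<Longrightarrow> 0 \<le> u j"
  shows "(\<Prod>j\<in>J. u j powr \<theta> j) \<le> (\<Sum>j\<in>J. \<theta> j * u j)"
proof (cases "\<exists>j\<in>J. u j = 0")
  case True
  then have "(\<Prod>j\<in>J. u j powr \<theta> j) = 0" using \<open>finite J\<close> by (auto simp: prod_zero_iff)
  then show ?thesis using \<theta> u by (simp add: sum_nonneg less_imp_le)
next
  case False
  then have pos: "0 < u j" if "j \<in> J" for j using u that by (metis le_less)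
  have "(\<Prod>j\<in>J. u j powr \<theta> j) = exp (\<Sum>j\<in>J. \<theta> j *\<^sub>R ln (u j))"
    using pos False by (simp add: exp_sum \<open>finite J\<close> powr_def)
  also have "\<dots> \<le> (\<Sum>j\<in>J. \<theta> j * exp (ln (u j)))"
    using \<theta> sum1 u \<open>finite J\<close> False
    by (intro convex_on_sum[OF \<open>finite J\<close> _ exp_convex]) (auto intro: less_imp_le)
  also have "\<dots> = (\<Sum>j\<in>J. \<theta> j * u j)"
    using pos by (intro sum.cong) auto
  finally show ?thesis .
qed

text \<open>
  After each sum over \<open>i\<close> has been normalised to \<open>1\<close>, this is the inequality of the weighted
  means, applied for every \<open>i\<close> and added up.
\<close>

lemma sum_prod_powr_le:
  fixes a :: "'i \<Rightarrow> 'k \<Rightarrow> real"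
  assumes "finite J" "finite A" and \<theta>: "\<And>j. j \<in> J \<Longrightarrow> 0 < \<theta> j" and sum1: "sum \<theta> J = 1"
    and a: "\<And>j i. j \<in> J \<Longrightarrow> i \<in> A \<Longrightarrow> 0 \<le> a j i"
  shows "(\<Sum>i\<in>A. \<Prod>j\<in>J. a j i powr \<theta> j) \<le> (\<Prod>j\<in>J. (\<Sum>i\<in>A. a j i) powr \<theta> j)"
proof (cases "\<exists>j\<in>J. (\<Sum>i\<in>A. a j i) = 0")
  case True
  then obtain j where j: "j \<in> J" "(\<Sum>i\<in>A. a j i) = 0" by blast
  then have "a j i = 0" if "i \<in> A" for i
    using sum_nonneg_eq_0_iff[OF \<open>finite A\<close>, of "a j"] a that by auto
  then have "(\<Sum>i\<in>A. \<Prod>j\<in>J. a j i powr \<theta> j) = 0"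
    using j \<open>finite J\<close> by (intro sum.neutral ballI) (auto simp: prod_zero_iff)
  then show ?thesis by (simp add: prod_nonneg)
next
  case False
  define S where "S j = (\<Sum>i\<in>A. a j i)" for j
  have S: "0 < S j" if "j \<in> J" for j
    using False a that unfolding S_def by (metis (no_types, lifting) le_less sum_nonneg)
  have "(\<Sum>i\<in>A. \<Prod>j\<in>J. a j i powr \<theta> j)
      = (\<Prod>j\<in>J. S j powr \<theta> j) * (\<Sum>i\<in>A. \<Prod>j\<in>J. (a j i / S j) powr \<theta> j)"
    unfolding sum_distrib_left prod.distrib[symmetric]
  proof (intro sum.cong prod.cong refl)
    fix i j assume "i \<in> A" "j \<in> J"
    then show "a j i powr \<theta> j = S j powr \<theta> j * (a j i / S j) powr \<theta> j"
      using S[of j] a by (subst powr_mult[symmetric]) auto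
  qed
  also have "(\<Sum>i\<in>A. \<Prod>j\<in>J. (a j i / S j) powr \<theta> j) \<le> (\<Sum>i\<in>A. \<Sum>j\<in>J. \<theta> j * (a j i / S j))"
    using S a assms(1) \<theta> sum1
    by (intro sum_mono weighted_arith_geo_mean) (auto intro: divide_nonneg_pos)
  also have "\<dots> = (\<Sum>j\<in>J. \<theta> j * (\<Sum>i\<in>A. a j i) / S j)"
    by (subst sum.swap) (simp add: sum_distrib_left sum_divide_distrib)
  also have "\<dots> = 1"
    using S sum1 unfolding S_def[symmetric] by (metis (no_types, lifting) less_irrefl nonzero_mult_div_cancel_right sum.cong)
  finally show ?thesis
    unfolding S_def by (simp add: mult_left_mono mult_left_le prod_nonneg)
qed

text \<open>
  Hoelder's inequality for finitely many factors: the factors with exponent \<open>\<infinity>\<close> are replaced by their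
  maxima, and the others are treated by the preceding lemma with the weights \<open>s / q\<^sub>j\<close>.
\<close>

theorem ell_norm_prod_le:
  fixes b :: "'i \<Rightarrow> nat \<Rightarrow> real"
  assumes "finite I" and q: "\<And>j. j \<in> I \<Longrightarrow> 1 \<le> q j" and "1 \<le> s"
    and recip: "recip s = (\<Sum>j\<in>I. recip (q j))"
  shows "ell_norm s n (\<lambda>i. \<Prod>j\<in>I. b j i) \<le> (\<Prod>j\<in>I. ell_norm (q j) n (b j))"
  using \<open>1 \<le> s\<close>
proof (cases rule: exponent_cases)
  case infinite
  then have "recip (q j) = 0" if "j \<in> I" for j
    using recip recip_bounds(1)[OF q] that \<open>finite I\<close> by (simp add: sum_nonneg_eq_0_iff)
  then have inf: "q j = \<infinity>" if "j \<in> I" for j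
    using recip_eq_0_iff[OF q] that by auto
  have "ell_norm \<infinity> n (\<lambda>i. \<Prod>j\<in>I. b j i) \<le> (\<Prod>j\<in>I. ell_norm \<infinity> n (b j))"
    by (intro ell_norm_infinity_le prod_nonneg ell_norm_nonneg)
      (auto simp: abs_prod simp del: infinity_ennreal_def intro!: prod_mono abs_le_ell_norm_infinity)
  then show ?thesis using inf infinite by simp
next
  case finite
  define \<sigma> where "\<sigma> = recip s"
  have \<sigma>: "0 < \<sigma>" using finite by (simp add: \<sigma>_def)
  define J where "J = {j\<in>I. recip (q j) \<noteq> 0}"
  define J' where "J' = {j\<in>I. recip (q j) = 0}"
  have J: "finite J" "finite J'" "J \<inter> J' = {}" "I = J' \<union> J"
    using \<open>finite I\<close> by (auto simp: J_def J'_def)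
  define \<rho> where "\<rho> j = recip (q j)" for j
  have \<rho>: "0 < \<rho> j" "1 \<le> q j" if "j \<in> J" for j
    using that recip_bounds(1)[OF q] q[of j] by (auto simp: J_def \<rho>_def less_le)
  have inf: "q j = \<infinity>" if "j \<in> J'" for j
    using that recip_eq_0_iff[OF q] by (auto simp: J'_def)
  have "(\<Sum>j\<in>I. recip (q j)) = (\<Sum>j\<in>J. \<rho> j)"
    unfolding \<rho>_def using \<open>finite I\<close> by (intro sum.mono_neutral_right) (auto simp: J_def)
  then have sum\<rho>: "(\<Sum>j\<in>J. \<rho> j) = \<sigma>" using recip by (simp add: \<sigma>_def)
  define M where "M = (\<Prod>j\<in>J'. ell_norm (q j) n (b j))"
  have M: "0 \<le> M" by (simp add: M_def prod_nonneg ell_norm_nonneg)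
  have "(\<Sum>i=1..n. \<bar>\<Prod>j\<in>I. b j i\<bar> powr (1 / \<sigma>))
      \<le> (\<Sum>i=1..n. M powr (1 / \<sigma>) * (\<Prod>j\<in>J. (\<bar>b j i\<bar> powr (1 / \<rho> j)) powr (\<rho> j / \<sigma>)))"
  proof (intro sum_mono)
    fix i assume i: "i \<in> {1..n}"
    have "\<bar>\<Prod>j\<in>I. b j i\<bar> = (\<Prod>j\<in>J'. \<bar>b j i\<bar>) * (\<Prod>j\<in>J. \<bar>b j i\<bar>)"
      using J by (simp add: abs_mult abs_prod prod.union_disjoint Int_commute)
    also have "\<dots> \<le> M * (\<Prod>j\<in>J. \<bar>b j i\<bar>)"
      unfolding M_def using i inf
      by (intro mult_right_mono prod_mono prod_nonneg)
        (auto simp del: infinity_ennreal_def intro: abs_le_ell_norm_infinity)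
    finally have "\<bar>\<Prod>j\<in>I. b j i\<bar> powr (1 / \<sigma>) \<le> (M * (\<Prod>j\<in>J. \<bar>b j i\<bar>)) powr (1 / \<sigma>)"
      using \<sigma> by (intro powr_mono2) auto
    also have "\<dots> = M powr (1 / \<sigma>) * (\<Prod>j\<in>J. \<bar>b j i\<bar> powr (1 / \<sigma>))"
      using M by (simp add: powr_mult prod_nonneg prod_powr_distrib)
    also have "(\<Prod>j\<in>J. \<bar>b j i\<bar> powr (1 / \<sigma>)) = (\<Prod>j\<in>J. (\<bar>b j i\<bar> powr (1 / \<rho> j)) powr (\<rho> j / \<sigma>))"
      using \<rho> by (intro prod.cong refl) (force simp: powr_powr)
    finally show "\<bar>\<Prod>j\<in>I. b j i\<bar> powr (1 / \<sigma>)
        \<le> M powr (1 / \<sigma>) * (\<Prod>j\<in>J. (\<bar>b j i\<bar> powr (1 / \<rho> j)) powr (\<rho> j / \<sigma>))" .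
  qed
  also have "\<dots> \<le> M powr (1 / \<sigma>) * (\<Prod>j\<in>J. (\<Sum>i=1..n. \<bar>b j i\<bar> powr (1 / \<rho> j)) powr (\<rho> j / \<sigma>))"
    unfolding sum_distrib_left[symmetric]
    using J \<rho> \<sigma> sum\<rho>
    by (intro mult_left_mono sum_prod_powr_le) (auto simp: sum_divide_distrib[symmetric])
  finally have "(\<Sum>i=1..n. \<bar>\<Prod>j\<in>I. b j i\<bar> powr (1 / \<sigma>)) powr \<sigma>
      \<le> (M powr (1 / \<sigma>) * (\<Prod>j\<in>J. (\<Sum>i=1..n. \<bar>b j i\<bar> powr (1 / \<rho> j)) powr (\<rho> j / \<sigma>))) powr \<sigma>"
    using \<sigma> by (intro powr_mono2) (auto intro: sum_nonneg)
  also have "\<dots> = M * (\<Prod>j\<in>J. (\<Sum>i=1..n. \<bar>b j i\<bar> powr (1 / \<rho> j)) powr \<rho> j)"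
    using \<sigma> M by (simp add: powr_mult prod_nonneg powr_powr prod_powr_distrib)
  also have "(\<Prod>j\<in>J. (\<Sum>i=1..n. \<bar>b j i\<bar> powr (1 / \<rho> j)) powr \<rho> j) = (\<Prod>j\<in>J. ell_norm (q j) n (b j))"
    using \<rho> by (intro prod.cong refl) (force simp: ell_norm_finite \<rho>_def)
  also have "M * \<dots> = (\<Prod>j\<in>I. ell_norm (q j) n (b j))"
    unfolding M_def using J by (simp add: prod.union_disjoint Int_commute)
  finally show ?thesis
    using finite \<open>1 \<le> s\<close> by (simp add: ell_norm_finite \<sigma>_def)
qed

lemma ell_norm_mult_le:
  assumes "1 \<le> q" "1 \<le> q'" "1 \<le> s" "recip s = recip q + recip q'"
  shows "ell_norm s n (\<lambda>i. a i * b i) \<le> ell_norm q n a * ell_norm q' n b"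
  using ell_norm_prod_le[of UNIV "\<lambda>j. if j then q else q'" s n "\<lambda>j. if j then a else b"] assms
  by (simp add: UNIV_bool mult.commute add.commute)

text \<open>
  The converse of the Hoelder inequality: the extremal weights are \<open>l\<^sub>i = a\<^sub>i\<^sup>p\<^sup>-\<^sup>1\<close>, and unit vectors if
  \<open>p = \<infinity>\<close>.
\<close>

lemma ell_norm_le_by_duality:
  assumes "1 \<le> p" "0 \<le> D" and a: "\<And>i. i \<in> {1..n} \<Longrightarrow> 0 \<le> a i"
    and D: "\<And>l. (\<And>i. i \<in> {1..n} \<Longrightarrow> 0 \<le> l i) \<Longrightarrow> (\<Sum>i=1..n. l i * a i) \<le> D * ell_norm (conj_exp p) n l"
  shows "ell_norm p n a \<le> D"
  using assms(1)
proof (cases rule: exponent_cases)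
  case infinite
  have "ell_norm \<infinity> n a \<le> D"
  proof (intro ell_norm_infinity_le \<open>0 \<le> D\<close>)
    fix i assume i: "i \<in> {1..n}"
    have "a i = (\<Sum>k=1..n. (if k = i then 1 else 0) * a k)"
      using i by (simp add: if_distrib[of "\<lambda>c. c * _"] cong: if_cong)
    also have "\<dots> \<le> D * ell_norm (conj_exp p) n (\<lambda>k. if k = i then 1 else 0)"
      by (intro D) auto
    also have "conj_exp p = 1" using infinite by (simp add: conj_exp_def)
    also have "ell_norm 1 n (\<lambda>k. if k = i then 1 else 0) = 1"
      using i by (simp add: ell_norm_1 if_distrib cong: if_cong)
    finally show "\<bar>a i\<bar> \<le> D" using a i by simp
  qed
  then show ?thesis using infinite by simp
next
  case finite
  define \<rho> where "\<rho> = recip p"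
  have \<rho>: "0 < \<rho>" "\<rho> \<le> 1" using finite by (auto simp: \<rho>_def)
  define S where "S = (\<Sum>i=1..n. a i powr (1 / \<rho>))"
  have S: "0 \<le> S" by (simp add: S_def sum_nonneg)
  define l where "l i = a i powr (1 / \<rho> - 1)" for i
  have "S = (\<Sum>i=1..n. l i * a i)"
    unfolding S_def l_def
  proof (intro sum.cong refl)
    fix i assume "i \<in> {1..n}"
    then show "a i powr (1 / \<rho>) = a i powr (1 / \<rho> - 1) * a i"
      using powr_mult_base[OF a[of i], of "1 / \<rho> - 1"] by (simp add: mult.commute)
  qed
  also have "\<dots> \<le> D * ell_norm (conj_exp p) n l"
    by (intro D) (simp add: l_def)
  also have "\<dots> \<le> D * S powr (1 - \<rho>)"
  proof (intro mult_left_mono \<open>0 \<le> D\<close>)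
    show "ell_norm (conj_exp p) n l \<le> S powr (1 - \<rho>)"
    proof (cases "\<rho> = 1")
      case True
      then have inf: "conj_exp p = \<infinity>"
        using recip_conj_exp[OF assms(1)] recip_eq_0_iff[OF conj_exp_ge_1[OF assms(1)]] by (simp add: \<rho>_def)
      show ?thesis
      proof (cases "S = 0")
        case True
        then have "a i = 0" if "i \<in> {1..n}" for i
          using sum_nonneg_eq_0_iff[of "{1..n}" "\<lambda>i. a i powr (1 / \<rho>)"] that \<rho> a by (auto simp: S_def)
        then show ?thesis
          unfolding inf using S True by (intro ell_norm_infinity_le) (auto simp: l_def)
      next
        case False
        then show ?thesis unfolding inf using True
          by (intro ell_norm_infinity_le) (auto simp: l_def)
      qed
    next
      case False
      then have "ell_norm (conj_exp p) n l = (\<Sum>i=1..n. l i powr (1 / (1 - \<rho>))) powr (1 - \<rho>)"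
        using conj_exp_ge_1[OF assms(1)] recip_conj_exp[OF assms(1)]
        by (simp add: ell_norm_finite \<rho>_def l_def)
      also have "(\<Sum>i=1..n. l i powr (1 / (1 - \<rho>))) = S"
        unfolding l_def powr_powr S_def using \<rho> False
        by (intro sum.cong refl arg_cong2[of _ _ _ _ "(powr)"]) (simp add: field_simps)
      finally show ?thesis by simp
    qed
  qed
  finally have le: "S \<le> D * S powr (1 - \<rho>)" .
  have "S powr \<rho> \<le> D"
  proof (cases "S = 0")
    case True then show ?thesis using \<open>0 \<le> D\<close> by simp
  next
    case False
    then have "S powr \<rho> * S powr (1 - \<rho>) \<le> D * S powr (1 - \<rho>)"
      using le S by (simp add: powr_add[symmetric])
    then show ?thesis using False S by simp
  qed
  then show ?thesis
    using finite assms(1) a by (simp add: ell_norm_finite \<rho>_def S_def)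
qed

section \<open>Sublinear functionals and the Hahn--Banach theorem\<close>

lemma real_line_simps [simp]:
  "carrier real_line = UNIV" "a \<otimes>\<^bsub>real_line\<^esub> b = a * b" "\<one>\<^bsub>real_line\<^esub> = 1" "\<zero>\<^bsub>real_line\<^esub> = 0"
  "a \<oplus>\<^bsub>real_line\<^esub> b = a + b" "a \<odot>\<^bsub>real_line\<^esub> b = a * b" "nrm real_line a = \<bar>a\<bar>"
  by (simp_all add: real_line_def)

lemma cring_real_line: "cring real_line"
proof (intro cringI abelian_groupI comm_monoidI)
  fix x :: real
  show "\<exists>y\<in>carrier real_line. y \<oplus>\<^bsub>real_line\<^esub> x = \<zero>\<^bsub>real_line\<^esub>"
    by (auto intro!: exI[of _ "- x"])
qed (auto simp: algebra_simps)

lemma real_line_uminus [simp]: "\<ominus>\<^bsub>real_line\<^esub> a = - a"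
proof -
  interpret cring real_line by (rule cring_real_line)
  show ?thesis by (rule minus_equality) auto
qed

text \<open>
  Modules over \<open>real_line\<close>, with the module laws restated in terms of the arithmetic of the real numbers.
\<close>

locale real_space = Module.module real_line V for V :: "(real, 'a, 'z) module_scheme" (structure)

sublocale banach_space \<subseteq> real_space ..

context real_space
begin

lemma scale_closed [simp, intro]: "x \<in> carrier V \<Longrightarrow> a \<odot>\<^bsub>V\<^esub> x \<in> carrier V"
  using smult_closed[of a x] by simp

lemma scale_add: "x \<in> carrier V \<Longrightarrow> y \<in> carrier V \<Longrightarrow> a \<odot>\<^bsub>V\<^esub> (x \<oplus>\<^bsub>V\<^esub> y) = a \<odot>\<^bsub>V\<^esub> x \<oplus>\<^bsub>V\<^esub> a \<odot>\<^bsub>V\<^esub> y"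
  using smult_r_distr[of a x y] by simp

lemma add_scale: "x \<in> carrier V \<Longrightarrow> (a + b) \<odot>\<^bsub>V\<^esub> x = a \<odot>\<^bsub>V\<^esub> x \<oplus>\<^bsub>V\<^esub> b \<odot>\<^bsub>V\<^esub> x"
  using smult_l_distr[of a b x] by simp

lemma scale_scale: "x \<in> carrier V \<Longrightarrow> a \<odot>\<^bsub>V\<^esub> (b \<odot>\<^bsub>V\<^esub> x) = (a * b) \<odot>\<^bsub>V\<^esub> x"
  using smult_assoc1[of a b x] by simp

lemma one_scale [simp]: "x \<in> carrier V \<Longrightarrow> 1 \<odot>\<^bsub>V\<^esub> x = x"
  using smult_one[of x] by simp

lemma zero_scale [simp]: "x \<in> carrier V \<Longrightarrow> 0 \<odot>\<^bsub>V\<^esub> x = \<zero>\<^bsub>V\<^esub>"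
  using smult_l_null[of x] by simp

lemma scale_zero [simp]: "a \<odot>\<^bsub>V\<^esub> \<zero>\<^bsub>V\<^esub> = \<zero>\<^bsub>V\<^esub>"
  using smult_r_null[of a] by simp

lemma scale_uminus: "x \<in> carrier V \<Longrightarrow> a \<odot>\<^bsub>V\<^esub> (\<ominus>\<^bsub>V\<^esub> x) = \<ominus>\<^bsub>V\<^esub> (a \<odot>\<^bsub>V\<^esub> x)"
  using smult_r_minus[of a x] by simp

lemma uminus_scale: "x \<in> carrier V \<Longrightarrow> (- a) \<odot>\<^bsub>V\<^esub> x = \<ominus>\<^bsub>V\<^esub> (a \<odot>\<^bsub>V\<^esub> x)"
  using smult_l_minus[of a x] by simp

lemma scale_minus: "x \<in> carrier V \<Longrightarrow> y \<in> carrier V \<Longrightarrow> a \<odot>\<^bsub>V\<^esub> (x \<ominus>\<^bsub>V\<^esub> y) = a \<odot>\<^bsub>V\<^esub> x \<ominus>\<^bsub>V\<^esub> a \<odot>\<^bsub>V\<^esub> y"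
  by (simp add: minus_eq scale_add scale_uminus)

lemma uminus_conv_scale: "x \<in> carrier V \<Longrightarrow> \<ominus>\<^bsub>V\<^esub> x = (-1) \<odot>\<^bsub>V\<^esub> x"
  using uminus_scale[of x 1] by simp

end

definition sublinear :: "(real, 'a, 'z) module_scheme \<Rightarrow> ('a \<Rightarrow> real) \<Rightarrow> bool" where
  "sublinear V q \<longleftrightarrow>
     (\<forall>x\<in>carrier V. \<forall>y\<in>carrier V. q (x \<oplus>\<^bsub>V\<^esub> y) \<le> q x + q y) \<and>
     (\<forall>x\<in>carrier V. \<forall>t\<ge>0. q (t \<odot>\<^bsub>V\<^esub> x) = t * q x)"

definition linear_functional :: "(real, 'a, 'z) module_scheme \<Rightarrow> ('a \<Rightarrow> real) \<Rightarrow> bool" where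
  "linear_functional V f \<longleftrightarrow>
     (\<forall>x\<in>carrier V. \<forall>y\<in>carrier V. f (x \<oplus>\<^bsub>V\<^esub> y) = f x + f y) \<and>
     (\<forall>x\<in>carrier V. \<forall>t. f (t \<odot>\<^bsub>V\<^esub> x) = t * f x)"

text \<open>
  A pair \<open>(c, b)\<close> of a vector and a number stands for the constraint \<open>b \<le> f c\<close> on a linear functional
  \<open>f\<close>; such constraints may be added and multiplied by positive numbers.
\<close>

definition convex_cone :: "(real, 'a, 'z) module_scheme \<Rightarrow> ('a \<times> real) set \<Rightarrow> bool" where
  "convex_cone V K \<longleftrightarrow> K \<subseteq> carrier V \<times> UNIV \<and> (\<zero>\<^bsub>V\<^esub>, 0) \<in> K \<and>
     (\<forall>c b c' b'. (c, b) \<in> K \<longrightarrow> (c', b') \<in> K \<longrightarrow> (c \<oplus>\<^bsub>V\<^esub> c', b + b') \<in> K) \<and>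
     (\<forall>c b t. (c, b) \<in> K \<longrightarrow> 0 < t \<longrightarrow> (t \<odot>\<^bsub>V\<^esub> c, t * b) \<in> K)"

context real_space
begin

lemma sublinear_add: "sublinear V q \<Longrightarrow> x \<in> carrier V \<Longrightarrow> y \<in> carrier V \<Longrightarrow> q (x \<oplus> y) \<le> q x + q y"
  by (simp add: sublinear_def)

lemma sublinear_scale: "sublinear V q \<Longrightarrow> x \<in> carrier V \<Longrightarrow> 0 \<le> t \<Longrightarrow> q (t \<odot> x) = t * q x"
  by (simp add: sublinear_def)

lemma sublinear_zero: "sublinear V q \<Longrightarrow> q \<zero> = 0"
  using sublinear_scale[of q \<zero> 0] by simp

lemma sublinear_uminus: "sublinear V q \<Longrightarrow> x \<in> carrier V \<Longrightarrow> - q (\<ominus> x) \<le> q x"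
  using sublinear_add[of q x "\<ominus> x"] sublinear_zero[of q] by (simp add: r_neg)

text \<open>
  Minkowski's device for lowering a sublinear functional: shifting along a cone of vectors \<open>c\<close>
  with prescribed lower bounds \<open>b\<close> gives the largest sublinear functional below \<open>q\<close> all of whose
  linear minorants \<open>f\<close> satisfy \<open>f c \<ge> b\<close>.
\<close>

lemma sublinear_shift:
  assumes q: "sublinear V q"
    and cone: "convex_cone V K" and le: "\<forall>(c, b)\<in>K. b \<le> q c"
  defines "q' \<equiv> \<lambda>x. INF (c, b)\<in>K. q (x \<oplus> c) - b"
  shows "sublinear V q'" "\<And>x. x \<in> carrier V \<Longrightarrow> q' x \<le> q x"
    "\<And>c b. (c, b) \<in> K \<Longrightarrow> q' (\<ominus> c) \<le> - b"
proof -
  have K: "K \<subseteq> carrier V \<times> UNIV" "(\<zero>, 0) \<in> K"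
    and K_add: "\<And>c b c' b'. (c, b) \<in> K \<Longrightarrow> (c', b') \<in> K \<Longrightarrow> (c \<oplus> c', b + b') \<in> K"
    and K_scale: "\<And>c b t. (c, b) \<in> K \<Longrightarrow> 0 < t \<Longrightarrow> (t \<odot> c, t * b) \<in> K"
    using cone unfolding convex_cone_def by blast+
  have le: "b \<le> q c" if "(c, b) \<in> K" for c b using le that by auto
  have Kc: "c \<in> carrier V" if "(c, b) \<in> K" for c b using K that by auto
  have lower: "- q (\<ominus> x) \<le> q (x \<oplus> c) - b" if "x \<in> carrier V" "(c, b) \<in> K" for x c b
  proof -
    have "q c = q ((x \<oplus> c) \<oplus> (\<ominus> x))"
      using that Kc by (simp add: a_ac r_neg2 a_comm[of x] a_assoc r_neg)
    also have "\<dots> \<le> q (x \<oplus> c) + q (\<ominus> x)" using that Kc by (intro sublinear_add q) auto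
    finally show ?thesis using le[OF that(2)] by simp
  qed
  then have bdd: "bdd_below ((\<lambda>(c, b). q (x \<oplus> c) - b) ` K)" if "x \<in> carrier V" for x
    using that by (intro bdd_belowI2[where m = "- q (\<ominus> x)"]) auto
  have le_shift: "q' x \<le> q (x \<oplus> c) - b" if "x \<in> carrier V" "(c, b) \<in> K" for x c b
    unfolding q'_def using cINF_lower[OF bdd[OF that(1)] that(2)] by simp
  have ge_shift: "a \<le> q' x" if "\<And>c b. (c, b) \<in> K \<Longrightarrow> a \<le> q (x \<oplus> c) - b" for a x
    unfolding q'_def using that K(2) by (intro cINF_greatest) auto
  show *: "q' x \<le> q x" if "x \<in> carrier V" for x
    using le_shift[OF that K(2)] that by simp
  show "q' (\<ominus> c) \<le> - b" if "(c, b) \<in> K" for c b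
    using le_shift[OF _ that, of "\<ominus> c"] Kc[OF that] sublinear_zero[OF q] by (simp add: l_neg)
  have scale_le: "q' (t \<odot> x) \<le> t * q' x" if x: "x \<in> carrier V" and t: "0 < t" for x t
  proof -
    have "q' (t \<odot> x) / t \<le> q' x"
    proof (rule ge_shift)
      fix c b assume cb: "(c, b) \<in> K"
      have "q' (t \<odot> x) \<le> q (t \<odot> x \<oplus> t \<odot> c) - t * b"
        using x t by (intro le_shift K_scale cb) auto
      also have "\<dots> = t * (q (x \<oplus> c) - b)"
        using sublinear_scale[OF q, of "x \<oplus> c" t] x t Kc[OF cb] by (simp add: scale_add algebra_simps)
      finally show "q' (t \<odot> x) / t \<le> q (x \<oplus> c) - b"
        using t by (simp add: field_simps)
    qed
    then show ?thesis using t by (simp add: field_simps)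
  qed
  show "sublinear V q'"
    unfolding sublinear_def
  proof safe
    fix x y assume x: "x \<in> carrier V" and y: "y \<in> carrier V"
    have "q' (x \<oplus> y) - q' y \<le> q' x"
    proof (rule ge_shift)
      fix c b assume cb: "(c, b) \<in> K"
      have "q' (x \<oplus> y) - (q (x \<oplus> c) - b) \<le> q' y"
      proof (rule ge_shift)
        fix c' b' assume cb': "(c', b') \<in> K"
        have "q' (x \<oplus> y) \<le> q ((x \<oplus> y) \<oplus> (c \<oplus> c')) - (b + b')"
          using x y by (intro le_shift K_add cb cb') auto
        also have "(x \<oplus> y) \<oplus> (c \<oplus> c') = (x \<oplus> c) \<oplus> (y \<oplus> c')"
          using x y Kc[OF cb] Kc[OF cb'] by (simp add: a_ac)
        also have "q \<dots> \<le> q (x \<oplus> c) + q (y \<oplus> c')"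
          using x y Kc[OF cb] Kc[OF cb'] by (intro sublinear_add q) auto
        finally show "q' (x \<oplus> y) - (q (x \<oplus> c) - b) \<le> q (y \<oplus> c') - b'" by simp
      qed
      then show "q' (x \<oplus> y) - q' y \<le> q (x \<oplus> c) - b" by simp
    qed
    then show "q' (x \<oplus> y) \<le> q' x + q' y" by simp
  next
    fix x and t :: real assume x: "x \<in> carrier V" and t: "0 \<le> t"
    show "q' (t \<odot> x) = t * q' x"
    proof (cases "t = 0")
      case True
      have "0 \<le> q' \<zero>" using le Kc by (intro ge_shift) auto
      moreover have "q' \<zero> \<le> 0" using *[of \<zero>] sublinear_zero[OF q] by simp
      ultimately show ?thesis using True x by simp
    next
      case False
      then have t: "0 < t" using t by simp
      have "q' ((1 / t) \<odot> (t \<odot> x)) \<le> (1 / t) * q' (t \<odot> x)" using x t by (intro scale_le) auto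
      then have "t * q' x \<le> q' (t \<odot> x)" using x t by (simp add: scale_scale field_simps)
      then show ?thesis using scale_le[OF x t] by simp
    qed
  qed
qed

lemma ray_cone:
  assumes z: "z \<in> carrier V"
  shows "convex_cone V {(t \<odot> z, t * a) | t. 0 \<le> t}" (is "convex_cone V ?K")
  unfolding convex_cone_def
proof (intro conjI allI impI)
  show "?K \<subseteq> carrier V \<times> UNIV" using z by auto
  show "(\<zero>, 0) \<in> ?K" using z by (auto intro!: exI[of _ 0])
  fix c b c' b' assume "(c, b) \<in> ?K" "(c', b') \<in> ?K"
  then obtain s t where "0 \<le> s" "c = s \<odot> z" "b = s * a" "0 \<le> t" "c' = t \<odot> z" "b' = t * a"
    by blast
  then show "(c \<oplus> c', b + b') \<in> ?K" using z
    by (auto intro!: exI[of _ "s + t"] simp: add_scale algebra_simps)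
next
  fix c b and t :: real assume "(c, b) \<in> ?K" and t: "0 < t"
  then obtain s where "0 \<le> s" "c = s \<odot> z" "b = s * a" by blast
  then show "(t \<odot> c, t * b) \<in> ?K" using z t
    by (auto intro!: exI[of _ "t * s"] simp: scale_scale)
qed

text \<open>
  By Zorn's lemma there is a minimal sublinear functional below \<open>q\<close>. It is superadditive, because
  lowering it along the ray of a vector \<open>y\<close> by the value that it already has at \<open>y\<close> cannot
  change it.
\<close>

lemma sublinear_ge_linear_functional:
  assumes q: "sublinear V q"
  shows "\<exists>f. linear_functional V f \<and> (\<forall>x\<in>carrier V. f x \<le> q x)"
proof -
  define S where "S = {q'. sublinear V q' \<and> q' \<in> extensional (carrier V) \<and> (\<forall>x\<in>carrier V. q' x \<le> q x)}"
  define le where "le = (\<lambda>(f :: 'a \<Rightarrow> real) g. \<forall>x\<in>carrier V. g x \<le> f x)"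
  have restrict_S: "restrict q' (carrier V) \<in> S"
    if "sublinear V q'" "\<And>x. x \<in> carrier V \<Longrightarrow> q' x \<le> q x" for q'
    using that by (simp add: S_def sublinear_def)
  have "\<exists>m\<in>S. \<forall>a\<in>S. le m a \<longrightarrow> a = m"
  proof (rule predicate_Zorn)
    show "partial_order_on S (relation_of le S)"
      unfolding le_def
    proof (rule partial_order_on_relation_ofI)
      fix f g assume "f \<in> S" "g \<in> S" "\<forall>x\<in>carrier V. g x \<le> f x" "\<forall>x\<in>carrier V. f x \<le> g x"
      then show "f = g" by (intro extensionalityI[of _ "carrier V"]) (auto simp: S_def intro: antisym)
    qed (auto intro: order_trans)
  next
    fix C assume C: "C \<in> Chains (relation_of le S)"
    show "\<exists>u\<in>S. \<forall>a\<in>C. le a u"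
    proof (cases "C = {}")
      case True
      then show ?thesis using restrict_S[OF q] by auto
    next
      case False
      have CS: "C \<subseteq> S" and chain: "\<And>f g. f \<in> C \<Longrightarrow> g \<in> C \<Longrightarrow> le f g \<or> le g f"
        using C by (auto simp: Chains_def relation_of_def)
      have sub: "sublinear V f" if "f \<in> C" for f using CS that by (auto simp: S_def)
      have "- q (\<ominus> x) \<le> f x" if "f \<in> C" "x \<in> carrier V" for f x
        proof -
        have "f (\<ominus> x) \<le> q (\<ominus> x)" using CS that by (auto simp: S_def)
        then show ?thesis using sublinear_uminus[OF sub[OF that(1)] that(2)] by simp
      qed
      then have bdd: "bdd_below ((\<lambda>f. f x) ` C)" if "x \<in> carrier V" for x
        using that by (intro bdd_belowI2[where m = "- q (\<ominus> x)"]) auto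
      define u where "u x = (INF f\<in>C. f x)" for x
      have u_le: "u x \<le> f x" if "f \<in> C" "x \<in> carrier V" for f x
        unfolding u_def using that by (intro cINF_lower bdd)
      have u_ge: "a \<le> u x" if "\<And>f. f \<in> C \<Longrightarrow> a \<le> f x" for a x
        unfolding u_def using that False by (intro cINF_greatest) auto
      have "sublinear V u"
        unfolding sublinear_def
      proof safe
        fix x y assume x: "x \<in> carrier V" and y: "y \<in> carrier V"
        have "u (x \<oplus> y) - u y \<le> u x"
        proof (rule u_ge)
          fix f assume f: "f \<in> C"
          have "u (x \<oplus> y) - f x \<le> u y"
          proof (rule u_ge)
            fix g assume g: "g \<in> C"
            obtain h where h: "h \<in> C" "h x \<le> f x" "h y \<le> g y"
              using chain[OF f g] f g x y by (auto simp: le_def)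
            have "u (x \<oplus> y) \<le> h (x \<oplus> y)" using h x y by (intro u_le) auto
            also have "\<dots> \<le> h x + h y" using h x y by (intro sublinear_add sub)
            finally show "u (x \<oplus> y) - f x \<le> g y" using h by simp
          qed
          then show "u (x \<oplus> y) - u y \<le> f x" by simp
        qed
        then show "u (x \<oplus> y) \<le> u x + u y" by simp
      next
        fix x and t :: real assume x: "x \<in> carrier V" and t: "0 \<le> t"
        have "u (t \<odot> x) = (INF f\<in>C. t * f x)"
          unfolding u_def using x t sub by (intro INF_cong refl) (simp add: sublinear_scale)
        also have "\<dots> = t * u x"
        proof (rule antisym)
          show "t * u x \<le> (INF f\<in>C. t * f x)"
            using False u_le x t by (intro cINF_greatest mult_left_mono) auto
          have bdd': "bdd_below ((\<lambda>f. t * f x) ` C)"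
            using u_le x t by (intro bdd_belowI2[where m = "t * u x"] mult_left_mono) auto
          show "(INF f\<in>C. t * f x) \<le> t * u x"
          proof (cases "t = 0")
            case True then show ?thesis using False by simp
          next
            case t': False
            have "(INF f\<in>C. t * f x) / t \<le> u x"
            proof (rule u_ge)
              fix f assume "f \<in> C"
              then have "(INF f\<in>C. t * f x) \<le> t * f x" by (intro cINF_lower bdd')
              then show "(INF f\<in>C. t * f x) / t \<le> f x" using t t' by (simp add: field_simps)
            qed
            then show ?thesis using t t' by (simp add: field_simps)
          qed
        qed
        finally show "u (t \<odot> x) = t * u x" .
      qed
      moreover have "u x \<le> q x" if "x \<in> carrier V" for x
      proof -
        obtain f where "f \<in> C" using False by blast
        then show ?thesis using u_le[of f x] that CS by (force simp: S_def)
      qed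
      ultimately have "restrict u (carrier V) \<in> S" by (rule restrict_S)
      moreover have "\<forall>a\<in>C. le a (restrict u (carrier V))" using u_le by (auto simp: le_def)
      ultimately show ?thesis by blast
    qed
  qed
  then obtain f where f: "f \<in> S" and min: "\<And>g. g \<in> S \<Longrightarrow> le f g \<Longrightarrow> g = f" by blast
  have sub: "sublinear V f" and f_le: "\<And>x. x \<in> carrier V \<Longrightarrow> f x \<le> q x" using f by (auto simp: S_def)
  have superadd: "f x + f y \<le> f (x \<oplus> y)" if x: "x \<in> carrier V" and y: "y \<in> carrier V" for x y
  proof -
    define K where "K = {(t \<odot> y, t * f y) | t. 0 \<le> t}"
    define f' where "f' x = (INF (c, b)\<in>K. f (x \<oplus> c) - b)" for x
    have ray: "convex_cone V K" unfolding K_def by (rule ray_cone[OF y])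
    have Kle: "\<forall>(c, b)\<in>K. b \<le> f c"
      using y sublinear_scale[OF sub] by (auto simp: K_def)
    \<comment> \<open>The functional lowered along the ray of y is again a member of S, so minimality makes it equal to f.\<close>
    note shift = sublinear_shift[OF sub ray Kle, folded f'_def]
    have "restrict f' (carrier V) \<in> S"
      using shift(1,2) f_le by (intro restrict_S) (auto intro: order_trans)
    then have "restrict f' (carrier V) = f"
      using shift(2) by (intro min) (auto simp: le_def)
    then have "f x = f' x" using x by (metis restrict_apply')
    also have "\<dots> \<le> f (x \<oplus> y) - f y"
    proof -
      have "(y, f y) \<in> K" using y unfolding K_def by (auto intro!: exI[of _ 1])
      moreover have "- f (\<ominus> x) \<le> f (x \<oplus> c) - b" if "(c, b) \<in> K" for c b
      proof -
        have c: "c \<in> carrier V" using ray that unfolding convex_cone_def by blast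
        have "f c = f ((x \<oplus> c) \<oplus> (\<ominus> x))"
          using x c by (simp add: a_comm[of x] a_assoc r_neg)
        also have "\<dots> \<le> f (x \<oplus> c) + f (\<ominus> x)" using x c by (intro sublinear_add sub) auto
        finally show ?thesis using Kle that by auto
      qed
      then have "bdd_below ((\<lambda>(c, b). f (x \<oplus> c) - b) ` K)"
        by (intro bdd_belowI2[where m = "- f (\<ominus> x)"]) auto
      ultimately show ?thesis
        unfolding f'_def using cINF_lower[of "\<lambda>(c, b). f (x \<oplus> c) - b" K "(y, f y)"] by simp
    qed
    finally show ?thesis by simp
  qed
  have add: "f (x \<oplus> y) = f x + f y" if "x \<in> carrier V" "y \<in> carrier V" for x y
    using superadd[OF that] sublinear_add[OF sub that] by simp
  have neg: "f (\<ominus> x) = - f x" if "x \<in> carrier V" for x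
    using add[of x "\<ominus> x"] that sublinear_zero[OF sub] by (simp add: r_neg)
  have "f (t \<odot> x) = t * f x" if x: "x \<in> carrier V" for x t
  proof (cases "0 \<le> t")
    case True
    then show ?thesis using sublinear_scale[OF sub x] by simp
  next
    case False
    have "f (t \<odot> x) = - f ((- t) \<odot> x)"
      using neg[of "(- t) \<odot> x"] x by (simp add: uminus_scale)
    then show ?thesis using False sublinear_scale[OF sub x, of "- t"] by simp
  qed
  then show ?thesis using add f_le unfolding linear_functional_def by blast
qed

lemma linear_functional_uminus:
  "linear_functional V f \<Longrightarrow> x \<in> carrier V \<Longrightarrow> f (\<ominus> x) = - f x"
  unfolding linear_functional_def by (simp add: uminus_conv_scale)

text \<open>
  The constraints can be met by a linear functional below \<open>q\<close> as soon as \<open>q\<close> itself meets them: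
  take a linear functional below the shifted functional.
\<close>

theorem hahn_banach_cone:
  assumes q: "sublinear V q"
    and cone: "convex_cone V K" and le: "\<forall>(c, b)\<in>K. b \<le> q c"
  shows "\<exists>f. linear_functional V f \<and> (\<forall>x\<in>carrier V. f x \<le> q x) \<and> (\<forall>(c, b)\<in>K. b \<le> f c)"
proof -
  note shift = sublinear_shift[OF q cone le]
  obtain f where f: "linear_functional V f" "\<And>x. x \<in> carrier V \<Longrightarrow> f x \<le> (INF (c, b)\<in>K. q (x \<oplus> c) - b)"
    using sublinear_ge_linear_functional[OF shift(1)] by auto
  have "b \<le> f c" if "(c, b) \<in> K" for c b
  proof -
    have c: "c \<in> carrier V" using cone that unfolding convex_cone_def by blast
    have "- f c \<le> - b"
      using f(2)[of "\<ominus> c"] shift(3)[OF that] linear_functional_uminus[OF f(1) c] c by simp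
    then show ?thesis by simp
  qed
  moreover have "f x \<le> q x" if "x \<in> carrier V" for x
    using f(2)[OF that] shift(2)[OF that] by simp
  ultimately show ?thesis using f(1) by blast
qed

corollary hahn_banach_point:
  assumes q: "sublinear V q" and z: "z \<in> carrier V"
  shows "\<exists>f. linear_functional V f \<and> (\<forall>x\<in>carrier V. f x \<le> q x) \<and> f z = q z"
proof -
  define K where "K = {(t \<odot> z, t * q z) | t. 0 \<le> t}"
  have "\<exists>f. linear_functional V f \<and> (\<forall>x\<in>carrier V. f x \<le> q x) \<and> (\<forall>(c, b)\<in>K. b \<le> f c)"
  proof (rule hahn_banach_cone[OF q])
    show "convex_cone V K" unfolding K_def by (rule ray_cone[OF z])
    show "\<forall>(c, b)\<in>K. b \<le> q c" using z sublinear_scale[OF q] by (auto simp: K_def)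
  qed
  then obtain f where f: "linear_functional V f" "\<forall>x\<in>carrier V. f x \<le> q x" "\<forall>(c, b)\<in>K. b \<le> f c" by blast
  moreover have "(z, q z) \<in> K" using z unfolding K_def by (auto intro!: exI[of _ 1])
  ultimately have "f z = q z" using z by (force intro: antisym)
  then show ?thesis using f by blast
qed

end

section \<open>Means on bounded functions\<close>

text \<open>
  A mean is the integral with respect to a finitely additive probability measure on \<open>\<Phi>\<close>. Positivity and
  normalisation are contained in the last condition, applied to \<open>h\<close> and to \<open>- h\<close>.
\<close>

definition mean_on :: "'t set \<Rightarrow> (('t \<Rightarrow> real) \<Rightarrow> real) \<Rightarrow> bool" where
  "mean_on \<Phi> L \<longleftrightarrow>
     (\<forall>h k. bounded (h ` \<Phi>) \<longrightarrow> bounded (k ` \<Phi>) \<longrightarrow> L (\<lambda>t. h t + k t) = L h + L k) \<and>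
     (\<forall>h a. bounded (h ` \<Phi>) \<longrightarrow> L (\<lambda>t. a * h t) = a * L h) \<and>
     (\<forall>h. bounded (h ` \<Phi>) \<longrightarrow> L h \<le> (SUP t\<in>\<Phi>. h t))"

text \<open>
  The functions that are bounded on the disjoint union of the sets \<open>\<Phi> j\<close> with \<open>j \<in> I\<close>.
\<close>

definition function_space :: "'i set \<Rightarrow> ('i \<Rightarrow> 't set) \<Rightarrow> (real, 'i \<Rightarrow> 't \<Rightarrow> real) module" where
  "function_space I \<Phi> =
     \<lparr>carrier = {h. \<forall>j\<in>I. bounded (h j ` \<Phi> j)}, mult = undefined, one = undefined,
      zero = (\<lambda>j t. 0), add = (\<lambda>h k j t. h j t + k j t), smult = (\<lambda>a h j t. a * h j t)\<rparr>"

lemma function_space_simps [simp]: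
  "carrier (function_space I \<Phi>) = {h. \<forall>j\<in>I. bounded (h j ` \<Phi> j)}"
  "\<zero>\<^bsub>function_space I \<Phi>\<^esub> = (\<lambda>j t. 0)"
  "h \<oplus>\<^bsub>function_space I \<Phi>\<^esub> k = (\<lambda>j t. h j t + k j t)"
  "a \<odot>\<^bsub>function_space I \<Phi>\<^esub> h = (\<lambda>j t. a * h j t)"
  by (simp_all add: function_space_def)

lemma bounded_add_image:
  fixes f g :: "'t \<Rightarrow> real"
  shows "bounded (f ` A) \<Longrightarrow> bounded (g ` A) \<Longrightarrow> bounded ((\<lambda>t. f t + g t) ` A)"
  by (rule bounded_plus_comp)

lemma bounded_mult_image:
  fixes f :: "'t \<Rightarrow> real"
  shows "bounded (f ` A) \<Longrightarrow> bounded ((\<lambda>t. a * f t) ` A)"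
  using bounded_scaleR_comp[of f A a] by simp

lemma bounded_zero_image: "bounded ((\<lambda>t. 0 :: real) ` A)"
  by (auto simp: image_constant_conv)

lemma bounded_sum_image:
  fixes f :: "'b \<Rightarrow> 't \<Rightarrow> real"
  assumes "\<And>b. b \<in> B \<Longrightarrow> bounded (f b ` A)"
  shows "bounded ((\<lambda>t. \<Sum>b\<in>B. f b t) ` A)"
  using assms
  by (induction B rule: infinite_finite_induct) (auto intro!: bounded_zero_image bounded_add_image)

lemma bdd_above_image: "bounded (h ` \<Phi>) \<Longrightarrow> bdd_above ((h :: 't \<Rightarrow> real) ` \<Phi>)"
  by (rule bounded_imp_bdd_above)

lemma function_space_real_space: "real_space (function_space I \<Phi>)"
proof (intro real_space.intro moduleI abelian_groupI cring_real_line)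
  fix h assume "h \<in> carrier (function_space I \<Phi>)"
  then show "\<exists>k\<in>carrier (function_space I \<Phi>). k \<oplus>\<^bsub>function_space I \<Phi>\<^esub> h = \<zero>\<^bsub>function_space I \<Phi>\<^esub>"
    using bounded_mult_image[of "h _" "\<Phi> _" "-1"]
    by (intro bexI[of _ "\<lambda>j t. - h j t"]) auto
qed (auto simp: algebra_simps intro: bounded_zero_image bounded_add_image bounded_mult_image)

lemma sublinear_sum_SUP:
  assumes ne: "\<And>j. j \<in> I \<Longrightarrow> \<Phi> j \<noteq> {}"
  shows "sublinear (function_space I \<Phi>) (\<lambda>h. \<Sum>j\<in>I. SUP t\<in>\<Phi> j. h j t)"
  unfolding sublinear_def
proof (intro conjI ballI allI impI)
  fix h k assume "h \<in> carrier (function_space I \<Phi>)" "k \<in> carrier (function_space I \<Phi>)"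
  then have "(SUP t\<in>\<Phi> j. h j t + k j t) \<le> (SUP t\<in>\<Phi> j. h j t) + (SUP t\<in>\<Phi> j. k j t)" if "j \<in> I" for j
    using that by (intro cSUP_least ne add_mono cSUP_upper bdd_above_image) auto
  then show "(\<Sum>j\<in>I. SUP t\<in>\<Phi> j. (h \<oplus>\<^bsub>function_space I \<Phi>\<^esub> k) j t)
      \<le> (\<Sum>j\<in>I. SUP t\<in>\<Phi> j. h j t) + (\<Sum>j\<in>I. SUP t\<in>\<Phi> j. k j t)"
    by (simp add: sum.distrib[symmetric] sum_mono)
next
  fix h and a :: real assume h: "h \<in> carrier (function_space I \<Phi>)" and a: "0 \<le> a"
  have "(SUP t\<in>\<Phi> j. a * h j t) = a * (SUP t\<in>\<Phi> j. h j t)" if j: "j \<in> I" for j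
  proof (cases "a = 0")
    case True then show ?thesis using ne[OF j] by simp
  next
    case False
    then have a: "0 < a" using a by simp
    have bdd: "bdd_above ((\<lambda>t. h j t) ` \<Phi> j)" "bdd_above ((\<lambda>t. a * h j t) ` \<Phi> j)"
      using h j by (auto intro!: bdd_above_image bounded_mult_image)
    have "(SUP t\<in>\<Phi> j. h j t) \<le> (SUP t\<in>\<Phi> j. a * h j t) / a"
    proof (rule cSUP_least[OF ne[OF j]])
      fix t assume "t \<in> \<Phi> j"
      then have "a * h j t \<le> (SUP t\<in>\<Phi> j. a * h j t)" by (intro cSUP_upper bdd)
      then show "h j t \<le> (SUP t\<in>\<Phi> j. a * h j t) / a" using a by (simp add: field_simps)
    qed
    moreover have "(SUP t\<in>\<Phi> j. a * h j t) \<le> a * (SUP t\<in>\<Phi> j. h j t)"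
      using a by (intro cSUP_least ne j mult_left_mono cSUP_upper bdd) auto
    ultimately show ?thesis using a by (simp add: field_simps)
  qed
  then show "(\<Sum>j\<in>I. SUP t\<in>\<Phi> j. (a \<odot>\<^bsub>function_space I \<Phi>\<^esub> h) j t) = a * (\<Sum>j\<in>I. SUP t\<in>\<Phi> j. h j t)"
    by (simp add: sum_distrib_left)
qed

text \<open>
  On a disjoint union of finitely many sets \<open>\<Phi> j\<close> the sum of the suprema over the
  \<open>\<Phi> j\<close> is sublinear, and a linear functional below it splits into one mean on each \<open>\<Phi> j\<close>.
  Hence the Hahn--Banach theorem for the cone generated by the functions \<open>e a\<close> turns an
  inequality between suprema into an inequality between means that holds for each \<open>a\<close> separately.
\<close>

theorem exists_dominating_means:
  fixes e :: "'a \<Rightarrow> 'i \<Rightarrow> 't \<Rightarrow> real" and \<tau> :: "'a \<Rightarrow> real"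
  assumes "finite I" and ne: "\<And>j. j \<in> I \<Longrightarrow> \<Phi> j \<noteq> {}"
    and e: "\<And>a j. a \<in> A \<Longrightarrow> j \<in> I \<Longrightarrow> bounded (e a j ` \<Phi> j)"
    and le: "\<And>B c. finite B \<Longrightarrow> B \<subseteq> A \<Longrightarrow> (\<And>a. 0 \<le> c a) \<Longrightarrow>
      (\<Sum>a\<in>B. c a * \<tau> a) \<le> (\<Sum>j\<in>I. SUP t\<in>\<Phi> j. \<Sum>a\<in>B. c a * e a j t)"
  shows "\<exists>L. (\<forall>j\<in>I. mean_on (\<Phi> j) (L j)) \<and> (\<forall>a\<in>A. \<tau> a \<le> (\<Sum>j\<in>I. L j (e a j)))"
proof -
  define V where "V = function_space I \<Phi>"
  interpret real_space V unfolding V_def by (rule function_space_real_space)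
  define q where "q = (\<lambda>h :: 'i \<Rightarrow> 't \<Rightarrow> real. \<Sum>j\<in>I. SUP t\<in>\<Phi> j. h j t)"
  have q: "sublinear V q" unfolding q_def V_def by (intro sublinear_sum_SUP ne)
  define comb where "comb B c = ((\<lambda>j t. \<Sum>a\<in>B. c a * e a j t), \<Sum>a\<in>B. c a * \<tau> a)" for B c
  define K where "K = {comb B c | B c. finite B \<and> B \<subseteq> A \<and> (\<forall>a. 0 \<le> c a) \<and> (\<forall>a. a \<notin> B \<longrightarrow> c a = 0)}"
  have "\<exists>f. linear_functional V f \<and> (\<forall>x\<in>carrier V. f x \<le> q x) \<and> (\<forall>(c, b)\<in>K. b \<le> f c)"
  proof (rule hahn_banach_cone[OF q])
    show "convex_cone V K" unfolding convex_cone_def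
    proof (intro conjI allI impI)
      show "K \<subseteq> carrier V \<times> UNIV"
        using e by (auto simp: K_def V_def comb_def intro!: bounded_sum_image bounded_mult_image)
      have "comb {} (\<lambda>_. 0) \<in> K" unfolding K_def by blast
      then show "(\<zero>\<^bsub>V\<^esub>, 0) \<in> K" by (simp add: V_def comb_def)
    next
      fix h b k d assume "(h, b) \<in> K" "(k, d) \<in> K"
      then obtain B c B' c' where
        B: "(h, b) = comb B c" "finite B" "B \<subseteq> A" "\<And>a. 0 \<le> c a" "\<And>a. a \<notin> B \<Longrightarrow> c a = 0" and
        B': "(k, d) = comb B' c'" "finite B'" "B' \<subseteq> A" "\<And>a. 0 \<le> c' a" "\<And>a. a \<notin> B' \<Longrightarrow> c' a = 0"
        unfolding K_def by blast
      have ext: "(\<Sum>a\<in>B. c a * s a) = (\<Sum>a\<in>B \<union> B'. c a * s a)"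
        "(\<Sum>a\<in>B'. c' a * s a) = (\<Sum>a\<in>B \<union> B'. c' a * s a)" for s
        using B B' by (auto intro!: sum.mono_neutral_left)
      have "(h \<oplus>\<^bsub>V\<^esub> k, b + d) = comb (B \<union> B') (\<lambda>a. c a + c' a)"
        using B(1) B'(1) by (simp add: comb_def V_def ext sum.distrib distrib_right)
      then show "(h \<oplus>\<^bsub>V\<^esub> k, b + d) \<in> K"
        using B(2-4) B'(2-4) B(5) B'(5) unfolding K_def
        by (intro CollectI exI[of _ "B \<union> B'"] exI[of _ "\<lambda>a. c a + c' a"]) auto
    next
      fix h b and t :: real assume "(h, b) \<in> K" and t: "0 < t"
      then obtain B c where
        B: "(h, b) = comb B c" "finite B" "B \<subseteq> A" "\<And>a. 0 \<le> c a" "\<And>a. a \<notin> B \<Longrightarrow> c a = 0"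
        unfolding K_def by blast
      have "(t \<odot>\<^bsub>V\<^esub> h, t * b) = comb B (\<lambda>a. t * c a)"
        using B(1) by (simp add: comb_def V_def sum_distrib_left mult.assoc)
      then show "(t \<odot>\<^bsub>V\<^esub> h, t * b) \<in> K"
        using B t unfolding K_def by (auto intro!: exI[of _ B] exI[of _ "\<lambda>a. t * c a"])
    qed
  next
    show "\<forall>(h, b)\<in>K. b \<le> q h"
    proof safe
      fix h b assume "(h, b) \<in> K"
      then obtain B c where B: "(h, b) = comb B c" "finite B" "B \<subseteq> A" "\<And>a. 0 \<le> c a"
        unfolding K_def by blast
      show "b \<le> q h" using B(1) le[OF B(2-4)] by (simp add: comb_def q_def)
    qed
  qed
  then obtain f where f: "linear_functional V f" and f_le: "\<And>h. h \<in> carrier V \<Longrightarrow> f h \<le> q h"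
    and f_ge: "\<And>h b. (h, b) \<in> K \<Longrightarrow> b \<le> f h" by blast
  \<comment> \<open>The function h on the components in J, continued by 0.\<close>
  define part where "part J h = (\<lambda>j t. if j \<in> J then h j t else 0)" for J :: "'i set" and h :: "'i \<Rightarrow> 't \<Rightarrow> real"
  define L where "L j h = f (part {j} (\<lambda>_. h))" for j h
  have part_V: "part J h \<in> carrier V" if "\<And>j. j \<in> I \<Longrightarrow> j \<in> J \<Longrightarrow> bounded (h j ` \<Phi> j)" for J h
    using that by (auto simp: V_def part_def intro: bounded_zero_image)
  have f_add: "f (\<lambda>j t. h j t + k j t) = f h + f k" if "h \<in> carrier V" "k \<in> carrier V" for h k
    using f that unfolding linear_functional_def V_def by simp
  have f_mult: "f (\<lambda>j t. a * h j t) = a * f h" if "h \<in> carrier V" for h a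
    using f that unfolding linear_functional_def V_def by simp
  have "mean_on (\<Phi> j) (L j)" if j: "j \<in> I" for j
    unfolding mean_on_def
  proof (intro conjI allI impI)
    fix h k :: "'t \<Rightarrow> real" assume hk: "bounded (h ` \<Phi> j)" "bounded (k ` \<Phi> j)"
    have "part {j} (\<lambda>_ t. h t + k t) = (\<lambda>i t. part {j} (\<lambda>_. h) i t + part {j} (\<lambda>_. k) i t)"
      by (auto simp: part_def fun_eq_iff)
    then show "L j (\<lambda>t. h t + k t) = L j h + L j k"
      using f_add[of "part {j} (\<lambda>_. h)" "part {j} (\<lambda>_. k)"] hk part_V[of "{j}"] by (simp add: L_def)
  next
    fix h :: "'t \<Rightarrow> real" and a assume h: "bounded (h ` \<Phi> j)"
    have "part {j} (\<lambda>_ t. a * h t) = (\<lambda>i t. a * part {j} (\<lambda>_. h) i t)"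
      by (auto simp: part_def fun_eq_iff)
    then show "L j (\<lambda>t. a * h t) = a * L j h"
      using f_mult[of "part {j} (\<lambda>_. h)" a] h part_V[of "{j}"] by (simp add: L_def)
  next
    fix h :: "'t \<Rightarrow> real" assume h: "bounded (h ` \<Phi> j)"
    have "L j h \<le> q (part {j} (\<lambda>_. h))"
      unfolding L_def using h by (intro f_le part_V) auto
    also have "\<dots> = (SUP t\<in>\<Phi> j. h t)"
      unfolding q_def part_def using \<open>finite I\<close> j ne by (simp add: sum.remove[of I j] cong: if_cong)
    finally show "L j h \<le> (SUP t\<in>\<Phi> j. h t)" .
  qed
  moreover have "\<tau> a \<le> (\<Sum>j\<in>I. L j (e a j))" if a: "a \<in> A" for a
  proof -
    have ea: "e a \<in> carrier V" using e a by (simp add: V_def)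
    have parts: "f (part J (e a)) = (\<Sum>j\<in>J. L j (e a j))" if "finite J" "J \<subseteq> I" for J
      using that
    proof (induction J rule: finite_induct)
      case empty
      have "f (\<lambda>j t. 0 * e a j t) = 0" using f_mult[OF ea, of 0] by simp
      then show ?case by (simp add: part_def)
    next
      case (insert j J)
      have "part (insert j J) (e a) = (\<lambda>i t. part {j} (\<lambda>_. e a j) i t + part J (e a) i t)"
        using insert.hyps by (auto simp: part_def fun_eq_iff)
      moreover have "part {j} (\<lambda>_. e a j) \<in> carrier V" "part J (e a) \<in> carrier V"
        using e a by (auto intro!: part_V)
      ultimately have "f (part (insert j J) (e a)) = L j (e a j) + f (part J (e a))"
        using f_add by (simp add: L_def)
      then show ?case using insert by simp
    qed
    have "comb {a} (\<lambda>b. if b = a then 1 else 0) \<in> K"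
      using a unfolding K_def by (auto intro!: exI[of _ "{a}"] exI[of _ "\<lambda>b. if b = a then 1 else 0"] split: if_splits)
    then have "\<tau> a \<le> f (e a)" using f_ge by (simp add: comb_def)
    also have "\<dots> \<le> f (part I (e a))"
    proof -
      \<comment> \<open>A function that vanishes on all components in I has q = 0, so f cannot be positive at it.\<close>
      define d where "d = (\<lambda>j t. e a j t + (-1) * part I (e a) j t)"
      have V: "part I (e a) \<in> carrier V" using e a by (intro part_V)
      have neg: "(\<lambda>j t. (-1) * part I (e a) j t) \<in> carrier V"
        using V by (auto simp: V_def intro!: bounded_mult_image)
      have "f d = f (e a) - f (part I (e a))"
        unfolding d_def using f_add[OF ea neg] f_mult[OF V, of "-1"] by simp
      moreover have "d \<in> carrier V" using ea neg unfolding d_def V_def function_space_simps mem_Collect_eq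
        by (intro ballI bounded_add_image) blast+
      then have "f d \<le> q d" by (rule f_le)
      moreover have "q d = 0" unfolding q_def d_def part_def using ne by simp
      ultimately show ?thesis by simp
    qed
    also have "\<dots> = (\<Sum>j\<in>I. L j (e a j))" using \<open>finite I\<close> by (intro parts) auto
    finally show ?thesis .
  qed
  ultimately show ?thesis by blast
qed

lemma mean_on_add: "mean_on \<Phi> L \<Longrightarrow> bounded (h ` \<Phi>) \<Longrightarrow> bounded (k ` \<Phi>) \<Longrightarrow> L (\<lambda>t. h t + k t) = L h + L k"
  by (simp add: mean_on_def)

lemma mean_on_mult: "mean_on \<Phi> L \<Longrightarrow> bounded (h ` \<Phi>) \<Longrightarrow> L (\<lambda>t. a * h t) = a * L h"
  by (simp add: mean_on_def)

lemma mean_on_le_SUP: "mean_on \<Phi> L \<Longrightarrow> bounded (h ` \<Phi>) \<Longrightarrow> L h \<le> (SUP t\<in>\<Phi>. h t)"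
  by (simp add: mean_on_def)

lemma mean_on_mono:
  assumes L: "mean_on \<Phi> L" and "\<Phi> \<noteq> {}" and b: "bounded (h ` \<Phi>)" "bounded (k ` \<Phi>)"
    and le: "\<And>t. t \<in> \<Phi> \<Longrightarrow> h t \<le> k t"
  shows "L h \<le> L k"
proof -
  have b': "bounded ((\<lambda>t. (-1) * k t) ` \<Phi>)" by (intro bounded_mult_image b)
  have "L h - L k = L (\<lambda>t. h t + (-1) * k t)"
    using mean_on_add[OF L b(1) b'] mean_on_mult[OF L b(2), of "-1"] by simp
  also have "\<dots> \<le> (SUP t\<in>\<Phi>. h t + (-1) * k t)"
    by (intro mean_on_le_SUP[OF L] bounded_add_image b b')
  also have "\<dots> \<le> 0" using le \<open>\<Phi> \<noteq> {}\<close> by (intro cSUP_least) auto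
  finally show ?thesis by simp
qed

lemma mean_on_nonneg:
  assumes "mean_on \<Phi> L" "\<Phi> \<noteq> {}" "bounded (h ` \<Phi>)" "\<And>t. t \<in> \<Phi> \<Longrightarrow> 0 \<le> h t"
  shows "0 \<le> L h"
  using mean_on_mono[OF assms(1,2) bounded_mult_image[OF assms(3), of 0] assms(3)] assms(4)
    mean_on_mult[OF assms(1,3), of 0] by simp

lemma mean_on_sum:
  assumes L: "mean_on \<Phi> L" and "finite B" and b: "\<And>i. i \<in> B \<Longrightarrow> bounded (h i ` \<Phi>)"
  shows "L (\<lambda>t. \<Sum>i\<in>B. h i t) = (\<Sum>i\<in>B. L (h i))"
  using \<open>finite B\<close> b
proof (induction B rule: finite_induct)
  case empty
  then show ?case using mean_on_mult[OF L bounded_zero_image, of 0] by simp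
next
  case (insert i B)
  then show ?case using mean_on_add[OF L, of "h i" "\<lambda>t. \<Sum>i\<in>B. h i t"]
    by (simp add: bounded_sum_image)
qed

lemma bounded_powr_image:
  fixes h :: "'t \<Rightarrow> real"
  assumes "bounded (h ` \<Phi>)" "0 \<le> P"
  shows "bounded ((\<lambda>t. \<bar>h t\<bar> powr P) ` \<Phi>)"
proof -
  obtain M where M: "\<And>t. t \<in> \<Phi> \<Longrightarrow> \<bar>h t\<bar> \<le> M" using assms(1) by (auto simp: bounded_iff)
  show ?thesis
    unfolding bounded_iff using M assms(2) by (auto intro!: exI[of _ "M powr P"] powr_mono2)
qed

lemma powr_convex_combination:
  fixes a b t P :: real
  assumes "1 \<le> P" "0 \<le> a" "0 \<le> b" "0 < t" "t < 1"
  shows "(t * a + (1 - t) * b) powr P \<le> t * a powr P + (1 - t) * b powr P"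
proof -
  have small: "s powr P \<le> s" if "0 < s" "s < 1" for s :: real
    using powr_mono'[of 1 P s] that assms(1) by simp
  consider "a = 0" | "b = 0" | "0 < a" "0 < b" using assms by linarith
  then show ?thesis
  proof cases
    case 1
    then show ?thesis using assms small[of "1 - t"] by (simp add: powr_mult mult_right_mono)
  next
    case 2
    then show ?thesis using assms small[of t] by (simp add: powr_mult mult_right_mono)
  next
    case 3
    then show ?thesis
      using convex_onD[OF powr_convex[OF assms(1)], of "1 - t" a b] assms by simp
  qed
qed

text \<open>
  The \<open>L\<^sub>q\<close>-seminorm of \<open>h\<close> with respect to the mean \<open>L\<close>, and its supremum norm if \<open>q = \<infinity>\<close>.
\<close>

definition mean_norm :: "ennreal \<Rightarrow> 't set \<Rightarrow> (('t \<Rightarrow> real) \<Rightarrow> real) \<Rightarrow> ('t \<Rightarrow> real) \<Rightarrow> real" where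
  "mean_norm q \<Phi> L h =
     (if q = \<infinity> then (SUP t\<in>\<Phi>. \<bar>h t\<bar>) else L (\<lambda>t. \<bar>h t\<bar> powr enn2real q) powr (1 / enn2real q))"

lemma mean_norm_finite:
  assumes "1 \<le> q" "q \<noteq> \<infinity>"
  shows "mean_norm q \<Phi> L h = L (\<lambda>t. \<bar>h t\<bar> powr (1 / recip q)) powr recip q"
  using assms(1)
proof (cases rule: exponent_cases)
  case finite
  then show ?thesis unfolding mean_norm_def finite(4) by simp
qed (use assms in simp)

locale averaging =
  fixes q :: ennreal and \<Phi> :: "'t set" and L
  assumes exponent: "1 \<le> q" and nonempty: "\<Phi> \<noteq> {}" and mean: "q \<noteq> \<infinity> \<Longrightarrow> mean_on \<Phi> L"
begin

abbreviation "N \<equiv> mean_norm q \<Phi> L"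

lemma bdd_above_abs: "bounded (h ` \<Phi>) \<Longrightarrow> bdd_above ((\<lambda>t. \<bar>h t :: real\<bar>) ` \<Phi>)"
  by (auto simp: bounded_iff intro: bdd_aboveI2)

lemma abs_le_SUP: "bounded (h ` \<Phi>) \<Longrightarrow> t \<in> \<Phi> \<Longrightarrow> \<bar>h t :: real\<bar> \<le> (SUP t\<in>\<Phi>. \<bar>h t\<bar>)"
  by (rule cSUP_upper[OF _ bdd_above_abs])

lemma nonneg:
  assumes "bounded (h ` \<Phi>)" shows "0 \<le> N h"
proof (cases "q = \<infinity>")
  case True
  obtain t where "t \<in> \<Phi>" using nonempty by blast
  then have "0 \<le> (SUP t\<in>\<Phi>. \<bar>h t\<bar>)" using abs_le_SUP[OF assms, of t] by simp
  then show ?thesis using True by (simp add: mean_norm_def)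
next
  case False
  then show ?thesis by (simp add: mean_norm_def)
qed

lemma powr_bounded: "bounded (h ` \<Phi>) \<Longrightarrow> bounded ((\<lambda>t. \<bar>h t\<bar> powr (1 / recip q)) ` \<Phi>)"
  using recip_bounds[OF exponent] by (intro bounded_powr_image) auto

text \<open>
  The sum of the \<open>q\<close>-th powers of the seminorms is the mean of the sum of the \<open>q\<close>-th powers of the
  functions, hence at most the supremum of that sum.
\<close>

lemma ell_norm_le:
  assumes b: "\<And>i. i \<in> {1..n} \<Longrightarrow> bounded (h i ` \<Phi>)" and "0 \<le> D"
    and D: "\<And>t. t \<in> \<Phi> \<Longrightarrow> ell_norm q n (\<lambda>i. h i t) \<le> D"
  shows "ell_norm q n (\<lambda>i. N (h i)) \<le> D"
  using exponent
proof (cases rule: exponent_cases)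
  case infinite
  have "\<bar>N (h i)\<bar> \<le> D" if i: "i \<in> {1..n}" for i
  proof -
    have "\<bar>h i t\<bar> \<le> D" if "t \<in> \<Phi>" for t
      using D[OF that] abs_le_ell_norm_infinity[OF i, of "\<lambda>i. h i t"] infinite by simp
    then have "N (h i) \<le> D" using nonempty infinite by (auto simp: mean_norm_def intro!: cSUP_least)
    then show ?thesis using nonneg[OF b[OF i]] by simp
  qed
  then show ?thesis using infinite \<open>0 \<le> D\<close> by (metis ell_norm_infinity_le)
next
  case finite
  define \<rho> where "\<rho> = recip q"
  have \<rho>: "0 < \<rho>" using finite by (simp add: \<rho>_def)
  have L: "mean_on \<Phi> L" using mean finite by blast
  define k where "k i t = \<bar>h i t\<bar> powr (1 / \<rho>)" for i t
  have k: "bounded (k i ` \<Phi>)" if "i \<in> {1..n}" for i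
    using powr_bounded[OF b[OF that]] by (simp add: k_def \<rho>_def)
  have Lk: "0 \<le> L (k i)" if "i \<in> {1..n}" for i
    using k[OF that] by (intro mean_on_nonneg[OF L nonempty]) (auto simp: k_def)
  have Nh: "N (h i) = L (k i) powr \<rho>" for i
    using finite exponent by (simp add: mean_norm_finite k_def[abs_def] \<rho>_def)
  have "(\<Sum>i=1..n. \<bar>N (h i)\<bar> powr (1 / \<rho>)) = (\<Sum>i=1..n. L (k i))"
    using Lk \<rho> by (intro sum.cong) (auto simp: Nh powr_powr)
  also have "\<dots> = L (\<lambda>t. \<Sum>i=1..n. k i t)"
    using k by (intro mean_on_sum[OF L, symmetric]) auto
  also have "\<dots> \<le> (SUP t\<in>\<Phi>. \<Sum>i=1..n. k i t)"
    using k by (intro mean_on_le_SUP[OF L] bounded_sum_image)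
  also have "\<dots> \<le> D powr (1 / \<rho>)"
  proof (rule cSUP_least[OF nonempty])
    fix t assume "t \<in> \<Phi>"
    then have "(\<Sum>i=1..n. k i t) powr \<rho> \<le> D"
      using D[of t] finite exponent by (simp add: ell_norm_finite k_def \<rho>_def)
    then have "((\<Sum>i=1..n. k i t) powr \<rho>) powr (1 / \<rho>) \<le> D powr (1 / \<rho>)"
      using \<rho> by (intro powr_mono2) auto
    then show "(\<Sum>i=1..n. k i t) \<le> D powr (1 / \<rho>)"
      using \<rho> by (simp add: powr_powr sum_nonneg k_def)
  qed
  finally have "(\<Sum>i=1..n. \<bar>N (h i)\<bar> powr (1 / \<rho>)) powr \<rho> \<le> (D powr (1 / \<rho>)) powr \<rho>"
    using \<rho> by (intro powr_mono2) (auto intro: sum_nonneg)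
  then show ?thesis
    using \<rho> \<open>0 \<le> D\<close> finite exponent by (simp add: ell_norm_finite \<rho>_def powr_powr)
qed

lemma le_bound:
  assumes "bounded (h ` \<Phi>)" "0 \<le> D" "\<And>t. t \<in> \<Phi> \<Longrightarrow> \<bar>h t\<bar> \<le> D"
  shows "N h \<le> D"
  using ell_norm_le[of 1 "\<lambda>_. h" D] assms exponent nonneg[of h] by (simp add: ell_norm_single)

lemma mono:
  assumes b: "bounded (h ` \<Phi>)" "bounded (k ` \<Phi>)" and le: "\<And>t. t \<in> \<Phi> \<Longrightarrow> \<bar>h t\<bar> \<le> \<bar>k t\<bar>"
  shows "N h \<le> N k"
proof (cases "q = \<infinity>")
  case True
  have "\<bar>h t\<bar> \<le> (SUP t\<in>\<Phi>. \<bar>k t\<bar>)" if "t \<in> \<Phi>" for t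
    using le[OF that] abs_le_SUP[OF b(2) that] by simp
  then have "(SUP t\<in>\<Phi>. \<bar>h t\<bar>) \<le> (SUP t\<in>\<Phi>. \<bar>k t\<bar>)" by (rule cSUP_least[OF nonempty])
  then show ?thesis using True by (simp add: mean_norm_def)
next
  case False
  have r: "0 \<le> recip q" using recip_bounds[OF exponent] by simp
  have "L (\<lambda>t. \<bar>h t\<bar> powr (1 / recip q)) \<le> L (\<lambda>t. \<bar>k t\<bar> powr (1 / recip q))"
    using le r by (intro mean_on_mono[OF mean[OF False] nonempty] powr_bounded b powr_mono2) auto
  moreover have "0 \<le> L (\<lambda>t. \<bar>h t\<bar> powr (1 / recip q))"
    by (intro mean_on_nonneg[OF mean[OF False] nonempty] powr_bounded b) auto
  ultimately show ?thesis
    using r False exponent by (simp add: mean_norm_finite powr_mono2)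
qed

lemma scale:
  assumes b: "bounded (h ` \<Phi>)"
  shows "N (\<lambda>t. c * h t) = \<bar>c\<bar> * N h"
proof -
  have le: "N (\<lambda>t. c * h t) \<le> \<bar>c\<bar> * N h" if b: "bounded (h ` \<Phi>)" for c h
    using exponent
  proof (cases rule: exponent_cases)
    case infinite
    have "(SUP t\<in>\<Phi>. \<bar>c * h t\<bar>) \<le> \<bar>c\<bar> * (SUP t\<in>\<Phi>. \<bar>h t\<bar>)"
      unfolding abs_mult by (intro cSUP_least[OF nonempty] mult_left_mono abs_le_SUP[OF b]) auto
    then show ?thesis using infinite by (simp add: mean_norm_def)
  next
    case finite
    have L: "mean_on \<Phi> L" using mean finite by blast
    have "L (\<lambda>t. \<bar>c * h t\<bar> powr (1 / recip q)) = \<bar>c\<bar> powr (1 / recip q) * L (\<lambda>t. \<bar>h t\<bar> powr (1 / recip q))"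
      using mean_on_mult[OF L powr_bounded[OF b]] by (simp add: abs_mult powr_mult)
    moreover have "0 \<le> L (\<lambda>t. \<bar>h t\<bar> powr (1 / recip q))"
      by (intro mean_on_nonneg[OF L nonempty] powr_bounded b) auto
    ultimately show ?thesis
      using finite exponent by (simp add: mean_norm_finite powr_mult powr_powr)
  qed
  show ?thesis
  proof (cases "c = 0")
    case True
    have "0 \<le> N (\<lambda>t. 0 * h t)" by (intro nonneg bounded_mult_image b)
    then have "N (\<lambda>t. 0 * h t) = 0" using le[OF b, of 0] by linarith
    then show ?thesis using True by simp
  next
    case False
    have "N (\<lambda>t. (1 / c) * (c * h t)) \<le> \<bar>1 / c\<bar> * N (\<lambda>t. c * h t)"
      by (intro le bounded_mult_image b)
    then have "\<bar>c\<bar> * N h \<le> N (\<lambda>t. c * h t)" using False by (simp add: field_simps)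
    then show ?thesis using le[OF b, of c] by simp
  qed
qed

lemma triangle:
  assumes b: "bounded (h ` \<Phi>)" "bounded (k ` \<Phi>)"
  shows "N (\<lambda>t. h t + k t) \<le> N h + N k"
  using exponent
proof (cases rule: exponent_cases)
  case infinite
  have "(SUP t\<in>\<Phi>. \<bar>h t + k t\<bar>) \<le> (SUP t\<in>\<Phi>. \<bar>h t\<bar>) + (SUP t\<in>\<Phi>. \<bar>k t\<bar>)"
    by (intro cSUP_least[OF nonempty] order_trans[OF abs_triangle_ineq] add_mono abs_le_SUP b)
  then show ?thesis using infinite by (simp add: mean_norm_def)
next
  case finite
  define P where "P = 1 / recip q"
  have P: "1 \<le> P" "recip q = 1 / P" using finite by (auto simp: P_def)
  have L: "mean_on \<Phi> L" using mean finite by blast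
  have N_eq: "N f = L (\<lambda>t. \<bar>f t\<bar> powr P) powr (1 / P)" for f
    using finite exponent by (simp add: mean_norm_finite P_def)
  have pb: "bounded ((\<lambda>t. \<bar>f t\<bar> powr P) ` \<Phi>)" if "bounded (f ` \<Phi>)" for f
    using powr_bounded[OF that] by (simp add: P_def)
  have L_nonneg: "0 \<le> L (\<lambda>t. \<bar>f t\<bar> powr P)" if "bounded (f ` \<Phi>)" for f
    by (intro mean_on_nonneg[OF L nonempty] pb that) auto
  have L_eq: "L (\<lambda>t. \<bar>f t\<bar> powr P) = N f powr P" if "bounded (f ` \<Phi>)" for f
    using P L_nonneg[OF that] by (simp add: N_eq powr_powr)
  have "N (\<lambda>t. h t + k t) \<le> (N h + N k) + \<epsilon>" if "0 < \<epsilon>" for \<epsilon>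
  proof -
    \<comment> \<open>Convexity with weights proportional to the two (slightly enlarged) seminorms.\<close>
    define s where "s = N h + \<epsilon> / 2"
    define u where "u = N k + \<epsilon> / 2"
    have su: "0 < s" "0 < u" "N h \<le> s" "N k \<le> u" "0 \<le> N h" "0 \<le> N k"
      using that nonneg[OF b(1)] nonneg[OF b(2)] by (auto simp: s_def u_def)
    define \<theta> where "\<theta> = s / (s + u)"
    have \<theta>: "0 < \<theta>" "\<theta> < 1" "1 - \<theta> = u / (s + u)" using su by (auto simp: \<theta>_def field_simps)
    have pointwise: "\<bar>h t + k t\<bar> powr P
        \<le> (s + u) powr P * (\<theta> / s powr P) * \<bar>h t\<bar> powr P + (s + u) powr P * ((1 - \<theta>) / u powr P) * \<bar>k t\<bar> powr P"
      for t
    proof -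
      have "\<bar>h t + k t\<bar> powr P \<le> ((s + u) * (\<theta> * (\<bar>h t\<bar> / s) + (1 - \<theta>) * (\<bar>k t\<bar> / u))) powr P"
      proof (intro powr_mono2)
        have "(s + u) * (\<theta> * (\<bar>h t\<bar> / s) + (1 - \<theta>) * (\<bar>k t\<bar> / u)) = \<bar>h t\<bar> + \<bar>k t\<bar>"
          using su unfolding \<theta>(3) unfolding \<theta>_def by (simp add: distrib_left)
        then show "\<bar>h t + k t\<bar> \<le> (s + u) * (\<theta> * (\<bar>h t\<bar> / s) + (1 - \<theta>) * (\<bar>k t\<bar> / u))"
          by simp
      qed (use P in auto)
      also have "\<dots> = (s + u) powr P * (\<theta> * (\<bar>h t\<bar> / s) + (1 - \<theta>) * (\<bar>k t\<bar> / u)) powr P"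
        by (rule powr_mult)
      also have "\<dots> \<le> (s + u) powr P * (\<theta> * (\<bar>h t\<bar> / s) powr P + (1 - \<theta>) * (\<bar>k t\<bar> / u) powr P)"
        using su P \<theta> by (intro mult_left_mono powr_convex_combination) auto
      also have "\<dots> = (s + u) powr P * (\<theta> / s powr P) * \<bar>h t\<bar> powr P
          + (s + u) powr P * ((1 - \<theta>) / u powr P) * \<bar>k t\<bar> powr P"
        using su by (simp add: powr_divide distrib_left)
      finally show ?thesis .
    qed
    have "L (\<lambda>t. \<bar>h t + k t\<bar> powr P) \<le> L (\<lambda>t. (s + u) powr P * (\<theta> / s powr P) * \<bar>h t\<bar> powr P
          + (s + u) powr P * ((1 - \<theta>) / u powr P) * \<bar>k t\<bar> powr P)"
      by (intro mean_on_mono[OF L nonempty] bounded_add_image bounded_mult_image pb b pointwise)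
    also have "\<dots> = (s + u) powr P * (\<theta> / s powr P) * N h powr P
        + (s + u) powr P * ((1 - \<theta>) / u powr P) * N k powr P"
      using b by (simp only: mean_on_add[OF L] mean_on_mult[OF L] bounded_mult_image pb L_eq)
    also have "\<dots> \<le> (s + u) powr P * (\<theta> / s powr P) * s powr P
        + (s + u) powr P * ((1 - \<theta>) / u powr P) * u powr P"
      using su \<theta> P by (intro add_mono mult_left_mono powr_mono2) auto
    also have "\<dots> = (s + u) powr P" using su by (simp add: field_simps)
    finally have "N (\<lambda>t. h t + k t) \<le> ((s + u) powr P) powr (1 / P)"
      unfolding N_eq using P L_nonneg[OF bounded_add_image[OF b]] by (intro powr_mono2) auto
    then show ?thesis using P su by (simp add: powr_powr s_def u_def)
  qed
  then show ?thesis by (rule field_le_epsilon)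
qed

end

section \<open>Domination by means\<close>

lemma averagingI:
  "1 \<le> q \<Longrightarrow> \<Phi> \<noteq> {} \<Longrightarrow> (q \<noteq> \<infinity> \<Longrightarrow> mean_on \<Phi> L) \<Longrightarrow> averaging q \<Phi> L"
  by (simp add: averaging_def)

lemma prod_powr_const:
  fixes P :: "'i \<Rightarrow> real"
  assumes "finite J" "J \<noteq> {}" "0 \<le> c" "\<And>j. j \<in> J \<Longrightarrow> 0 < P j"
  shows "(\<Prod>j\<in>J. c powr P j) = c powr sum P J"
proof (cases "c = 0")
  case True
  then show ?thesis using assms by (simp add: card_gt_0_iff)
next
  case False
  then show ?thesis by (simp add: powr_sum)
qed

text \<open>
  Let \<open>ev j a\<close> be the function on \<open>\<Phi> j\<close> given by the \<open>j\<close>-th component of \<open>a\<close>. By the inequality of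
  the weighted means, the product of suprema on the right of the assumption may be replaced by a sum
  of suprema of \<open>q\<^sub>j\<close>-th powers, so that means can be found by the Hahn--Banach theorem; scaling
  the components of \<open>a\<close> individually then restores the product. Components with exponent \<open>\<infinity>\<close> are not
  averaged but normalised beforehand.
\<close>

theorem domination:
  fixes ev :: "'i \<Rightarrow> 'a \<Rightarrow> 't \<Rightarrow> real" and \<tau> :: "'a \<Rightarrow> real"
  assumes "finite I" and ne: "\<And>j. j \<in> I \<Longrightarrow> \<Phi> j \<noteq> {}"
    and q: "\<And>j. j \<in> I \<Longrightarrow> 1 \<le> q j" and "1 \<le> p" and recip: "recip p = (\<Sum>j\<in>I. recip (q j))"
    and b: "\<And>a j. a \<in> A \<Longrightarrow> j \<in> I \<Longrightarrow> bounded (ev j a ` \<Phi> j)"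
    and \<tau>: "\<And>a. a \<in> A \<Longrightarrow> 0 \<le> \<tau> a" and C: "0 < C"
    and scale: "\<And>a c. a \<in> A \<Longrightarrow> (\<And>j. j \<in> I \<Longrightarrow> 0 \<le> c j) \<Longrightarrow>
      \<exists>a'\<in>A. \<tau> a' = (\<Prod>j\<in>I. c j) * \<tau> a \<and> (\<forall>j\<in>I. \<forall>t\<in>\<Phi> j. ev j a' t = c j * ev j a t)"
    and le: "\<And>n a. (\<And>i. i \<in> {1..n} \<Longrightarrow> a i \<in> A) \<Longrightarrow>
      ell_norm p n (\<lambda>i. \<tau> (a i)) \<le> C * (\<Prod>j\<in>I. SUP t\<in>\<Phi> j. ell_norm (q j) n (\<lambda>i. ev j (a i) t))"
  shows "\<exists>L. (\<forall>j\<in>I. averaging (q j) (\<Phi> j) (L j)) \<and>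
    (\<forall>a\<in>A. \<tau> a \<le> C * (\<Prod>j\<in>I. mean_norm (q j) (\<Phi> j) (L j) (ev j a)))"
  using \<open>1 \<le> p\<close>
proof (cases rule: exponent_cases)
  case infinite
  have inf: "q j = \<infinity>" if "j \<in> I" for j
    using infinite recip recip_bounds(1)[OF q] that \<open>finite I\<close> recip_eq_0_iff[OF q]
    by (simp add: sum_nonneg_eq_0_iff)
  have "\<tau> a \<le> C * (\<Prod>j\<in>I. mean_norm (q j) (\<Phi> j) L (ev j a))" if a: "a \<in> A" for a L
  proof -
    have "\<tau> a \<le> C * (\<Prod>j\<in>I. SUP t\<in>\<Phi> j. \<bar>ev j a t\<bar>)"
      using le[of 1 "\<lambda>_. a"] a \<tau>[OF a] \<open>1 \<le> p\<close> q by (simp add: ell_norm_single)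
    then show ?thesis using inf by (simp add: mean_norm_def)
  qed
  then show ?thesis using inf q ne by (intro exI[of _ "\<lambda>_. undefined"]) (auto intro: averagingI)
next
  case finite
  define \<sigma> where "\<sigma> = recip p"
  have \<sigma>: "0 < \<sigma>" using finite by (simp add: \<sigma>_def)
  define \<rho> where "\<rho> j = recip (q j)" for j
  define J where "J = {j\<in>I. q j \<noteq> \<infinity>}"
  have J: "finite J" "J \<subseteq> I" using \<open>finite I\<close> by (auto simp: J_def)
  have \<rho>: "0 < \<rho> j" if "j \<in> J" for j
    using that recip_bounds(1)[OF q] recip_eq_0_iff[OF q] by (auto simp: J_def \<rho>_def less_le)
  have \<rho>0: "\<rho> j = 0" if "j \<in> I - J" for j
  proof -
    have "j \<in> I" "q j = \<infinity>" using that by (auto simp: J_def)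
    then show ?thesis using recip_eq_0_iff[OF q] unfolding \<rho>_def by blast
  qed
  have sum\<rho>: "sum \<rho> J = \<sigma>"
    using \<rho>0 J \<open>finite I\<close> unfolding \<sigma>_def recip \<rho>_def by (intro sum.mono_neutral_left) auto
  have J_ne: "J \<noteq> {}" using sum\<rho> \<sigma> by auto
  define \<theta> where "\<theta> j = \<rho> j / \<sigma>" for j
  have \<theta>: "0 < \<theta> j" if "j \<in> J" for j using \<rho>[OF that] \<sigma> by (simp add: \<theta>_def)
  have sum\<theta>: "sum \<theta> J = 1" using sum\<rho> \<sigma> by (simp add: \<theta>_def sum_divide_distrib[symmetric])
  \<comment> \<open>For these tuples the components with exponent infinity contribute at most 1 to the product.\<close>
  define A' where "A' = {a\<in>A. \<forall>j\<in>I - J. \<forall>t\<in>\<Phi> j. \<bar>ev j a t\<bar> \<le> 1}"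
  define e where "e a j t = \<theta> j * \<bar>ev j a t\<bar> powr (1 / \<rho> j)" for a j t
  define \<tau>' where "\<tau>' a = (\<tau> a / C) powr (1 / \<sigma>)" for a
  have powr_b: "bounded ((\<lambda>t. \<bar>ev j a t\<bar> powr (1 / \<rho> j)) ` \<Phi> j)" if "a \<in> A" "j \<in> J" for a j
    using \<rho>[OF that(2)] J that by (intro bounded_powr_image b) auto
  have "\<exists>L. (\<forall>j\<in>J. mean_on (\<Phi> j) (L j)) \<and> (\<forall>a\<in>A'. \<tau>' a \<le> (\<Sum>j\<in>J. L j (e a j)))"
  proof (rule exists_dominating_means[OF \<open>finite J\<close>])
    show "bounded (e a j ` \<Phi> j)" if "a \<in> A'" "j \<in> J" for a j
      unfolding e_def using that powr_b by (intro bounded_mult_image) (auto simp: A'_def)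
    show "\<Phi> j \<noteq> {}" if "j \<in> J" for j using that ne J by auto
  next
    fix B and c :: "'a \<Rightarrow> real" assume B: "finite B" "B \<subseteq> A'" and c: "\<And>a. 0 \<le> c a"
    obtain h where h: "bij_betw h {1..card B} B" using ex_bij_betw_nat_finite_1[OF B(1)] by blast
    define n where "n = card B"
    have hB: "h i \<in> B" if "i \<in> {1..n}" for i using h that unfolding n_def by (rule bij_betwE[rule_format])
    \<comment> \<open>The coefficients are absorbed into the components with finite exponent.\<close>
    define d where "d a j = (if j \<in> J then c a powr \<rho> j else 1)" for a j
    have "\<forall>a\<in>B. \<exists>a'. a' \<in> A \<and> \<tau> a' = (\<Prod>j\<in>I. d a j) * \<tau> a \<and>
        (\<forall>j\<in>I. \<forall>t\<in>\<Phi> j. ev j a' t = d a j * ev j a t)"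
    proof
      fix a assume "a \<in> B"
      then have "a \<in> A" using B by (auto simp: A'_def)
      moreover have "0 \<le> d a j" for j by (simp add: d_def)
      ultimately show "\<exists>a'. a' \<in> A \<and> \<tau> a' = (\<Prod>j\<in>I. d a j) * \<tau> a \<and>
          (\<forall>j\<in>I. \<forall>t\<in>\<Phi> j. ev j a' t = d a j * ev j a t)"
        using scale[of a "d a"] by blast
    qed
    from bchoice[OF this] obtain s where s: "\<forall>a\<in>B. s a \<in> A \<and> \<tau> (s a) = (\<Prod>j\<in>I. d a j) * \<tau> a \<and>
        (\<forall>j\<in>I. \<forall>t\<in>\<Phi> j. ev j (s a) t = d a j * ev j a t)" by blast
    have sA: "s a \<in> A" and s\<tau>: "\<tau> (s a) = (\<Prod>j\<in>I. d a j) * \<tau> a" if "a \<in> B" for a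
      using s that by auto
    have s_ev: "ev j (s a) t = d a j * ev j a t" if "a \<in> B" "j \<in> I" "t \<in> \<Phi> j" for a j t
      using s that by auto
    have s\<tau>': "\<tau> (s a) = c a powr \<sigma> * \<tau> a" if "a \<in> B" for a
    proof -
      have "(\<Prod>j\<in>I. d a j) = (\<Prod>j\<in>J. c a powr \<rho> j)"
        unfolding d_def using J \<open>finite I\<close> by (simp add: prod.If_cases Int_absorb1)
      then show ?thesis using s\<tau>[OF that] prod_powr_const[OF J(1) J_ne c \<rho>] by (simp add: sum\<rho>)
    qed
    define W where "W j = (SUP t\<in>\<Phi> j. ell_norm (q j) n (\<lambda>i. ev j (s (h i)) t))" for j
    define S where "S j = (SUP t\<in>\<Phi> j. \<Sum>a\<in>B. c a * e a j t)" for j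
    have ell_bdd: "bdd_above ((\<lambda>t. ell_norm (q j) n (\<lambda>i. ev j (s (h i)) t)) ` \<Phi> j)" if j: "j \<in> I" for j
    proof -
      have "\<forall>i\<in>{1..n}. \<exists>M. \<forall>t\<in>\<Phi> j. \<bar>ev j (s (h i)) t\<bar> \<le> M"
        using b[OF sA[OF hB] j] by (auto simp: bounded_iff)
      from bchoice[OF this] obtain M where M: "\<forall>i\<in>{1..n}. \<forall>t\<in>\<Phi> j. \<bar>ev j (s (h i)) t\<bar> \<le> M i" by blast
      have "ell_norm (q j) n (\<lambda>i. ev j (s (h i)) t) \<le> ell_norm (q j) n M" if "t \<in> \<Phi> j" for t
        using M that by (intro ell_norm_mono q j) (meson abs_ge_self order_trans)
      then show ?thesis by (rule bdd_aboveI2)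
    qed
    have W_nonneg: "0 \<le> W j" if j: "j \<in> I" for j
    proof -
      obtain t where t: "t \<in> \<Phi> j" using ne[OF j] by blast
      have "0 \<le> ell_norm (q j) n (\<lambda>i. ev j (s (h i)) t)" by (rule ell_norm_nonneg)
      also have "\<dots> \<le> W j" unfolding W_def by (intro cSUP_upper ell_bdd j t)
      finally show ?thesis .
    qed
    have W_inf: "W j \<le> 1" if j: "j \<in> I - J" for j
      unfolding W_def
    proof (rule cSUP_least)
      fix t assume t: "t \<in> \<Phi> j"
      have "\<bar>ev j (s (h i)) t\<bar> \<le> 1" if "i \<in> {1..n}" for i
        using s_ev[OF hB[OF that], of j t] hB[OF that] B j t by (auto simp: A'_def d_def)
      moreover have "q j = \<infinity>" using j by (simp add: J_def)
      ultimately show "ell_norm (q j) n (\<lambda>i. ev j (s (h i)) t) \<le> 1"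
        by (metis ell_norm_infinity_le zero_le_one)
    qed (use ne j in auto)
    have W_fin: "\<theta> j * W j powr (1 / \<rho> j) \<le> S j" if j: "j \<in> J" for j
    proof -
      have \<rho>j: "0 < \<rho> j" and jI: "j \<in> I" using \<rho>[OF j] j J by auto
      have e_bdd: "bdd_above ((\<lambda>t. \<Sum>a\<in>B. c a * e a j t) ` \<Phi> j)"
        unfolding e_def using B powr_b[OF _ j]
        by (intro bdd_above_image bounded_sum_image bounded_mult_image) (auto simp: A'_def)
      have "W j \<le> (S j / \<theta> j) powr \<rho> j"
        unfolding W_def
      proof (rule cSUP_least)
        fix t assume t: "t \<in> \<Phi> j"
        have "(\<Sum>i=1..n. \<bar>ev j (s (h i)) t\<bar> powr (1 / \<rho> j)) = (\<Sum>i=1..n. c (h i) * \<bar>ev j (h i) t\<bar> powr (1 / \<rho> j))"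
        proof (intro sum.cong refl)
          fix i assume i: "i \<in> {1..n}"
          show "\<bar>ev j (s (h i)) t\<bar> powr (1 / \<rho> j) = c (h i) * \<bar>ev j (h i) t\<bar> powr (1 / \<rho> j)"
            using s_ev[OF hB[OF i] jI t] c \<rho>j j by (simp add: d_def abs_mult powr_mult powr_powr)
        qed
        also have "\<dots> = (\<Sum>a\<in>B. c a * \<bar>ev j a t\<bar> powr (1 / \<rho> j))"
          using h unfolding n_def by (rule sum.reindex_bij_betw)
        also have "\<dots> = (\<Sum>a\<in>B. c a * e a j t) / \<theta> j"
          using \<theta>[OF j] by (simp add: e_def sum_divide_distrib)
        also have "\<dots> \<le> S j / \<theta> j"
          unfolding S_def using \<theta>[OF j] by (intro divide_right_mono cSUP_upper t e_bdd) auto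
        finally have "(\<Sum>i=1..n. \<bar>ev j (s (h i)) t\<bar> powr (1 / \<rho> j)) powr \<rho> j \<le> (S j / \<theta> j) powr \<rho> j"
          using \<rho>j by (intro powr_mono2) (auto intro: sum_nonneg)
        then show "ell_norm (q j) n (\<lambda>i. ev j (s (h i)) t) \<le> (S j / \<theta> j) powr \<rho> j"
          using q[OF jI] \<rho>j by (simp add: ell_norm_finite \<rho>_def)
      qed (use ne jI in auto)
      then have "W j powr (1 / \<rho> j) \<le> ((S j / \<theta> j) powr \<rho> j) powr (1 / \<rho> j)"
        using \<rho>j W_nonneg[OF jI] by (intro powr_mono2) auto
      also have "\<dots> = S j / \<theta> j"
      proof -
        obtain t where t: "t \<in> \<Phi> j" using ne[OF jI] by blast
        have "0 \<le> (\<Sum>a\<in>B. c a * e a j t)"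
          unfolding e_def using c \<theta>[OF j] by (intro sum_nonneg mult_nonneg_nonneg) auto
        also have "\<dots> \<le> S j" unfolding S_def by (intro cSUP_upper t e_bdd)
        finally show ?thesis using \<rho>j \<theta>[OF j] by (simp add: powr_powr)
      qed
      finally show ?thesis using \<theta>[OF j] by (simp add: field_simps)
    qed
    have "(\<Sum>a\<in>B. c a * \<tau>' a) = (\<Sum>i=1..n. c (h i) * \<tau>' (h i))"
      using h unfolding n_def by (rule sum.reindex_bij_betw[symmetric])
    also have "\<dots> = (\<Sum>i=1..n. \<bar>\<tau> (s (h i))\<bar> powr (1 / \<sigma>)) / C powr (1 / \<sigma>)"
      unfolding sum_divide_distrib
    proof (intro sum.cong refl)
      fix i assume i: "i \<in> {1..n}"
      have "0 \<le> \<tau> (h i)" using hB[OF i] B \<tau> by (auto simp: A'_def)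
      then show "c (h i) * \<tau>' (h i) = \<bar>\<tau> (s (h i))\<bar> powr (1 / \<sigma>) / C powr (1 / \<sigma>)"
        using c \<sigma> C by (simp add: s\<tau>'[OF hB[OF i]] \<tau>'_def abs_mult powr_mult powr_powr powr_divide)
    qed
    also have "\<dots> \<le> (\<Prod>j\<in>J. W j) powr (1 / \<sigma>)"
    proof -
      have "(\<Sum>i=1..n. \<bar>\<tau> (s (h i))\<bar> powr (1 / \<sigma>)) powr \<sigma> \<le> C * (\<Prod>j\<in>I. W j)"
        using le[of n "\<lambda>i. s (h i)"] sA hB finite \<open>1 \<le> p\<close> by (simp add: ell_norm_finite \<sigma>_def W_def)
      also have "(\<Prod>j\<in>I. W j) = (\<Prod>j\<in>I - J. W j) * (\<Prod>j\<in>J. W j)"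
        using J \<open>finite I\<close> by (metis prod.subset_diff)
      also have "\<dots> \<le> 1 * (\<Prod>j\<in>J. W j)"
        using W_inf W_nonneg J by (intro mult_right_mono prod_le_1 prod_nonneg) auto
      finally have "(\<Sum>i=1..n. \<bar>\<tau> (s (h i))\<bar> powr (1 / \<sigma>)) powr \<sigma> \<le> C * (\<Prod>j\<in>J. W j)"
        using C by simp
      then have "((\<Sum>i=1..n. \<bar>\<tau> (s (h i))\<bar> powr (1 / \<sigma>)) powr \<sigma>) powr (1 / \<sigma>) \<le> (C * (\<Prod>j\<in>J. W j)) powr (1 / \<sigma>)"
        using \<sigma> by (intro powr_mono2) auto
      then show ?thesis
        using \<sigma> C by (simp add: powr_powr powr_mult sum_nonneg field_simps)
    qed
    also have "\<dots> = (\<Prod>j\<in>J. (W j powr (1 / \<rho> j)) powr \<theta> j)"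
    proof -
      have "(W j powr (1 / \<rho> j)) powr \<theta> j = W j powr (1 / \<sigma>)" if "j \<in> J" for j
        using \<rho>[OF that] by (simp add: powr_powr \<theta>_def)
      then show ?thesis by (simp add: prod_powr_distrib)
    qed
    also have "\<dots> \<le> (\<Sum>j\<in>J. \<theta> j * W j powr (1 / \<rho> j))"
      using \<theta> sum\<theta> J by (intro weighted_arith_geo_mean) auto
    also have "\<dots> \<le> (\<Sum>j\<in>J. S j)" by (intro sum_mono W_fin)
    finally show "(\<Sum>a\<in>B. c a * \<tau>' a) \<le> (\<Sum>j\<in>J. SUP t\<in>\<Phi> j. \<Sum>a\<in>B. c a * e a j t)"
      by (simp add: S_def)
  qed
  then obtain L where L: "\<And>j. j \<in> J \<Longrightarrow> mean_on (\<Phi> j) (L j)"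
    and dom: "\<And>a. a \<in> A' \<Longrightarrow> \<tau>' a \<le> (\<Sum>j\<in>J. L j (e a j))" by blast
  define N where "N j = mean_norm (q j) (\<Phi> j) (L j)" for j
  have avg: "averaging (q j) (\<Phi> j) (L j)" if "j \<in> I" for j
    using that q ne L by (auto intro!: averagingI simp: J_def)
  have "\<tau> a \<le> C * (\<Prod>j\<in>I. N j (ev j a))" if a: "a \<in> A" for a
  proof -
    have N_nonneg: "0 \<le> N j (ev j a)" if "j \<in> I" for j
      unfolding N_def by (rule averaging.nonneg[OF avg[OF that] b[OF a that]])
    \<comment> \<open>The means only matter after each component of \<open>a\<close> has been scaled to seminorm at most 1.\<close>
    have *: "\<tau> a \<le> C * (\<Prod>j\<in>I. N j (ev j a) + \<delta>)" if \<delta>: "0 < \<delta>" for \<delta>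
    proof -
      define c where "c j = 1 / (N j (ev j a) + \<delta>)" for j
      have c: "0 < c j" "c j * N j (ev j a) \<le> 1" if "j \<in> I" for j
        using N_nonneg[OF that] \<delta> by (auto simp: c_def field_simps)
      obtain a' where a': "a' \<in> A" "\<tau> a' = (\<Prod>j\<in>I. c j) * \<tau> a"
        "\<And>j t. j \<in> I \<Longrightarrow> t \<in> \<Phi> j \<Longrightarrow> ev j a' t = c j * ev j a t"
        using scale[OF a, of c] less_imp_le[OF c(1)] by blast
      have N_a': "N j (ev j a') \<le> 1" if j: "j \<in> I" for j
      proof -
        have "N j (ev j a') \<le> N j (\<lambda>t. c j * ev j a t)"
          unfolding N_def using a' a j by (intro averaging.mono[OF avg] bounded_mult_image b) auto
        also have "\<dots> = c j * N j (ev j a)"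
          unfolding N_def using averaging.scale[OF avg b, OF j a j] c(1)[OF j] by simp
        finally show ?thesis using c(2)[OF j] by simp
      qed
      have "a' \<in> A'"
        unfolding A'_def
      proof (intro CollectI conjI ballI a')
        fix j t assume j: "j \<in> I - J" and t: "t \<in> \<Phi> j"
        have "N j (ev j a') = (SUP t\<in>\<Phi> j. \<bar>ev j a' t\<bar>)" using j by (simp add: N_def mean_norm_def J_def)
        then show "\<bar>ev j a' t\<bar> \<le> 1"
          using averaging.abs_le_SUP[OF avg[of j] b[OF a'(1), of j], of t] N_a'[of j] j t by simp
      qed
      then have "\<tau>' a' \<le> (\<Sum>j\<in>J. L j (e a' j))" by (rule dom)
      also have "\<dots> \<le> (\<Sum>j\<in>J. \<theta> j)"
      proof (intro sum_mono)
        fix j assume j: "j \<in> J"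
        then have jI: "j \<in> I" "q j \<noteq> \<infinity>" by (auto simp: J_def)
        define l where "l = L j (\<lambda>t. \<bar>ev j a' t\<bar> powr (1 / \<rho> j))"
        have "0 \<le> l"
          unfolding l_def using jI
          by (intro mean_on_nonneg[OF L[OF j] ne] powr_b a' j) auto
        moreover have "l powr \<rho> j \<le> 1"
          using N_a'[OF jI(1)] q[OF jI(1)] jI(2) by (simp add: N_def l_def mean_norm_finite \<rho>_def)
        ultimately have "l \<le> 1"
          using \<rho>[OF j] gr_one_powr[of l "\<rho> j"] by linarith
        moreover have "L j (e a' j) = \<theta> j * l"
          unfolding e_def l_def by (intro mean_on_mult[OF L[OF j]] powr_b a' j)
        ultimately show "L j (e a' j) \<le> \<theta> j" using \<theta>[OF j] by (simp add: mult_left_le)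
      qed
      finally have "\<tau>' a' \<le> 1" using sum\<theta> by simp
      moreover have "0 \<le> \<tau> a'" by (rule \<tau>[OF a'(1)])
      ultimately have "\<tau> a' / C \<le> 1"
        unfolding \<tau>'_def using gr_one_powr[of "\<tau> a' / C" "1 / \<sigma>"] \<sigma> by (simp add: not_less[symmetric] del: divide_less_eq_1 less_divide_eq_1 divide_le_eq_1) blast
      then have "(\<Prod>j\<in>I. c j) * \<tau> a \<le> C" using C by (simp add: a')
      moreover have "0 < (\<Prod>j\<in>I. N j (ev j a) + \<delta>)"
        using N_nonneg \<delta> by (intro prod_pos) (auto intro: add_nonneg_pos)
      moreover have "(\<Prod>j\<in>I. c j) = 1 / (\<Prod>j\<in>I. N j (ev j a) + \<delta>)"
        by (simp add: c_def prod_dividef)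
      ultimately show ?thesis by (simp add: field_simps)
    qed
    have "((\<lambda>\<delta>. C * (\<Prod>j\<in>I. N j (ev j a) + \<delta>)) \<longlongrightarrow> C * (\<Prod>j\<in>I. N j (ev j a) + 0)) (at_right 0)"
      by (intro tendsto_intros)
    then have "\<tau> a \<le> C * (\<Prod>j\<in>I. N j (ev j a) + 0)"
      by (rule tendsto_lowerbound) (use * in \<open>auto simp: eventually_at_filter\<close>)
    then show ?thesis by simp
  qed
  then show ?thesis using avg by (auto simp: N_def)
qed

section \<open>Duality and weak norms\<close>

text \<open>
  The part of the structure of a normed space on which the estimates for functionals rest. Banach
  spaces share it with the duals of Banach lattices, whose weak norms involve the second dual.
\<close>

locale scaled_space =
  fixes V :: "('a, 'z) normed_scheme" (structure)
  assumes smult_carrier: "x \<in> carrier V \<Longrightarrow> a \<odot>\<^bsub>V\<^esub> x \<in> carrier V"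
    and norm_nonneg: "x \<in> carrier V \<Longrightarrow> 0 \<le> nrm V x"
    and norm_smult: "x \<in> carrier V \<Longrightarrow> nrm V (a \<odot>\<^bsub>V\<^esub> x) = \<bar>a\<bar> * nrm V x"
    and carrier_nonempty: "carrier V \<noteq> {}"

sublocale banach_space \<subseteq> scaled_space
  by standard (auto simp: nrm_nonneg nrm_smult)

definition dual_ball :: "('a, 'z) normed_scheme \<Rightarrow> ('a \<Rightarrow> real) set" where
  "dual_ball V = {f \<in> carrier (dual_space V). nrm (dual_space V) f \<le> 1}"

lemma weak_norm_dual_ball: "weak_norm V q n x = (SUP f\<in>dual_ball V. ell_norm q n (\<lambda>i. f (x i)))"
  by (simp add: weak_norm_def dual_ball_def)

lemma carrier_dual_space: "carrier (dual_space V) = bounded_ops V real_line \<inter> extensional (carrier V)"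
  by (simp add: dual_space_def)

lemma nrm_dual_space: "nrm (dual_space V) f = (SUP x\<in>{x \<in> carrier V. nrm V x \<le> 1}. \<bar>f x\<bar>)"
  by (simp add: dual_space_def)

lemma dual_space_add:
  "f \<in> carrier (dual_space V) \<Longrightarrow> x \<in> carrier V \<Longrightarrow> y \<in> carrier V \<Longrightarrow> f (x \<oplus>\<^bsub>V\<^esub> y) = f x + f y"
  by (simp add: dual_space_def bounded_ops_def)

lemma dual_space_smult:
  "f \<in> carrier (dual_space V) \<Longrightarrow> x \<in> carrier V \<Longrightarrow> f (a \<odot>\<^bsub>V\<^esub> x) = a * f x"
  by (simp add: dual_space_def bounded_ops_def)

lemma dual_spaceI:
  assumes "f \<in> extensional (carrier V)"
    and "\<And>x y. x \<in> carrier V \<Longrightarrow> y \<in> carrier V \<Longrightarrow> f (x \<oplus>\<^bsub>V\<^esub> y) = f x + f y"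
    and "\<And>x a. x \<in> carrier V \<Longrightarrow> f (a \<odot>\<^bsub>V\<^esub> x) = a * f x"
    and "\<And>x. x \<in> carrier V \<Longrightarrow> \<bar>f x\<bar> \<le> K * nrm V x"
  shows "f \<in> carrier (dual_space V)"
  using assms by (auto simp: carrier_dual_space bounded_ops_def intro!: exI[of _ K])

context scaled_space
begin

lemma dual_space_bound:
  assumes "f \<in> carrier (dual_space V)"
  obtains K where "0 \<le> K" "\<And>x. x \<in> carrier V \<Longrightarrow> \<bar>f x\<bar> \<le> K * nrm V x"
proof -
  obtain K where K: "\<And>x. x \<in> carrier V \<Longrightarrow> \<bar>f x\<bar> \<le> K * nrm V x"
    using assms unfolding carrier_dual_space bounded_ops_def real_line_simps by blast
  have "\<bar>f x\<bar> \<le> max K 0 * nrm V x" if "x \<in> carrier V" for x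
    using K[OF that] norm_nonneg[OF that] by (meson max.cobounded1 mult_right_mono order_trans)
  then show ?thesis using that[of "max K 0"] by simp
qed

lemma dual_space_bdd_above:
  assumes "f \<in> carrier (dual_space V)"
  shows "bdd_above ((\<lambda>x. \<bar>f x\<bar>) ` {x \<in> carrier V. nrm V x \<le> 1})"
proof -
  obtain K where K: "0 \<le> K" "\<And>x. x \<in> carrier V \<Longrightarrow> \<bar>f x\<bar> \<le> K * nrm V x"
    using dual_space_bound[OF assms] by blast
  have "\<bar>f x\<bar> \<le> K" if "x \<in> carrier V" "nrm V x \<le> 1" for x
    using K(2)[OF that(1)] mult_left_mono[OF that(2) K(1)] by simp
  then show ?thesis by (intro bdd_aboveI2[where M = K]) auto
qed

lemma unit_ball_nonempty: "{x \<in> carrier V. nrm V x \<le> 1} \<noteq> {}"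
proof -
  obtain x where "x \<in> carrier V" using carrier_nonempty by blast
  then have "0 \<odot>\<^bsub>V\<^esub> x \<in> {x \<in> carrier V. nrm V x \<le> 1}" using smult_carrier norm_smult by simp
  then show ?thesis by blast
qed

lemma dual_space_le:
  assumes f: "f \<in> carrier (dual_space V)" and x: "x \<in> carrier V"
  shows "\<bar>f x\<bar> \<le> nrm (dual_space V) f * nrm V x"
proof (cases "nrm V x = 0")
  case True
  then show ?thesis using dual_space_bound[OF f] x by (metis mult_zero_right)
next
  case False
  then have pos: "0 < nrm V x" using norm_nonneg[OF x] by simp
  define y where "y = (1 / nrm V x) \<odot> x"
  have "y \<in> carrier V" "nrm V y \<le> 1" using x pos smult_carrier norm_smult by (auto simp: y_def)
  then have "\<bar>f y\<bar> \<le> nrm (dual_space V) f"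
    unfolding nrm_dual_space by (intro cSUP_upper dual_space_bdd_above f) auto
  moreover have "f y = f x / nrm V x" using dual_space_smult[OF f x] by (simp add: y_def)
  ultimately show ?thesis using pos by (simp add: field_simps)
qed

lemma dual_ball_le:
  assumes "f \<in> dual_ball V" "x \<in> carrier V" shows "\<bar>f x\<bar> \<le> nrm V x"
proof -
  have "\<bar>f x\<bar> \<le> nrm (dual_space V) f * nrm V x"
    using assms by (intro dual_space_le) (auto simp: dual_ball_def)
  also have "\<dots> \<le> 1 * nrm V x"
    using assms norm_nonneg by (intro mult_right_mono) (auto simp: dual_ball_def)
  finally show ?thesis by simp
qed

lemma dual_ballI:
  assumes "f \<in> carrier (dual_space V)" "\<And>x. x \<in> carrier V \<Longrightarrow> \<bar>f x\<bar> \<le> nrm V x"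
  shows "f \<in> dual_ball V"
  using assms unit_ball_nonempty
  by (auto simp: dual_ball_def nrm_dual_space intro!: cSUP_least intro: order_trans)

lemma nrm_dual_space_nonneg:
  assumes "f \<in> carrier (dual_space V)" shows "0 \<le> nrm (dual_space V) f"
proof -
  obtain x where x: "x \<in> {x \<in> carrier V. nrm V x \<le> 1}" using unit_ball_nonempty by blast
  have "0 \<le> \<bar>f x\<bar>" by simp
  also have "\<dots> \<le> nrm (dual_space V) f"
    unfolding nrm_dual_space by (intro cSUP_upper dual_space_bdd_above assms x)
  finally show ?thesis .
qed

lemma weak_norm_bdd_above:
  assumes "1 \<le> q" "\<And>i. i \<in> {1..n} \<Longrightarrow> x i \<in> carrier V"
  shows "bdd_above ((\<lambda>f. ell_norm q n (\<lambda>i. f (x i))) ` dual_ball V)"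
  using assms dual_ball_le norm_nonneg
  by (intro bdd_aboveI2[where M = "ell_norm q n (\<lambda>i. nrm V (x i))"] ell_norm_mono) auto

lemma ell_norm_le_weak_norm:
  assumes "1 \<le> q" "\<And>i. i \<in> {1..n} \<Longrightarrow> x i \<in> carrier V" "f \<in> dual_ball V"
  shows "ell_norm q n (\<lambda>i. f (x i)) \<le> weak_norm V q n x"
  unfolding weak_norm_dual_ball using assms by (intro cSUP_upper weak_norm_bdd_above)

end

lemma zero_functional:
  assumes "scaled_space V" "\<And>x y. x \<in> carrier V \<Longrightarrow> y \<in> carrier V \<Longrightarrow> x \<oplus>\<^bsub>V\<^esub> y \<in> carrier V"
  shows "(\<lambda>x\<in>carrier V. 0) \<in> dual_ball V"
proof -
  interpret scaled_space V by fact
  have "(\<lambda>x\<in>carrier V. 0) \<in> carrier (dual_space V)"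
    using assms(2) smult_carrier by (auto simp: carrier_dual_space bounded_ops_def intro: exI[of _ 0])
  then show ?thesis using norm_nonneg by (intro dual_ballI) auto
qed

lemma dual_lattice_simps:
  "carrier (dual_lattice E) = carrier (dual_space E)"
  "nrm (dual_lattice E) = nrm (dual_space E)"
  "f \<oplus>\<^bsub>dual_lattice E\<^esub> g = (\<lambda>x\<in>carrier E. f x + g x)"
  "a \<odot>\<^bsub>dual_lattice E\<^esub> f = (\<lambda>x\<in>carrier E. a * f x)"
  "\<zero>\<^bsub>dual_lattice E\<^esub> = (\<lambda>x\<in>carrier E. 0)"
  "leq (dual_lattice E) f g \<longleftrightarrow> (\<forall>x\<in>pos_cone E. f x \<le> g x)"
  by (simp_all add: dual_lattice_def dual_space_def normed.defs normed_lattice.defs)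

context banach_space
begin

lemma dual_space_add_closed:
  assumes "f \<in> carrier (dual_space V)" "g \<in> carrier (dual_space V)"
  shows "(\<lambda>x\<in>carrier V. f x + g x) \<in> carrier (dual_space V)"
proof -
  obtain K K' where K: "\<And>x. x \<in> carrier V \<Longrightarrow> \<bar>f x\<bar> \<le> K * nrm V x" "\<And>x. x \<in> carrier V \<Longrightarrow> \<bar>g x\<bar> \<le> K' * nrm V x"
    using dual_space_bound[OF assms(1)] dual_space_bound[OF assms(2)] by metis
  have "\<bar>f x + g x\<bar> \<le> (K + K') * nrm V x" if "x \<in> carrier V" for x
    using K(1)[OF that] K(2)[OF that] by (simp add: distrib_right)
  then show ?thesis
    using assms dual_space_add[OF assms(1)] dual_space_add[OF assms(2)]
      dual_space_smult[OF assms(1)] dual_space_smult[OF assms(2)]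
    by (intro dual_spaceI[where K = "K + K'"]) (auto simp: algebra_simps)
qed

lemma dual_space_smult_closed:
  assumes "f \<in> carrier (dual_space V)"
  shows "(\<lambda>x\<in>carrier V. a * f x) \<in> carrier (dual_space V)"
proof -
  obtain K where K: "\<And>x. x \<in> carrier V \<Longrightarrow> \<bar>f x\<bar> \<le> K * nrm V x"
    using dual_space_bound[OF assms] by metis
  have "\<bar>a * f x\<bar> \<le> (\<bar>a\<bar> * K) * nrm V x" if "x \<in> carrier V" for x
    using mult_left_mono[OF K[OF that], of "\<bar>a\<bar>"] by (simp add: abs_mult mult.assoc)
  then show ?thesis
    using dual_space_add[OF assms] dual_space_smult[OF assms]
    by (intro dual_spaceI[where K = "\<bar>a\<bar> * K"]) (auto simp: algebra_simps)
qed

end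

lemma dual_lattice_scaled_space:
  assumes "banach_lattice F"
  shows "scaled_space (dual_lattice F)"
proof -
  interpret banach_lattice F by fact
  have le: "nrm (dual_space F) (\<lambda>x\<in>carrier F. a * f x) \<le> \<bar>a\<bar> * nrm (dual_space F) f"
    if "f \<in> carrier (dual_space F)" for a f
    unfolding nrm_dual_space
    by (intro cSUP_least unit_ball_nonempty)
      (auto simp: abs_mult intro!: mult_left_mono cSUP_upper dual_space_bdd_above that)
  have eq: "nrm (dual_space F) (\<lambda>x\<in>carrier F. a * f x) = \<bar>a\<bar> * nrm (dual_space F) f"
    if f: "f \<in> carrier (dual_space F)" for a f
  proof (cases "a = 0")
    case True
    then show ?thesis
      using le[OF f, of a] nrm_dual_space_nonneg[OF dual_space_smult_closed[OF f], of a] by simp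
  next
    case False
    let ?g = "\<lambda>x\<in>carrier F. a * f x"
    have "(\<lambda>x\<in>carrier F. (1 / a) * ?g x) = f"
      using False f by (auto simp: carrier_dual_space extensional_def fun_eq_iff)
    then have "nrm (dual_space F) f \<le> \<bar>1 / a\<bar> * nrm (dual_space F) ?g"
      using le[OF dual_space_smult_closed[OF f], of "1 / a" a] by simp
    then show ?thesis using le[OF f, of a] False by (simp add: field_simps)
  qed
  have "(\<lambda>x\<in>carrier F. 0) \<in> dual_ball F"
    using zero_functional[of F] scaled_space_axioms by blast
  then show ?thesis
    using dual_space_smult_closed nrm_dual_space_nonneg eq
    by (intro scaled_space.intro) (auto simp: dual_lattice_simps dual_ball_def)
qed

lemma pos_cone_dual_lattice:
  "pos_cone (dual_lattice F) = {f \<in> carrier (dual_space F). \<forall>x\<in>pos_cone F. 0 \<le> f x}"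
  by (auto simp: pos_cone_def[of "dual_lattice F"] dual_lattice_simps) (auto simp: pos_cone_def)

lemma dual_lattice_ball_nonempty:
  assumes "banach_lattice F" shows "dual_ball (dual_lattice F) \<noteq> {}"
proof -
  interpret banach_lattice F by fact
  have "(\<lambda>x\<in>carrier (dual_lattice F). 0) \<in> dual_ball (dual_lattice F)"
    using dual_lattice_scaled_space[OF assms] dual_space_add_closed
    by (intro zero_functional) (auto simp: dual_lattice_simps)
  then show ?thesis by blast
qed

section \<open>Summing functions\<close>

text \<open>
  The last condition is the inequality of a \<open>q\<close>-summing operator with constant \<open>1\<close>, for all vectors. The
  functions of interest are the \<open>L\<^sub>q\<close>-seminorms of vectors regarded as functions on the dual unit ball.
\<close>

definition summing_function :: "ennreal \<Rightarrow> ('a, 'z) normed_scheme \<Rightarrow> ('a \<Rightarrow> real) \<Rightarrow> bool" where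
  "summing_function q V g \<longleftrightarrow>
     (\<forall>x\<in>carrier V. 0 \<le> g x \<and> g x \<le> nrm V x \<and> (\<forall>t. g (t \<odot>\<^bsub>V\<^esub> x) = \<bar>t\<bar> * g x)) \<and>
     (\<forall>n x. (\<forall>i\<in>{1..n}. x i \<in> carrier V) \<longrightarrow> ell_norm q n (\<lambda>i. g (x i)) \<le> weak_norm V q n x)"

context averaging
begin

lemma mean_norm_summing_function:
  assumes V: "scaled_space V" and \<pi>: "\<And>t. t \<in> \<Phi> \<Longrightarrow> \<pi> t \<in> dual_ball V"
  shows "summing_function q V (\<lambda>x. N (\<lambda>t. \<pi> t x))"
proof -
  interpret V: scaled_space V by fact
  have le: "\<bar>\<pi> t x\<bar> \<le> nrm V x" if "t \<in> \<Phi>" "x \<in> carrier V" for t x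
    using V.dual_ball_le[OF \<pi>[OF that(1)] that(2)] .
  then have b: "bounded ((\<lambda>t. \<pi> t x) ` \<Phi>)" if "x \<in> carrier V" for x
    using that by (auto simp: bounded_iff)
  have "N (\<lambda>t. \<pi> t (c \<odot>\<^bsub>V\<^esub> x)) = \<bar>c\<bar> * N (\<lambda>t. \<pi> t x)" if x: "x \<in> carrier V" for c x
  proof -
    have "\<pi> t (c \<odot>\<^bsub>V\<^esub> x) = c * \<pi> t x" if "t \<in> \<Phi>" for t
      using dual_space_smult[of "\<pi> t" V x c] \<pi>[OF that] x by (simp add: dual_ball_def)
    then have "N (\<lambda>t. \<pi> t (c \<odot>\<^bsub>V\<^esub> x)) = N (\<lambda>t. c * \<pi> t x)"
      using b[OF V.smult_carrier[OF x]] bounded_mult_image[OF b[OF x], of c] by (intro antisym mono) auto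
    then show ?thesis using scale[OF b[OF x]] by simp
  qed
  moreover have "ell_norm q n (\<lambda>i. N (\<lambda>t. \<pi> t (x i))) \<le> weak_norm V q n x"
    if x: "\<forall>i\<in>{1..n}. x i \<in> carrier V" for n x
  proof -
    have D: "ell_norm q n (\<lambda>i. \<pi> t (x i)) \<le> weak_norm V q n x" if "t \<in> \<Phi>" for t
      using x \<pi>[OF that] by (intro V.ell_norm_le_weak_norm exponent) auto
    obtain t where "t \<in> \<Phi>" using nonempty by blast
    then have "0 \<le> weak_norm V q n x"
      using D[of t] ell_norm_nonneg[of q n "\<lambda>i. \<pi> t (x i)"] by linarith
    then show ?thesis using D b x by (intro ell_norm_le) auto
  qed
  ultimately show ?thesis
    using nonneg[OF b] le_bound[OF b V.norm_nonneg le] by (simp add: summing_function_def)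
qed

lemma mean_norm_triangle:
  assumes V: "banach_space V" and \<pi>: "\<And>t. t \<in> \<Phi> \<Longrightarrow> \<pi> t \<in> dual_ball V"
    and x: "x \<in> carrier V" and y: "y \<in> carrier V"
  shows "N (\<lambda>t. \<pi> t (x \<oplus>\<^bsub>V\<^esub> y)) \<le> N (\<lambda>t. \<pi> t x) + N (\<lambda>t. \<pi> t y)"
proof -
  interpret V: banach_space V by fact
  have b: "bounded ((\<lambda>t. \<pi> t z) ` \<Phi>)" if "z \<in> carrier V" for z
    using V.dual_ball_le[OF \<pi> that] by (auto simp: bounded_iff)
  have "\<pi> t (x \<oplus>\<^bsub>V\<^esub> y) = \<pi> t x + \<pi> t y" if "t \<in> \<Phi>" for t
    using dual_space_add[of "\<pi> t" V x y] \<pi>[OF that] x y by (simp add: dual_ball_def)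
  then have "N (\<lambda>t. \<pi> t (x \<oplus>\<^bsub>V\<^esub> y)) \<le> N (\<lambda>t. \<pi> t x + \<pi> t y)"
    using x y by (intro mono bounded_add_image b) auto
  also have "\<dots> \<le> N (\<lambda>t. \<pi> t x) + N (\<lambda>t. \<pi> t y)"
    by (intro triangle b x y)
  finally show ?thesis .
qed

end

section \<open>Multilinear operators dominated by summing functions\<close>

lemma tuples_update:
  "x \<in> tuples m E \<Longrightarrow> j \<in> {1..m} \<Longrightarrow> y \<in> carrier (E j) \<Longrightarrow> x(j := y) \<in> tuples m E"
  unfolding tuples_def by (intro PiE_I) (auto simp: PiE_def extensional_def)

lemma tuples_carrier: "x \<in> tuples m E \<Longrightarrow> j \<in> {1..m} \<Longrightarrow> x j \<in> carrier (E j)"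
  by (auto simp: tuples_def)

lemma restrict_in_tuples: "(\<And>j. j \<in> {1..m} \<Longrightarrow> x j \<in> carrier (E j)) \<Longrightarrow> (\<lambda>j\<in>{1..m}. x j) \<in> tuples m E"
  by (auto simp: tuples_def)

lemma tuples_eqI:
  "x \<in> tuples m E \<Longrightarrow> y \<in> tuples m E \<Longrightarrow> (\<And>j. j \<in> {1..m} \<Longrightarrow> x j = y j) \<Longrightarrow> x = y"
  unfolding tuples_def by (rule PiE_ext)

lemma multilinear_carrier: "T \<in> bounded_multilinear_ops m E F \<Longrightarrow> x \<in> tuples m E \<Longrightarrow> T x \<in> carrier F"
  by (simp add: bounded_multilinear_ops_def)

lemma multilinear_add:
  "T \<in> bounded_multilinear_ops m E F \<Longrightarrow> x \<in> tuples m E \<Longrightarrow> j \<in> {1..m} \<Longrightarrow> y \<in> carrier (E j) \<Longrightarrow>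
    z \<in> carrier (E j) \<Longrightarrow> T (x(j := y \<oplus>\<^bsub>E j\<^esub> z)) = T (x(j := y)) \<oplus>\<^bsub>F\<^esub> T (x(j := z))"
  by (simp add: bounded_multilinear_ops_def)

lemma multilinear_smult:
  "T \<in> bounded_multilinear_ops m E F \<Longrightarrow> x \<in> tuples m E \<Longrightarrow> j \<in> {1..m} \<Longrightarrow> y \<in> carrier (E j) \<Longrightarrow>
    T (x(j := a \<odot>\<^bsub>E j\<^esub> y)) = a \<odot>\<^bsub>F\<^esub> T (x(j := y))"
  by (simp add: bounded_multilinear_ops_def)

lemma multilinear_minus:
  assumes T: "T \<in> bounded_multilinear_ops m E F" and E: "\<And>j. j \<in> {1..m} \<Longrightarrow> real_space (E j)"
    and F: "real_space F" and x: "x \<in> tuples m E" and j: "j \<in> {1..m}"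
    and y: "y \<in> carrier (E j)" and z: "z \<in> carrier (E j)"
  shows "T (x(j := y \<ominus>\<^bsub>E j\<^esub> z)) = T (x(j := y)) \<ominus>\<^bsub>F\<^esub> T (x(j := z))"
proof -
  interpret Ej: real_space "E j" using E j by blast
  interpret F: real_space F by (rule F)
  have "T (x(j := z)) \<in> carrier F" by (rule multilinear_carrier[OF T tuples_update[OF x j z]])
  then show ?thesis
    using multilinear_add[OF T x j y, of "(-1) \<odot>\<^bsub>E j\<^esub> z"] multilinear_smult[OF T x j z, of "-1"] z
    by (simp add: Ej.minus_eq Ej.uminus_conv_scale F.minus_eq F.uminus_conv_scale)
qed

lemma multilinear_smult_all:
  assumes T: "T \<in> bounded_multilinear_ops m E F" and E: "\<And>j. j \<in> {1..m} \<Longrightarrow> real_space (E j)"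
    and F: "real_space F" and x: "x \<in> tuples m E"
  shows "T (\<lambda>j\<in>{1..m}. c j \<odot>\<^bsub>E j\<^esub> x j) = (\<Prod>j=1..m. c j) \<odot>\<^bsub>F\<^esub> T x"
proof -
  interpret F: real_space F by (rule F)
  define s where "s J = (\<lambda>j\<in>{1..m}. if j \<in> J then c j \<odot>\<^bsub>E j\<^esub> x j else x j)" for J
  have s: "s J \<in> tuples m E" for J
    unfolding s_def
  proof (rule restrict_in_tuples)
    fix j assume j: "j \<in> {1..m}"
    interpret real_space "E j" by (rule E[OF j])
    show "(if j \<in> J then c j \<odot>\<^bsub>E j\<^esub> x j else x j) \<in> carrier (E j)" using tuples_carrier[OF x j] by simp
  qed
  have "T (s J) = (\<Prod>j\<in>J. c j) \<odot>\<^bsub>F\<^esub> T x" if "finite J" "J \<subseteq> {1..m}" for J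
    using that
  proof (induction J rule: finite_induct)
    case empty
    have "s {} = x" using x by (intro tuples_eqI[OF s x]) (simp add: s_def)
    then show ?case using multilinear_carrier[OF T x] by simp
  next
    case (insert k J)
    have k: "k \<in> {1..m}" using insert by simp
    have "s (insert k J) = (s J)(k := c k \<odot>\<^bsub>E k\<^esub> x k)" "(s J)(k := x k) = s J"
      using insert.hyps k by (auto simp: s_def fun_eq_iff)
    then have "T (s (insert k J)) = c k \<odot>\<^bsub>F\<^esub> T (s J)"
      using multilinear_smult[OF T s k tuples_carrier[OF x k], of J "c k"] by simp
    then show ?case
      using insert multilinear_carrier[OF T x] by (simp add: F.scale_scale)
  qed
  from this[of "{1..m}"] show ?thesis by (simp add: s_def cong: restrict_cong)
qed

lemma recip_sum:
  assumes "1 \<le> r" "1 \<le> p" and ps: "\<And>j. j \<in> {1..m} \<Longrightarrow> 1 \<le> ps j"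
    and eq: "1 / p = (\<Sum>j=1..m. 1 / ps j) + 1 / r"
  shows "recip p = (\<Sum>j=1..m. recip (ps j)) + recip r"
proof -
  have nn: "0 \<le> (\<Sum>j=1..m. recip (ps j))" using recip_bounds[OF ps] by (intro sum_nonneg) auto
  have "ennreal (recip p) = (\<Sum>j=1..m. ennreal (recip (ps j))) + ennreal (recip r)"
    unfolding inverse_exponent[OF assms(1), symmetric] inverse_exponent[OF assms(2), symmetric] eq
    by (intro arg_cong2[of _ _ _ _ "(+)"] sum.cong refl inverse_exponent ps)
  also have "\<dots> = ennreal ((\<Sum>j=1..m. recip (ps j)) + recip r)"
  proof -
    have "(\<Sum>j=1..m. ennreal (recip (ps j))) = ennreal (\<Sum>j=1..m. recip (ps j))"
      by (intro sum_ennreal recip_bounds ps)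
    then show ?thesis using nn recip_bounds(1)[OF assms(1)] by simp
  qed
  finally show ?thesis
    using recip_bounds[OF assms(2)] nn recip_bounds[OF assms(1)] by (metis add_nonneg_nonneg ennreal_inj)
qed

lemma (in banach_lattice) pos_cone_smult: "x \<in> pos_cone E \<Longrightarrow> 0 \<le> c \<Longrightarrow> c \<odot> x \<in> pos_cone E"
  using leq_smult by (auto simp: pos_cone_def)

lemma pos_cone_carrier: "x \<in> pos_cone E \<Longrightarrow> x \<in> carrier E"
  by (simp add: pos_cone_def)

lemma (in banach_lattice) dual_pos_cone_smult:
  assumes y: "y \<in> pos_cone (dual_lattice E)" and c: "0 \<le> c"
  shows "c \<odot>\<^bsub>dual_lattice E\<^esub> y \<in> pos_cone (dual_lattice E)"
  using y c dual_space_smult_closed[of y c]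
  by (auto simp: pos_cone_dual_lattice dual_lattice_simps pos_cone_carrier)

lemma banach_space_scaled_space: "banach_space V \<Longrightarrow> scaled_space V"
proof -
  assume "banach_space V"
  then interpret banach_space V .
  show "scaled_space V" by (rule scaled_space_axioms)
qed

text \<open>
  This is the domination theorem for tuples of positive vectors \<open>x\<^sub>1, \<dots>, x\<^sub>m\<close> and a positive functional
  \<open>y\<close>, which is the component with index \<open>0\<close>. The functions attached to the components are the evaluations
  of functionals in the dual unit balls, so the suprema on the right are weak norms. The two kinds of
  functionals, on the lattices \<open>E j\<close> and on the dual of \<open>F\<close>, are put together in a sum type.
\<close>

theorem dominated_by_summing_functions:
  fixes E :: "nat \<Rightarrow> ('e, 'y) normed_lattice_scheme" and F :: "('f, 'z) normed_lattice_scheme"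
  assumes "1 \<le> r" and "1 \<le> p" and ps: "\<And>j. j \<in> {1..m} \<Longrightarrow> 1 \<le> ps j"
    and exps: "1 / p = (\<Sum>j=1..m. 1 / ps j) + 1 / r"
    and E: "\<And>j. j \<in> {1..m} \<Longrightarrow> banach_lattice (E j)" and F: "banach_lattice F"
    and T: "T \<in> bounded_multilinear_ops m E F" and C: "0 < C"
    and bound: "positive_dominated_bound m p ps r E F T C"
  shows "\<exists>g H. (\<forall>j\<in>{1..m}. summing_function (ps j) (E j) (g j) \<and>
        (\<forall>x\<in>carrier (E j). \<forall>y\<in>carrier (E j). g j (x \<oplus>\<^bsub>E j\<^esub> y) \<le> g j x + g j y)) \<and>
      summing_function r (dual_lattice F) H \<and>
      (\<forall>x\<in>(\<Pi>\<^sub>E j\<in>{1..m}. pos_cone (E j)). \<forall>y\<in>pos_cone (dual_lattice F).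
         \<bar>y (T x)\<bar> \<le> C * (\<Prod>j=1..m. g j (x j)) * H y)"
proof -
  interpret F: banach_lattice F by (rule F)
  have E_real: "real_space (E j)" if "j \<in> {1..m}" for j
    using E[OF that] by (simp add: banach_lattice_def banach_space_def real_space_def)
  have E_banach: "banach_space (E j)" if "j \<in> {1..m}" for j
    using E[OF that] by (simp add: banach_lattice_def)
  define A where "A = (\<Pi>\<^sub>E j\<in>{1..m}. pos_cone (E j)) \<times> pos_cone (dual_lattice F)"
  define q where "q j = (if j = 0 then r else ps j)" for j :: nat
  define \<Phi> :: "nat \<Rightarrow> (('e \<Rightarrow> real) + (('f \<Rightarrow> real) \<Rightarrow> real)) set" where
    "\<Phi> j = (if j = 0 then Inr ` dual_ball (dual_lattice F) else Inl ` dual_ball (E j))" for j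
  define ev where "ev j a t = (if j = 0 then projr t (snd a) else projl t (fst a j))"
    for j :: nat and a :: "(nat \<Rightarrow> 'e) \<times> ('f \<Rightarrow> real)" and t :: "('e \<Rightarrow> real) + (('f \<Rightarrow> real) \<Rightarrow> real)"
  define \<tau> where "\<tau> a = \<bar>snd a (T (fst a))\<bar>" for a :: "(nat \<Rightarrow> 'e) \<times> ('f \<Rightarrow> real)"
  have split0: "{0..m} = insert 0 {1..m}" by auto
  have prod_split: "(\<Prod>j\<in>{0..m}. f j) = f 0 * (\<Prod>j=1..m. f j)" for f :: "nat \<Rightarrow> real"
    unfolding split0 by simp
  have A_tuples: "fst a \<in> tuples m E" if "a \<in> A" for a
    using that by (auto simp: A_def tuples_def PiE_def Pi_def pos_cone_def)
  have dual_scaled: "scaled_space (dual_lattice F)" by (rule dual_lattice_scaled_space[OF F])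
  have ball_ne: "dual_ball (E j) \<noteq> {}" if j: "j \<in> {1..m}" for j
  proof -
    interpret banach_space "E j" by (rule E_banach[OF j])
    show ?thesis using zero_functional[OF scaled_space_axioms] by auto
  qed
  have "\<exists>L. (\<forall>j\<in>{0..m}. averaging (q j) (\<Phi> j) (L j)) \<and>
    (\<forall>a\<in>A. \<tau> a \<le> C * (\<Prod>j\<in>{0..m}. mean_norm (q j) (\<Phi> j) (L j) (ev j a)))"
  proof (rule domination)
    show "finite {0..m}" "1 \<le> p" "0 < C" using assms by auto
    show "\<Phi> j \<noteq> {}" if "j \<in> {0..m}" for j
      using that ball_ne[of j] dual_lattice_ball_nonempty[OF F] by (auto simp: \<Phi>_def)
    show "1 \<le> q j" if "j \<in> {0..m}" for j using that ps[of j] \<open>1 \<le> r\<close> by (auto simp: q_def)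
    show "recip p = (\<Sum>j\<in>{0..m}. recip (q j))"
      unfolding split0 using recip_sum[OF \<open>1 \<le> r\<close> \<open>1 \<le> p\<close> ps exps] by (simp add: q_def)
    show "bounded (ev j a ` \<Phi> j)" if a: "a \<in> A" and j: "j \<in> {0..m}" for a j
    proof (cases "j = 0")
      case True
      have y: "snd a \<in> carrier (dual_lattice F)" using a by (auto simp: A_def pos_cone_carrier)
      have "\<bar>f (snd a)\<bar> \<le> nrm (dual_lattice F) (snd a)" if "f \<in> dual_ball (dual_lattice F)" for f
        by (rule scaled_space.dual_ball_le[OF dual_scaled that y])
      then show ?thesis using True by (auto simp: bounded_iff ev_def \<Phi>_def)
    next
      case False
      then have j: "j \<in> {1..m}" using j by simp
      interpret banach_space "E j" by (rule E_banach[OF j])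
      have "\<bar>f (fst a j)\<bar> \<le> nrm (E j) (fst a j)" if "f \<in> dual_ball (E j)" for f
        using dual_ball_le[OF that tuples_carrier[OF A_tuples[OF a] j]] .
      then show ?thesis using False by (auto simp: bounded_iff ev_def \<Phi>_def)
    qed
    show "0 \<le> \<tau> a" for a by (simp add: \<tau>_def)
  next
    fix a and c :: "nat \<Rightarrow> real" assume a: "a \<in> A" and c: "\<And>j. j \<in> {0..m} \<Longrightarrow> 0 \<le> c j"
    define x' where "x' = (\<lambda>j\<in>{1..m}. c j \<odot>\<^bsub>E j\<^esub> fst a j)"
    define y' where "y' = c 0 \<odot>\<^bsub>dual_lattice F\<^esub> snd a"
    have "x' \<in> (\<Pi>\<^sub>E j\<in>{1..m}. pos_cone (E j))"
      unfolding x'_def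
    proof (rule restrict_PiE_iff[THEN iffD2], rule ballI)
      fix j assume j: "j \<in> {1..m}"
      interpret banach_lattice "E j" by (rule E[OF j])
      show "c j \<odot>\<^bsub>E j\<^esub> fst a j \<in> pos_cone (E j)"
        using a j c by (intro pos_cone_smult) (auto simp: A_def)
    qed
    moreover have "y' \<in> pos_cone (dual_lattice F)"
      unfolding y'_def using a c by (intro F.dual_pos_cone_smult) (auto simp: A_def)
    moreover have "\<tau> (x', y') = (\<Prod>j\<in>{0..m}. c j) * \<tau> a"
    proof -
      have y: "snd a \<in> carrier (dual_space F)" using a by (auto simp: A_def pos_cone_dual_lattice)
      have Tx: "T (fst a) \<in> carrier F" by (rule multilinear_carrier[OF T A_tuples[OF a]])
      have "T x' = (\<Prod>j=1..m. c j) \<odot>\<^bsub>F\<^esub> T (fst a)"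
        unfolding x'_def by (rule multilinear_smult_all[OF T E_real F.real_space_axioms A_tuples[OF a]])
      then have "y' (T x') = c 0 * ((\<Prod>j=1..m. c j) * snd a (T (fst a)))"
        using Tx dual_space_smult[OF y Tx] by (simp add: y'_def dual_lattice_simps)
      moreover have "0 \<le> c 0" "0 \<le> (\<Prod>j=1..m. c j)" using c by (auto intro: prod_nonneg)
      ultimately show ?thesis by (simp add: \<tau>_def abs_mult prod_split)
    qed
    moreover have "ev j (x', y') t = c j * ev j a t" if j: "j \<in> {0..m}" and t: "t \<in> \<Phi> j" for j t
    proof (cases "j = 0")
      case True
      then obtain f where f: "f \<in> dual_ball (dual_lattice F)" "t = Inr f" using t by (auto simp: \<Phi>_def)
      have "snd a \<in> carrier (dual_lattice F)" using a by (auto simp: A_def pos_cone_carrier)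
      then show ?thesis
        using True f dual_space_smult[of f "dual_lattice F" "snd a" "c 0"] by (simp add: ev_def y'_def dual_ball_def)
    next
      case False
      then have j: "j \<in> {1..m}" using j by simp
      obtain f where f: "f \<in> dual_ball (E j)" "t = Inl f" using t False by (auto simp: \<Phi>_def)
      then show ?thesis
        using False j dual_space_smult[of f "E j" "fst a j" "c j"] tuples_carrier[OF A_tuples[OF a] j]
        by (simp add: ev_def x'_def dual_ball_def)
    qed
    ultimately show "\<exists>a'\<in>A. \<tau> a' = (\<Prod>j\<in>{0..m}. c j) * \<tau> a \<and>
        (\<forall>j\<in>{0..m}. \<forall>t\<in>\<Phi> j. ev j a' t = c j * ev j a t)"
      by (intro bexI[of _ "(x', y')"]) (auto simp: A_def)
  next
    fix n and a :: "nat \<Rightarrow> (nat \<Rightarrow> 'e) \<times> ('f \<Rightarrow> real)" assume a: "\<And>i. i \<in> {1..n} \<Longrightarrow> a i \<in> A"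
    have W0: "(SUP t\<in>\<Phi> 0. ell_norm (q 0) n (\<lambda>i. ev 0 (a i) t)) = weak_norm (dual_lattice F) r n (\<lambda>i. snd (a i))"
      by (simp add: weak_norm_dual_ball \<Phi>_def ev_def q_def image_image)
    have Wj: "(SUP t\<in>\<Phi> j. ell_norm (q j) n (\<lambda>i. ev j (a i) t)) = weak_norm (E j) (ps j) n (\<lambda>i. fst (a i) j)"
      if "j \<in> {1..m}" for j
      using that by (simp add: weak_norm_dual_ball \<Phi>_def ev_def q_def image_image)
    have "ell_norm p n (\<lambda>i. \<tau> (a i)) = ell_norm p n (\<lambda>i. snd (a i) (T (fst (a i))))"
      by (intro ell_norm_cong) (simp add: \<tau>_def)
    also have "\<dots> \<le> C * (\<Prod>j=1..m. weak_norm (E j) (ps j) n (\<lambda>i. fst (a i) j))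
        * weak_norm (dual_lattice F) r n (\<lambda>i. snd (a i))"
    proof -
      have "fst (a i) \<in> (\<Pi>\<^sub>E j\<in>{1..m}. pos_cone (E j))" "snd (a i) \<in> pos_cone (dual_lattice F)"
        if "i \<in> {1..n}" for i
        using a[OF that] unfolding A_def by (auto simp: mem_Times_iff)
      then show ?thesis
        using bound unfolding positive_dominated_bound_def
        by (elim allE[of _ n] allE[of _ "\<lambda>i. fst (a i)"] allE[of _ "\<lambda>i. snd (a i)"]) blast
    qed
    finally show "ell_norm p n (\<lambda>i. \<tau> (a i))
        \<le> C * (\<Prod>j\<in>{0..m}. SUP t\<in>\<Phi> j. ell_norm (q j) n (\<lambda>i. ev j (a i) t))"
      unfolding prod_split W0 using Wj by (simp add: mult_ac)
  qed
  then obtain L where avg: "\<And>j. j \<in> {0..m} \<Longrightarrow> averaging (q j) (\<Phi> j) (L j)"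
    and dom: "\<And>a. a \<in> A \<Longrightarrow> \<tau> a \<le> C * (\<Prod>j\<in>{0..m}. mean_norm (q j) (\<Phi> j) (L j) (ev j a))" by blast
  define g where "g j x = mean_norm (ps j) (\<Phi> j) (L j) (\<lambda>t. projl t x)" for j x
  define H where "H y = mean_norm r (\<Phi> 0) (L 0) (\<lambda>t. projr t y)" for y
  have avg_E: "averaging (ps j) (\<Phi> j) (L j)" if "j \<in> {1..m}" for j
    using avg[of j] that by (auto simp: q_def)
  have "summing_function (ps j) (E j) (g j)" if j: "j \<in> {1..m}" for j
    unfolding g_def using j E_banach[OF j]
    by (intro averaging.mean_norm_summing_function[OF avg_E[OF j]])
      (auto simp: \<Phi>_def intro: banach_space_scaled_space)
  moreover have "g j (x \<oplus>\<^bsub>E j\<^esub> y) \<le> g j x + g j y"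
    if j: "j \<in> {1..m}" and "x \<in> carrier (E j)" "y \<in> carrier (E j)" for j x y
    unfolding g_def using that
    by (intro averaging.mean_norm_triangle[OF avg_E[OF j] E_banach[OF j]]) (auto simp: \<Phi>_def)
  moreover have "summing_function r (dual_lattice F) H"
    unfolding H_def using avg[of 0]
    by (intro averaging.mean_norm_summing_function dual_scaled) (auto simp: \<Phi>_def q_def)
  moreover have "\<bar>y (T x)\<bar> \<le> C * (\<Prod>j=1..m. g j (x j)) * H y"
    if "x \<in> (\<Pi>\<^sub>E j\<in>{1..m}. pos_cone (E j))" "y \<in> pos_cone (dual_lattice F)" for x y
  proof -
    have "mean_norm (q j) (\<Phi> j) (L j) (ev j (x, y)) = (if j = 0 then H y else g j (x j))" for j
      by (simp add: q_def ev_def[abs_def] H_def g_def)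
    moreover have "(\<Prod>j=1..m. if j = 0 then H y else g j (x j)) = (\<Prod>j=1..m. g j (x j))"
      by (intro prod.cong) auto
    ultimately show ?thesis
      using dom[of "(x, y)"] that by (simp add: A_def \<tau>_def prod_split mult_ac)
  qed
  ultimately show ?thesis by blast
qed

section \<open>Positive cones\<close>

lemma order_of_simps [simp]: "carrier (order_of E) = carrier E" "le (order_of E) = leq E" "eq (order_of E) = (=)"
  by (simp_all add: order_of_def)

context banach_lattice
begin

lemma leq_refl: "x \<in> carrier E \<Longrightarrow> leq E x x"
  and leq_trans: "leq E x y \<Longrightarrow> leq E y z \<Longrightarrow> x \<in> carrier E \<Longrightarrow> y \<in> carrier E \<Longrightarrow> z \<in> carrier E \<Longrightarrow> leq E x z"
  and leq_antisym: "leq E x y \<Longrightarrow> leq E y x \<Longrightarrow> x \<in> carrier E \<Longrightarrow> y \<in> carrier E \<Longrightarrow> x = y"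
proof -
  interpret O: Lattice.lattice "order_of E" by (rule lattice_order)
  show "x \<in> carrier E \<Longrightarrow> leq E x x" using O.le_refl[of x] by simp
  show "leq E x y \<Longrightarrow> leq E y z \<Longrightarrow> x \<in> carrier E \<Longrightarrow> y \<in> carrier E \<Longrightarrow> z \<in> carrier E \<Longrightarrow> leq E x z"
    using O.le_trans[of x y z] by simp
  show "leq E x y \<Longrightarrow> leq E y x \<Longrightarrow> x \<in> carrier E \<Longrightarrow> y \<in> carrier E \<Longrightarrow> x = y"
    using O.le_antisym[of x y] by simp
qed

lemma modulus_carrier [simp]: "x \<in> carrier E \<Longrightarrow> modulus E x \<in> carrier E"
  and le_modulus: "x \<in> carrier E \<Longrightarrow> leq E x (modulus E x)"
  and uminus_le_modulus: "x \<in> carrier E \<Longrightarrow> leq E (\<ominus> x) (modulus E x)"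
  and modulus_least: "x \<in> carrier E \<Longrightarrow> z \<in> carrier E \<Longrightarrow> leq E x z \<Longrightarrow> leq E (\<ominus> x) z \<Longrightarrow> leq E (modulus E x) z"
proof -
  interpret O: Lattice.lattice "order_of E" by (rule lattice_order)
  show "x \<in> carrier E \<Longrightarrow> modulus E x \<in> carrier E"
    using O.join_closed[of x "\<ominus> x"] by (simp add: modulus_def)
  show "x \<in> carrier E \<Longrightarrow> leq E x (modulus E x)"
    using O.join_left[of x "\<ominus> x"] by (simp add: modulus_def)
  show "x \<in> carrier E \<Longrightarrow> leq E (\<ominus> x) (modulus E x)"
    using O.join_right[of x "\<ominus> x"] by (simp add: modulus_def)
  show "x \<in> carrier E \<Longrightarrow> z \<in> carrier E \<Longrightarrow> leq E x z \<Longrightarrow> leq E (\<ominus> x) z \<Longrightarrow> leq E (modulus E x) z"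
    using O.join_le[of x z "\<ominus> x"] by (simp add: modulus_def)
qed

lemma leq_add_both:
  assumes "leq E x y" "leq E z w" "x \<in> carrier E" "y \<in> carrier E" "z \<in> carrier E" "w \<in> carrier E"
  shows "leq E (x \<oplus> z) (y \<oplus> w)"
proof -
  have "leq E (x \<oplus> z) (y \<oplus> z)" using assms by (intro leq_add) auto
  moreover have "leq E (z \<oplus> y) (w \<oplus> y)" using assms by (intro leq_add) auto
  ultimately show ?thesis
    using assms leq_trans[of "x \<oplus> z" "y \<oplus> z" "y \<oplus> w"] by (simp add: a_comm)
qed

lemma leq_iff_diff: 
  assumes "x \<in> carrier E" "y \<in> carrier E"
  shows "leq E x y \<longleftrightarrow> leq E \<zero> (y \<ominus> x)"
proof
  assume "leq E x y"
  then have "leq E (x \<oplus> \<ominus> x) (y \<oplus> \<ominus> x)" using assms by (intro leq_add) auto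
  then show "leq E \<zero> (y \<ominus> x)" using assms by (simp add: minus_eq r_neg)
next
  assume "leq E \<zero> (y \<ominus> x)"
  then have "leq E (\<zero> \<oplus> x) (y \<ominus> x \<oplus> x)" using assms by (intro leq_add) auto
  then show "leq E x y" using assms by (simp add: minus_eq a_assoc l_neg)
qed

lemma pos_cone_add: "x \<in> pos_cone E \<Longrightarrow> y \<in> pos_cone E \<Longrightarrow> x \<oplus> y \<in> pos_cone E"
  using leq_add_both[of \<zero> x \<zero> y] by (simp add: pos_cone_def)

lemma pos_cone_zero [simp]: "\<zero> \<in> pos_cone E"
  by (simp add: pos_cone_def leq_refl)

lemma leq_scale:
  assumes "leq E x y" "0 \<le> t" "x \<in> carrier E" "y \<in> carrier E"
  shows "leq E (t \<odot> x) (t \<odot> y)"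
  using assms leq_smult[of "y \<ominus> x" t] by (simp add: leq_iff_diff[of x] leq_iff_diff[of "t \<odot> x"] scale_minus)

lemma modulus_pos_cone: 
  assumes x: "x \<in> carrier E" shows "modulus E x \<in> pos_cone E"
proof -
  have "leq E (x \<oplus> \<ominus> x) (modulus E x \<oplus> modulus E x)"
    using x by (intro leq_add_both le_modulus uminus_le_modulus) auto
  then have "leq E \<zero> ((1 / 2) \<odot> (modulus E x \<oplus> modulus E x))"
    using x by (intro leq_smult) (auto simp: r_neg)
  also have "(1 / 2) \<odot> (modulus E x \<oplus> modulus E x) = modulus E x"
    using x by (simp add: scale_add add_scale[symmetric])
  finally show ?thesis using x by (simp add: pos_cone_def)
qed

lemma modulus_pos:
  assumes "x \<in> pos_cone E" shows "modulus E x = x"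
proof (rule leq_antisym)
  have x: "x \<in> carrier E" "leq E \<zero> x" using assms by (auto simp: pos_cone_def)
  then have "leq E (\<ominus> x) \<zero>" using leq_add[of \<zero> x "\<ominus> x"] by (simp add: r_neg)
  then have "leq E (\<ominus> x) x" using x by (intro leq_trans[of "\<ominus> x" \<zero> x]) auto
  then show "leq E (modulus E x) x" using x by (intro modulus_least leq_refl)
qed (use assms le_modulus in \<open>auto simp: pos_cone_def\<close>)

lemma nrm_modulus_le:
  assumes "x \<in> carrier E" shows "nrm E (modulus E x) \<le> nrm E x"
  using assms modulus_pos[OF modulus_pos_cone[OF assms]] by (intro nrm_mono) (auto intro: leq_refl)

lemma nrm_uminus: "x \<in> carrier E \<Longrightarrow> nrm E (\<ominus> x) = nrm E x"
  using nrm_smult[of x "-1"] by (simp add: uminus_conv_scale)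

lemma pos_decomposition:
  assumes x: "x \<in> carrier E"
  obtains a b where "a \<in> pos_cone E" "b \<in> pos_cone E" "x = a \<ominus> b" "nrm E a + nrm E b \<le> 3 * nrm E x"
proof
  show "modulus E x \<in> pos_cone E" by (rule modulus_pos_cone[OF x])
  show "modulus E x \<ominus> x \<in> pos_cone E"
    using x le_modulus[OF x] by (simp add: pos_cone_def leq_iff_diff[of x])
  show "x = modulus E x \<ominus> (modulus E x \<ominus> x)"
    using x by (simp add: minus_eq minus_add minus_minus a_assoc[symmetric] r_neg)
  have "nrm E (modulus E x \<ominus> x) \<le> nrm E (modulus E x) + nrm E x"
    using x nrm_triangle[of "modulus E x" "\<ominus> x"] by (simp add: minus_eq nrm_uminus)
  then show "nrm E (modulus E x) + nrm E (modulus E x \<ominus> x) \<le> 3 * nrm E x"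
    using nrm_modulus_le[OF x] by simp
qed

text \<open>
  The distance functional \<open>q z = inf {nrm a. a \<ge> z, a \<ge> 0}\<close> is sublinear and vanishes at negative
  vectors, so the linear functionals below it are positive and contractive. The Hahn--Banach
  theorem provides enough of them to recover \<open>q\<close>.
\<close>

lemma exists_small_majorant:
  assumes z: "z \<in> carrier E"
    and D: "\<And>y. y \<in> pos_cone (dual_lattice E) \<Longrightarrow> y \<in> dual_ball E \<Longrightarrow> y z \<le> D" and "0 < \<epsilon>"
  shows "\<exists>a\<in>pos_cone E. leq E z a \<and> nrm E a < D + \<epsilon>"
proof -
  define S where "S w = {a \<in> pos_cone E. leq E w a}" for w
  define q where "q w = (INF a\<in>S w. nrm E a)" for w
  have bdd: "bdd_below (nrm E ` S w)" for w
    using nrm_nonneg by (intro bdd_belowI2[where m = 0]) (auto simp: S_def pos_cone_def)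
  have mod_S: "modulus E w \<in> S w" if "w \<in> carrier E" for w
    using that by (simp add: S_def modulus_pos_cone le_modulus)
  have q_le: "q w \<le> nrm E a" if "a \<in> S w" for w a
    unfolding q_def using that by (intro cINF_lower bdd)
  have q_ge: "c \<le> q w" if "\<And>a. a \<in> S w \<Longrightarrow> c \<le> nrm E a" "w \<in> carrier E" for w c
    unfolding q_def using that mod_S by (intro cINF_greatest) auto
  have scale_le: "q (t \<odot> w) \<le> t * q w" if w: "w \<in> carrier E" and t: "0 < t" for w t
  proof -
    have "q (t \<odot> w) / t \<le> q w"
    proof (rule q_ge[OF _ w])
      fix a assume a: "a \<in> S w"
      then have "t \<odot> a \<in> S (t \<odot> w)"
        using w t by (auto simp: S_def pos_cone_smult pos_cone_carrier intro: leq_scale)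
      then have "q (t \<odot> w) \<le> nrm E (t \<odot> a)" by (rule q_le)
      also have "\<dots> = t * nrm E a" using a t by (simp add: S_def pos_cone_carrier nrm_smult)
      finally show "q (t \<odot> w) / t \<le> nrm E a" using t by (simp add: field_simps)
    qed
    then show ?thesis using t by (simp add: field_simps)
  qed
  have q0: "q w \<le> 0" if "\<zero> \<in> S w" for w
    using q_le[OF that] nrm_eq_0[of \<zero>] by simp
  have q_nonneg: "0 \<le> q w" if "w \<in> carrier E" for w
    using that nrm_nonneg by (intro q_ge) (auto simp: S_def pos_cone_def)
  have "sublinear E q"
    unfolding sublinear_def
  proof safe
    fix x y assume x: "x \<in> carrier E" and y: "y \<in> carrier E"
    have "q (x \<oplus> y) - q y \<le> q x"
    proof (rule q_ge[OF _ x])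
      fix a assume a: "a \<in> S x"
      have "q (x \<oplus> y) - nrm E a \<le> q y"
      proof (rule q_ge[OF _ y])
        fix b assume b: "b \<in> S y"
        have "a \<oplus> b \<in> S (x \<oplus> y)"
          using a b x y by (auto simp: S_def pos_cone_carrier intro: pos_cone_add leq_add_both)
        then have "q (x \<oplus> y) \<le> nrm E (a \<oplus> b)" by (rule q_le)
        also have "\<dots> \<le> nrm E a + nrm E b"
          using a b by (intro nrm_triangle) (auto simp: S_def pos_cone_carrier)
        finally show "q (x \<oplus> y) - nrm E a \<le> nrm E b" by simp
      qed
      then show "q (x \<oplus> y) - q y \<le> nrm E a" by simp
    qed
    then show "q (x \<oplus> y) \<le> q x + q y" by simp
  next
    fix x and t :: real assume x: "x \<in> carrier E" and t: "0 \<le> t"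
    show "q (t \<odot> x) = t * q x"
    proof (cases "t = 0")
      case True
      have "q \<zero> = 0" using q0[of \<zero>] q_nonneg[of \<zero>] by (simp add: S_def leq_refl)
      then show ?thesis using True x by simp
    next
      case False
      then have t: "0 < t" using t by simp
      have "q ((1 / t) \<odot> (t \<odot> x)) \<le> (1 / t) * q (t \<odot> x)" using x t by (intro scale_le) auto
      then have "t * q x \<le> q (t \<odot> x)" using x t by (simp add: scale_scale field_simps)
      then show ?thesis using scale_le[OF x t] by simp
    qed
  qed
  then obtain f where f: "linear_functional E f" "\<And>x. x \<in> carrier E \<Longrightarrow> f x \<le> q x" "f z = q z"
    using hahn_banach_point[OF _ z] by blast
  define y where "y = restrict f (carrier E)"
  have f_le: "\<bar>f x\<bar> \<le> nrm E x" if x: "x \<in> carrier E" for x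
  proof -
    have "f w \<le> nrm E w" if "w \<in> carrier E" for w
      using f(2)[OF that] q_le[OF mod_S[OF that]] nrm_modulus_le[OF that] by linarith
    from this[of x] this[of "\<ominus> x"] show ?thesis
      using x linear_functional_uminus[OF f(1) x] nrm_uminus[OF x] by simp
  qed
  have y: "y \<in> carrier (dual_space E)"
    using f(1) f_le unfolding y_def linear_functional_def by (intro dual_spaceI[where K = 1]) auto
  then have "y \<in> dual_ball E" using f_le by (intro dual_ballI) (auto simp: y_def)
  moreover have "y \<in> pos_cone (dual_lattice E)"
    unfolding pos_cone_dual_lattice
  proof (intro CollectI conjI ballI y)
    fix x assume x: "x \<in> pos_cone E"
    then have xc: "x \<in> carrier E" by (rule pos_cone_carrier)
    have "\<zero> \<in> S (\<ominus> x)" using x leq_add[of \<zero> x "\<ominus> x"] by (simp add: S_def pos_cone_def r_neg leq_refl)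
    then have "f (\<ominus> x) \<le> 0" using f(2)[of "\<ominus> x"] q0[of "\<ominus> x"] xc by simp
    then show "0 \<le> y x" using linear_functional_uminus[OF f(1) xc] xc by (simp add: y_def)
  qed
  ultimately have "q z \<le> D" using D[of y] f(3) z by (simp add: y_def)
  then have "q z < D + \<epsilon>" using \<open>0 < \<epsilon>\<close> by simp
  then show ?thesis
    unfolding q_def using mod_S[OF z] bdd by (subst (asm) cINF_less_iff) (auto simp: S_def)
qed

text \<open>
  The factor \<open>2\<close> arises from majorising \<open>z\<close> and \<open>- z\<close> separately. It will only affect the bound of the
  norm of the extended operator, not its Cohen constant.
\<close>

lemma nrm_le_by_positive_functionals:
  assumes z: "z \<in> carrier E"
    and D: "\<And>y. y \<in> pos_cone (dual_lattice E) \<Longrightarrow> y \<in> dual_ball E \<Longrightarrow> \<bar>y z\<bar> \<le> D"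
  shows "nrm E z \<le> 2 * D"
proof -
  have "nrm E z \<le> 2 * D + \<epsilon>" if \<epsilon>: "0 < \<epsilon>" for \<epsilon>
  proof -
    have "y (\<ominus> z) \<le> D" if y: "y \<in> pos_cone (dual_lattice E)" "y \<in> dual_ball E" for y
      using D[OF y] dual_space_smult[of y E z "-1"] y(2) z by (simp add: dual_ball_def uminus_conv_scale)
    then obtain b where b: "b \<in> pos_cone E" "leq E (\<ominus> z) b" "nrm E b < D + \<epsilon> / 2"
      using exists_small_majorant[of "\<ominus> z" D "\<epsilon> / 2"] z \<epsilon> by auto
    have "y z \<le> D" if y: "y \<in> pos_cone (dual_lattice E)" "y \<in> dual_ball E" for y
      using D[OF y] by simp
    then obtain a where a: "a \<in> pos_cone E" "leq E z a" "nrm E a < D + \<epsilon> / 2"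
      using exists_small_majorant[of z D "\<epsilon> / 2"] z \<epsilon> by auto
    have ab: "a \<in> carrier E" "b \<in> carrier E" "leq E \<zero> a" "leq E \<zero> b" using a b by (auto simp: pos_cone_def)
    have "leq E (z \<oplus> \<zero>) (a \<oplus> b)" "leq E (\<zero> \<oplus> \<ominus> z) (a \<oplus> b)"
      using a b ab z by (auto simp del: l_zero r_zero intro!: leq_add_both)
    then have "leq E (modulus E z) (a \<oplus> b)" using z ab by (intro modulus_least) auto
    then have "nrm E z \<le> nrm E (a \<oplus> b)"
      using z ab modulus_pos[OF pos_cone_add[OF a(1) b(1)]] by (intro nrm_mono) auto
    also have "\<dots> \<le> nrm E a + nrm E b" using ab by (intro nrm_triangle)
    finally show ?thesis using a b by simp
  qed
  then show ?thesis by (rule field_le_epsilon)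
qed

end

locale seminormed_space = real_space V for V :: "('a, 'z) normed_scheme" (structure) +
  fixes N :: "'a \<Rightarrow> real"
  assumes seminorm_nonneg: "x \<in> carrier V \<Longrightarrow> 0 \<le> N x"
    and seminorm_add: "x \<in> carrier V \<Longrightarrow> y \<in> carrier V \<Longrightarrow> N (x \<oplus> y) \<le> N x + N y"
    and seminorm_smult: "x \<in> carrier V \<Longrightarrow> N (t \<odot> x) = \<bar>t\<bar> * N x"

text \<open>
  The largest seminorm that is at most \<open>g\<close> on the positive cone. It is defined by decompositions, not by
  \<open>g\<close> at the modulus, so that estimates for positive vectors carry over to all vectors without loss.
\<close>

definition cone_norm :: "('a, 'z) normed_lattice_scheme \<Rightarrow> ('a \<Rightarrow> real) \<Rightarrow> 'a \<Rightarrow> real" where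
  "cone_norm E g x = (INF (a, b)\<in>{(a, b). a \<in> pos_cone E \<and> b \<in> pos_cone E \<and> x = a \<ominus>\<^bsub>E\<^esub> b}. g a + g b)"

locale cone_seminorm = banach_lattice E for E :: "('a, 'z) normed_lattice_scheme" (structure) +
  fixes g :: "'a \<Rightarrow> real"
  assumes g_nonneg: "x \<in> carrier E \<Longrightarrow> 0 \<le> g x"
    and g_add: "x \<in> carrier E \<Longrightarrow> y \<in> carrier E \<Longrightarrow> g (x \<oplus> y) \<le> g x + g y"
    and g_smult: "x \<in> carrier E \<Longrightarrow> g (t \<odot> x) = \<bar>t\<bar> * g x"
    and g_le_nrm: "x \<in> carrier E \<Longrightarrow> g x \<le> nrm E x"
begin

lemma cone_norm_le:
  assumes "a \<in> pos_cone E" "b \<in> pos_cone E" shows "cone_norm E g (a \<ominus> b) \<le> g a + g b"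
proof -
  let ?S = "{(a', b'). a' \<in> pos_cone E \<and> b' \<in> pos_cone E \<and> a \<ominus> b = a' \<ominus> b'}"
  have "bdd_below ((\<lambda>(a, b). g a + g b) ` ?S)"
    using g_nonneg by (intro bdd_belowI2[where m = 0]) (auto simp: pos_cone_carrier)
  then show ?thesis
    unfolding cone_norm_def using assms cINF_lower[of "\<lambda>(a, b). g a + g b" ?S "(a, b)"] by simp
qed

lemma cone_norm_ge:
  assumes x: "x \<in> carrier E" and "\<And>a b. a \<in> pos_cone E \<Longrightarrow> b \<in> pos_cone E \<Longrightarrow> x = a \<ominus> b \<Longrightarrow> D \<le> g a + g b"
  shows "D \<le> cone_norm E g x"
proof -
  obtain a b where "a \<in> pos_cone E" "b \<in> pos_cone E" "x = a \<ominus> b" using pos_decomposition[OF x] by blast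
  then show ?thesis unfolding cone_norm_def using assms(2) by (intro cINF_greatest) auto
qed

lemma cone_norm_nonneg: "x \<in> carrier E \<Longrightarrow> 0 \<le> cone_norm E g x"
  using g_nonneg by (intro cone_norm_ge) (auto simp: pos_cone_carrier)

lemma cone_norm_on_cone: "x \<in> pos_cone E \<Longrightarrow> cone_norm E g x \<le> g x"
  using cone_norm_le[of x \<zero>] g_smult[of \<zero> 0] by (simp add: minus_eq uminus_conv_scale pos_cone_carrier)

lemma cone_norm_le_nrm: "x \<in> carrier E \<Longrightarrow> cone_norm E g x \<le> 3 * nrm E x"
proof -
  assume x: "x \<in> carrier E"
  obtain a b where ab: "a \<in> pos_cone E" "b \<in> pos_cone E" "x = a \<ominus> b" "nrm E a + nrm E b \<le> 3 * nrm E x"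
    using pos_decomposition[OF x] by blast
  then have "cone_norm E g x \<le> g a + g b" using cone_norm_le by simp
  then show ?thesis using g_le_nrm[of a] g_le_nrm[of b] ab by (simp add: pos_cone_carrier)
qed

sublocale cone: seminormed_space E "cone_norm E g"
proof
  show "0 \<le> cone_norm E g x" if "x \<in> carrier E" for x using that by (rule cone_norm_nonneg)
next
  fix x y assume x: "x \<in> carrier E" and y: "y \<in> carrier E"
  have "cone_norm E g (x \<oplus> y) - cone_norm E g y \<le> cone_norm E g x"
  proof (rule cone_norm_ge[OF x])
    fix a b assume ab: "a \<in> pos_cone E" "b \<in> pos_cone E" "x = a \<ominus> b"
    have "cone_norm E g (x \<oplus> y) - (g a + g b) \<le> cone_norm E g y"
    proof (rule cone_norm_ge[OF y])
      fix c d assume cd: "c \<in> pos_cone E" "d \<in> pos_cone E" "y = c \<ominus> d"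
      note carr = ab(1,2)[THEN pos_cone_carrier] cd(1,2)[THEN pos_cone_carrier]
      have "x \<oplus> y = (a \<oplus> c) \<ominus> (b \<oplus> d)"
        using carr by (simp add: ab cd minus_eq minus_add a_ac)
      then have "cone_norm E g (x \<oplus> y) \<le> g (a \<oplus> c) + g (b \<oplus> d)"
        using ab cd cone_norm_le pos_cone_add by simp
      then show "cone_norm E g (x \<oplus> y) - (g a + g b) \<le> g c + g d"
        using g_add[of a c] g_add[of b d] carr by simp
    qed
    then show "cone_norm E g (x \<oplus> y) - cone_norm E g y \<le> g a + g b" by simp
  qed
  then show "cone_norm E g (x \<oplus> y) \<le> cone_norm E g x + cone_norm E g y" by simp
next
  have le: "cone_norm E g (t \<odot> x) \<le> \<bar>t\<bar> * cone_norm E g x" if x: "x \<in> carrier E" and t: "t \<noteq> 0" for x t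
  proof -
    have "cone_norm E g (t \<odot> x) / \<bar>t\<bar> \<le> cone_norm E g x"
    proof (rule cone_norm_ge[OF x])
      fix a b assume ab: "a \<in> pos_cone E" "b \<in> pos_cone E" "x = a \<ominus> b"
      note carr = ab(1,2)[THEN pos_cone_carrier]
      have "cone_norm E g (t \<odot> x) \<le> \<bar>t\<bar> * g a + \<bar>t\<bar> * g b"
      proof (cases "0 \<le> t")
        case True
        then have "t \<odot> x = t \<odot> a \<ominus> t \<odot> b" using carr by (simp add: ab scale_minus)
        then show ?thesis
          using cone_norm_le[of "t \<odot> a" "t \<odot> b"] True carr by (simp add: ab pos_cone_smult g_smult)
      next
        case False
        then have "t \<odot> x = (- t) \<odot> b \<ominus> (- t) \<odot> a"
          using carr by (simp add: ab scale_add scale_uminus uminus_scale minus_eq minus_minus a_comm)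
        then show ?thesis
          using cone_norm_le[of "(- t) \<odot> b" "(- t) \<odot> a"] False ab carr
          by (simp add: pos_cone_smult g_smult)
      qed
      then show "cone_norm E g (t \<odot> x) / \<bar>t\<bar> \<le> g a + g b" using t by (simp add: field_simps)
    qed
    then show ?thesis using t by (simp add: field_simps)
  qed
  fix x and t :: real assume x: "x \<in> carrier E"
  show "cone_norm E g (t \<odot> x) = \<bar>t\<bar> * cone_norm E g x"
  proof (cases "t = 0")
    case True
    have "cone_norm E g \<zero> = 0"
      using cone_norm_on_cone[of \<zero>] cone_norm_nonneg[of \<zero>] g_smult[of \<zero> 0] by simp
    then show ?thesis using True x by simp
  next
    case False
    have "cone_norm E g ((1 / t) \<odot> (t \<odot> x)) \<le> \<bar>1 / t\<bar> * cone_norm E g (t \<odot> x)"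
      using x False by (intro le) auto
    then have "\<bar>t\<bar> * cone_norm E g x \<le> cone_norm E g (t \<odot> x)"
      using x False by (simp add: scale_scale field_simps)
    then show ?thesis using le[OF x False] by simp
  qed
qed

end

text \<open>
  The estimate for positive arguments extends to all arguments with the same constant, since by
  multilinearity a decomposition of one argument gives the sum of the two corresponding bounds.
\<close>

lemma multilinear_cone_norm_bound:
  assumes T: "T \<in> bounded_multilinear_ops m E F"
    and E: "\<And>j. j \<in> {1..m} \<Longrightarrow> cone_seminorm (E j) (g j)" and F: "real_space F"
    and y: "y \<in> carrier (dual_space F)" and D: "0 \<le> D"
    and pos: "\<And>x. x \<in> (\<Pi>\<^sub>E j\<in>{1..m}. pos_cone (E j)) \<Longrightarrow> \<bar>y (T x)\<bar> \<le> D * (\<Prod>j=1..m. g j (x j))"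
    and x: "x \<in> tuples m E"
  shows "\<bar>y (T x)\<bar> \<le> D * (\<Prod>j=1..m. cone_norm (E j) (g j) (x j))"
proof -
  interpret F: real_space F by (rule F)
  have real: "real_space (E j)" if "j \<in> {1..m}" for j
    using E[OF that] by (simp add: cone_seminorm_def banach_lattice_def banach_space_def real_space_def)
  \<comment> \<open>The arguments with index in J are arbitrary, the others are still positive.\<close>
  define w where "w J j = (if j \<in> J then cone_norm (E j) (g j) else g j)" for J j
  have w_nonneg: "0 \<le> w J j z" if "j \<in> {1..m}" "z \<in> carrier (E j)" for J j z
    using cone_seminorm.cone_norm_nonneg[OF E] cone_seminorm.g_nonneg[OF E] that by (auto simp: w_def)
  have "\<forall>x\<in>tuples m E. (\<forall>j\<in>{1..m} - J. x j \<in> pos_cone (E j)) \<longrightarrow> \<bar>y (T x)\<bar> \<le> D * (\<Prod>j=1..m. w J j (x j))"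
    if "finite J" "J \<subseteq> {1..m}" for J
    using that
  proof (induction J rule: finite_induct)
    case empty
    then show ?case using pos by (auto simp: tuples_def w_def)
  next
    case (insert k J)
    have k: "k \<in> {1..m}" using insert by simp
    interpret k: cone_seminorm "E k" "g k" by (rule E[OF k])
    show ?case
    proof (intro ballI impI)
      fix x assume x: "x \<in> tuples m E" and x_pos: "\<forall>j\<in>{1..m} - insert k J. x j \<in> pos_cone (E j)"
      define R where "R = D * (\<Prod>j\<in>{1..m} - {k}. w J j (x j))"
      have R: "0 \<le> R"
        unfolding R_def using D w_nonneg tuples_carrier[OF x] by (intro mult_nonneg_nonneg prod_nonneg) auto
      have at: "\<bar>y (T (x(k := a)))\<bar> \<le> R * g k a" if a: "a \<in> pos_cone (E k)" for a
      proof -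
        have "\<forall>j\<in>{1..m} - J. (x(k := a)) j \<in> pos_cone (E j)" using x_pos a by auto
        then have "\<bar>y (T (x(k := a)))\<bar> \<le> D * (\<Prod>j=1..m. w J j ((x(k := a)) j))"
          using insert tuples_update[OF x k pos_cone_carrier[OF a]] by auto
        also have "\<dots> = R * g k a"
          using k insert.hyps by (simp add: prod.remove[of _ k] R_def w_def)
        finally show ?thesis .
      qed
      have "\<bar>y (T x)\<bar> \<le> R * (g k a + g k b)" if ab: "a \<in> pos_cone (E k)" "b \<in> pos_cone (E k)" "x k = a \<ominus>\<^bsub>E k\<^esub> b" for a b
      proof -
        have xab: "x(k := a) \<in> tuples m E" "x(k := b) \<in> tuples m E"
          using tuples_update[OF x k] ab by (auto simp: pos_cone_carrier)
        note Tab = xab[THEN multilinear_carrier[OF T]]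
        have "T x = T (x(k := a \<ominus>\<^bsub>E k\<^esub> b))" using ab by (metis fun_upd_triv)
        also have "\<dots> = T (x(k := a)) \<ominus>\<^bsub>F\<^esub> T (x(k := b))"
          using ab by (intro multilinear_minus[OF T real F x k]) (auto simp: pos_cone_carrier)
        finally have "y (T x) = y (T (x(k := a))) - y (T (x(k := b)))"
          using dual_space_add[OF y] dual_space_smult[OF y] Tab
          by (simp add: F.minus_eq F.uminus_conv_scale)
        then show ?thesis using at[OF ab(1)] at[OF ab(2)] by (simp add: distrib_left)
      qed
      then have *: "\<bar>y (T x)\<bar> \<le> R * (g k a + g k b)"
        if "a \<in> pos_cone (E k)" "b \<in> pos_cone (E k)" "x k = a \<ominus>\<^bsub>E k\<^esub> b" for a b using that by blast
      have xk: "x k \<in> carrier (E k)" by (rule tuples_carrier[OF x k])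
      have "\<bar>y (T x)\<bar> \<le> R * cone_norm (E k) (g k) (x k)"
      proof (cases "R = 0")
        case True
        obtain a b where "a \<in> pos_cone (E k)" "b \<in> pos_cone (E k)" "x k = a \<ominus>\<^bsub>E k\<^esub> b"
          using k.pos_decomposition[OF xk] by blast
        then show ?thesis using * True by fastforce
      next
        case False
        then have R: "0 < R" using R by simp
        have "\<bar>y (T x)\<bar> / R \<le> cone_norm (E k) (g k) (x k)"
          using * R by (intro k.cone_norm_ge[OF xk]) (simp add: field_simps)
        then show ?thesis using R by (simp add: field_simps)
      qed
      also have "\<dots> = D * (\<Prod>j=1..m. w (insert k J) j (x j))"
        using k by (simp add: prod.remove[of _ k] R_def w_def)
      finally show "\<bar>y (T x)\<bar> \<le> D * (\<Prod>j=1..m. w (insert k J) j (x j))" .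
    qed
  qed
  from this[of "{1..m}"] have "\<bar>y (T x)\<bar> \<le> D * (\<Prod>j=1..m. w {1..m} j (x j))" using x by simp
  also have "(\<Prod>j=1..m. w {1..m} j (x j)) = (\<Prod>j=1..m. cone_norm (E j) (g j) (x j))"
    by (intro prod.cong) (auto simp: w_def)
  finally show ?thesis .
qed

section \<open>Completion of a seminormed space\<close>

definition cauchy_seqs :: "('a, 'z) normed_scheme \<Rightarrow> ('a \<Rightarrow> real) \<Rightarrow> (nat \<Rightarrow> 'a) set" where
  "cauchy_seqs V N = {c. (\<forall>n. c n \<in> carrier V) \<and> (\<forall>e>0. \<exists>K. \<forall>k\<ge>K. \<forall>l\<ge>K. N (c k \<ominus>\<^bsub>V\<^esub> c l) < e)}"

definition seq_space :: "('a, 'z) normed_scheme \<Rightarrow> ('a \<Rightarrow> real) \<Rightarrow> (nat \<Rightarrow> 'a) normed" where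
  "seq_space V N = \<lparr>carrier = cauchy_seqs V N, mult = undefined, one = undefined,
     zero = (\<lambda>n. \<zero>\<^bsub>V\<^esub>), add = (\<lambda>c d n. c n \<oplus>\<^bsub>V\<^esub> d n), smult = (\<lambda>t c n. t \<odot>\<^bsub>V\<^esub> c n),
     nrm = (\<lambda>c. lim (\<lambda>n. N (c n)))\<rparr>"

lemma seq_space_simps [simp]:
  "carrier (seq_space V N) = cauchy_seqs V N" "\<zero>\<^bsub>seq_space V N\<^esub> = (\<lambda>n. \<zero>\<^bsub>V\<^esub>)"
  "c \<oplus>\<^bsub>seq_space V N\<^esub> d = (\<lambda>n. c n \<oplus>\<^bsub>V\<^esub> d n)" "t \<odot>\<^bsub>seq_space V N\<^esub> c = (\<lambda>n. t \<odot>\<^bsub>V\<^esub> c n)"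
  by (simp_all add: seq_space_def)

definition complete_seminorm :: "('a, 'z) normed_scheme \<Rightarrow> ('a \<Rightarrow> real) \<Rightarrow> bool" where
  "complete_seminorm V N \<longleftrightarrow> (\<forall>s\<in>cauchy_seqs V N. \<exists>x\<in>carrier V. (\<lambda>n. N (s n \<ominus>\<^bsub>V\<^esub> x)) \<longlonglongrightarrow> 0)"

context seminormed_space
begin

lemma seminorm_zero [simp]: "N \<zero> = 0"
  using seminorm_smult[of \<zero> 0] by simp

lemma seminorm_uminus: "x \<in> carrier V \<Longrightarrow> N (\<ominus> x) = N x"
  using seminorm_smult[of x "-1"] by (simp add: uminus_conv_scale)

lemma seminorm_minus_commute:
  assumes "x \<in> carrier V" "y \<in> carrier V" shows "N (x \<ominus> y) = N (y \<ominus> x)"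
proof -
  have "\<ominus> (x \<ominus> y) = y \<ominus> x" using assms by (simp add: minus_eq minus_add minus_minus a_comm)
  then show ?thesis using seminorm_uminus[of "x \<ominus> y"] assms by simp
qed

lemma seminorm_minus_self [simp]: "x \<in> carrier V \<Longrightarrow> N (x \<ominus> x) = 0"
  by (simp add: minus_eq r_neg)

lemma seminorm_triangle:
  assumes "x \<in> carrier V" "y \<in> carrier V" "z \<in> carrier V"
  shows "N (x \<ominus> z) \<le> N (x \<ominus> y) + N (y \<ominus> z)"
proof -
  have "x \<ominus> z = (x \<ominus> y) \<oplus> (y \<ominus> z)" using assms by (simp add: minus_eq a_assoc r_neg1)
  then show ?thesis using seminorm_add[of "x \<ominus> y" "y \<ominus> z"] assms by simp
qed

lemma seminorm_diff_le:
  assumes "x \<in> carrier V" "y \<in> carrier V" shows "\<bar>N x - N y\<bar> \<le> N (x \<ominus> y)"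
proof -
  have le: "N a \<le> N (a \<ominus> b) + N b" if "a \<in> carrier V" "b \<in> carrier V" for a b
    using seminorm_add[of "a \<ominus> b" b] that by (simp add: minus_eq a_assoc l_neg)
  show ?thesis using le[OF assms] le[OF assms(2,1)] seminorm_minus_commute[OF assms] by linarith
qed

lemma cauchy_seqs_carrier: "c \<in> cauchy_seqs V N \<Longrightarrow> c n \<in> carrier V"
  by (simp add: cauchy_seqs_def)

lemma cauchy_seqsD:
  "c \<in> cauchy_seqs V N \<Longrightarrow> 0 < e \<Longrightarrow> \<exists>K. \<forall>k\<ge>K. \<forall>l\<ge>K. N (c k \<ominus> c l) < e"
  by (simp add: cauchy_seqs_def)

lemma cauchy_seqs_const [simp]: "x \<in> carrier V \<Longrightarrow> (\<lambda>n. x) \<in> cauchy_seqs V N"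
  by (simp add: cauchy_seqs_def)

lemma cauchy_seqs_add:
  assumes c: "c \<in> cauchy_seqs V N" and d: "d \<in> cauchy_seqs V N"
  shows "(\<lambda>n. c n \<oplus> d n) \<in> cauchy_seqs V N"
  unfolding cauchy_seqs_def
proof (intro CollectI conjI allI impI)
  fix e :: real assume e: "0 < e"
  obtain K where K: "\<forall>k\<ge>K. \<forall>l\<ge>K. N (c k \<ominus> c l) < e / 2" using cauchy_seqsD[OF c, of "e / 2"] e by auto
  obtain M where M: "\<forall>k\<ge>M. \<forall>l\<ge>M. N (d k \<ominus> d l) < e / 2" using cauchy_seqsD[OF d, of "e / 2"] e by auto
  have "N (c k \<oplus> d k \<ominus> (c l \<oplus> d l)) < e" if "max K M \<le> k" "max K M \<le> l" for k l
  proof -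
    have "c k \<oplus> d k \<ominus> (c l \<oplus> d l) = (c k \<ominus> c l) \<oplus> (d k \<ominus> d l)"
      using cauchy_seqs_carrier[OF c] cauchy_seqs_carrier[OF d] by (simp add: minus_eq minus_add a_ac)
    then have "N (c k \<oplus> d k \<ominus> (c l \<oplus> d l)) \<le> N (c k \<ominus> c l) + N (d k \<ominus> d l)"
      using cauchy_seqs_carrier[OF c] cauchy_seqs_carrier[OF d] by (simp add: seminorm_add)
    then show ?thesis using K M that by (smt (verit) max.bounded_iff field_sum_of_halves)
  qed
  then show "\<exists>K. \<forall>k\<ge>K. \<forall>l\<ge>K. N (c k \<oplus> d k \<ominus> (c l \<oplus> d l)) < e" by blast
qed (use cauchy_seqs_carrier[OF c] cauchy_seqs_carrier[OF d] in auto)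

lemma cauchy_seqs_scale:
  assumes c: "c \<in> cauchy_seqs V N" shows "(\<lambda>n. t \<odot> c n) \<in> cauchy_seqs V N"
  unfolding cauchy_seqs_def
proof (intro CollectI conjI allI impI)
  fix e :: real assume e: "0 < e"
  obtain K where K: "\<forall>k\<ge>K. \<forall>l\<ge>K. N (c k \<ominus> c l) < e / (\<bar>t\<bar> + 1)"
    using cauchy_seqsD[OF c, of "e / (\<bar>t\<bar> + 1)"] e by auto
  have "N (t \<odot> c k \<ominus> t \<odot> c l) < e" if kl: "K \<le> k" "K \<le> l" for k l
  proof -
    have "N (t \<odot> c k \<ominus> t \<odot> c l) = \<bar>t\<bar> * N (c k \<ominus> c l)"
      using cauchy_seqs_carrier[OF c] by (simp add: scale_minus[symmetric] seminorm_smult)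
    also have "\<dots> \<le> (\<bar>t\<bar> + 1) * N (c k \<ominus> c l)"
      using cauchy_seqs_carrier[OF c] by (intro mult_right_mono seminorm_nonneg) auto
    also have "\<dots> < e" using K kl by (simp add: field_simps)
    finally show ?thesis .
  qed
  then show "\<exists>K. \<forall>k\<ge>K. \<forall>l\<ge>K. N (t \<odot> c k \<ominus> t \<odot> c l) < e" by blast
qed (use cauchy_seqs_carrier[OF c] in auto)

lemma seq_space_real_space: "real_space (seq_space V N)"
proof (intro real_space.intro moduleI abelian_groupI cring_real_line)
  fix c assume "c \<in> carrier (seq_space V N)"
  then show "\<exists>d\<in>carrier (seq_space V N). d \<oplus>\<^bsub>seq_space V N\<^esub> c = \<zero>\<^bsub>seq_space V N\<^esub>"
    using cauchy_seqs_scale[of c "-1"] cauchy_seqs_carrier[of c]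
    by (intro bexI[of _ "\<lambda>n. (-1) \<odot> c n"]) (auto simp: uminus_conv_scale[symmetric] l_neg)
qed (auto simp: cauchy_seqs_add cauchy_seqs_scale cauchy_seqs_carrier a_ac scale_add add_scale scale_scale)

lemma seq_space_minus:
  assumes "c \<in> cauchy_seqs V N" "d \<in> cauchy_seqs V N"
  shows "c \<ominus>\<^bsub>seq_space V N\<^esub> d = (\<lambda>n. c n \<ominus> d n)"
proof -
  interpret S: real_space "seq_space V N" by (rule seq_space_real_space)
  show ?thesis
    using assms cauchy_seqs_carrier[OF assms(2)]
    by (simp add: S.minus_eq minus_eq S.uminus_conv_scale uminus_conv_scale)
qed

lemma tendsto_nrm_seq_space:
  assumes c: "c \<in> cauchy_seqs V N" shows "(\<lambda>n. N (c n)) \<longlonglongrightarrow> nrm (seq_space V N) c"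
proof -
  have "Cauchy (\<lambda>n. N (c n))"
    unfolding Cauchy_def
  proof (intro allI impI)
    fix e :: real assume "0 < e"
    then obtain K where K: "\<forall>k\<ge>K. \<forall>l\<ge>K. N (c k \<ominus> c l) < e" using cauchy_seqsD[OF c] by blast
    have "dist (N (c k)) (N (c l)) < e" if "K \<le> k" "K \<le> l" for k l
      using K that seminorm_diff_le[of "c k" "c l"] cauchy_seqs_carrier[OF c]
      by (fastforce simp: dist_real_def)
    then show "\<exists>K. \<forall>k\<ge>K. \<forall>l\<ge>K. dist (N (c k)) (N (c l)) < e" by blast
  qed
  then show ?thesis
    by (simp add: seq_space_def Cauchy_convergent_iff convergent_LIMSEQ_iff)
qed

lemma nrm_seq_space_eqI: "c \<in> cauchy_seqs V N \<Longrightarrow> (\<lambda>n. N (c n)) \<longlonglongrightarrow> a \<Longrightarrow> nrm (seq_space V N) c = a"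
  using tendsto_nrm_seq_space LIMSEQ_unique by blast

lemma nrm_seq_space_const: "x \<in> carrier V \<Longrightarrow> nrm (seq_space V N) (\<lambda>n. x) = N x"
  by (rule nrm_seq_space_eqI) auto

lemma seq_space_seminormed: "seminormed_space (seq_space V N) (nrm (seq_space V N))"
proof (intro seminormed_space.intro seminormed_space_axioms.intro seq_space_real_space)
  fix c assume "c \<in> carrier (seq_space V N)"
  then have c: "c \<in> cauchy_seqs V N" by simp
  show "0 \<le> nrm (seq_space V N) c"
    using tendsto_nrm_seq_space[OF c] cauchy_seqs_carrier[OF c] seminorm_nonneg
    by (intro LIMSEQ_le_const[of _ _ 0]) auto
  show "nrm (seq_space V N) (t \<odot>\<^bsub>seq_space V N\<^esub> c) = \<bar>t\<bar> * nrm (seq_space V N) c" for t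
  proof (rule nrm_seq_space_eqI)
    show "t \<odot>\<^bsub>seq_space V N\<^esub> c \<in> cauchy_seqs V N" using c by (simp add: cauchy_seqs_scale)
    show "(\<lambda>n. N ((t \<odot>\<^bsub>seq_space V N\<^esub> c) n)) \<longlonglongrightarrow> \<bar>t\<bar> * nrm (seq_space V N) c"
      using tendsto_mult_left[OF tendsto_nrm_seq_space[OF c], of "\<bar>t\<bar>"] cauchy_seqs_carrier[OF c]
      by (simp add: seminorm_smult)
  qed
  fix d assume "d \<in> carrier (seq_space V N)"
  then have d: "d \<in> cauchy_seqs V N" by simp
  show "nrm (seq_space V N) (c \<oplus>\<^bsub>seq_space V N\<^esub> d) \<le> nrm (seq_space V N) c + nrm (seq_space V N) d"
  proof (rule LIMSEQ_le)
    show "(\<lambda>n. N (c n \<oplus> d n)) \<longlonglongrightarrow> nrm (seq_space V N) (c \<oplus>\<^bsub>seq_space V N\<^esub> d)"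
      using tendsto_nrm_seq_space[OF cauchy_seqs_add[OF c d]] by simp
    show "(\<lambda>n. N (c n) + N (d n)) \<longlonglongrightarrow> nrm (seq_space V N) c + nrm (seq_space V N) d"
      by (intro tendsto_add tendsto_nrm_seq_space c d)
    show "\<exists>K. \<forall>n\<ge>K. N (c n \<oplus> d n) \<le> N (c n) + N (d n)"
      using seminorm_add cauchy_seqs_carrier[OF c] cauchy_seqs_carrier[OF d] by blast
  qed
qed

text \<open>A Cauchy sequence of Cauchy sequences converges to a diagonal sequence.\<close>

lemma seq_space_complete: "complete_seminorm (seq_space V N) (nrm (seq_space V N))"
  unfolding complete_seminorm_def
proof
  let ?S = "seq_space V N"
  let ?\<nu> = "nrm (seq_space V N)"
  interpret S: seminormed_space ?S ?\<nu> by (rule seq_space_seminormed)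
  fix s assume s: "s \<in> cauchy_seqs ?S ?\<nu>"
  have sc: "s n \<in> cauchy_seqs V N" for n using S.cauchy_seqs_carrier[OF s] by simp
  \<comment> \<open>Beyond the index chosen here, the n-th sequence varies by less than 1 / (n + 1).\<close>
  have "\<exists>K. \<forall>l\<ge>K. N (s n l \<ominus> s n K) < 1 / real (Suc n)" for n
    using cauchy_seqsD[OF sc[of n], of "1 / real (Suc n)"] by (metis le_refl of_nat_0_less_iff zero_less_Suc zero_less_divide_1_iff)
  then obtain \<kappa> where \<kappa>: "\<And>n l. \<kappa> n \<le> l \<Longrightarrow> N (s n l \<ominus> s n (\<kappa> n)) < 1 / real (Suc n)" by metis
  define c where "c n = s n (\<kappa> n)" for n
  have cV: "c n \<in> carrier V" for n using cauchy_seqs_carrier[OF sc] by (simp add: c_def)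
  have near: "?\<nu> (s n \<ominus>\<^bsub>?S\<^esub> (\<lambda>l. c n)) \<le> 1 / real (Suc n)" for n
  proof -
    have "(\<lambda>l. N (s n l \<ominus> c n)) \<longlonglongrightarrow> ?\<nu> (s n \<ominus>\<^bsub>?S\<^esub> (\<lambda>l. c n))"
      using tendsto_nrm_seq_space[of "s n \<ominus>\<^bsub>?S\<^esub> (\<lambda>l. c n)"] S.minus_closed[of "s n" "\<lambda>l. c n"] sc cV
      by (simp add: seq_space_minus)
    then show ?thesis
      using \<kappa>[of n] unfolding c_def by (intro LIMSEQ_le_const2[where X = "\<lambda>l. N (s n l \<ominus> s n (\<kappa> n))"]) (auto intro: less_imp_le)
  qed
  have const_diff: "?\<nu> ((\<lambda>l. c n) \<ominus>\<^bsub>?S\<^esub> (\<lambda>l. c k)) = N (c n \<ominus> c k)" for n k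
    using cV by (simp add: seq_space_minus nrm_seq_space_const)
  have c_le: "N (c n \<ominus> c k) \<le> 1 / real (Suc n) + ?\<nu> (s n \<ominus>\<^bsub>?S\<^esub> s k) + 1 / real (Suc k)" for n k
  proof -
    have "N (c n \<ominus> c k) \<le> ?\<nu> ((\<lambda>l. c n) \<ominus>\<^bsub>?S\<^esub> s n) + ?\<nu> (s n \<ominus>\<^bsub>?S\<^esub> (\<lambda>l. c k))"
      unfolding const_diff[symmetric] using cV sc by (intro S.seminorm_triangle) auto
    moreover have "?\<nu> (s n \<ominus>\<^bsub>?S\<^esub> (\<lambda>l. c k)) \<le> ?\<nu> (s n \<ominus>\<^bsub>?S\<^esub> s k) + ?\<nu> (s k \<ominus>\<^bsub>?S\<^esub> (\<lambda>l. c k))"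
      using cV sc by (intro S.seminorm_triangle) auto
    moreover have "?\<nu> ((\<lambda>l. c n) \<ominus>\<^bsub>?S\<^esub> s n) = ?\<nu> (s n \<ominus>\<^bsub>?S\<^esub> (\<lambda>l. c n))"
      using cV sc by (intro S.seminorm_minus_commute) auto
    ultimately show ?thesis using near[of n] near[of k] by linarith
  qed
  have c: "c \<in> cauchy_seqs V N"
    unfolding cauchy_seqs_def
  proof (intro CollectI conjI allI impI cV)
    fix e :: real assume e: "0 < e"
    obtain K where K: "\<forall>k\<ge>K. \<forall>l\<ge>K. ?\<nu> (s k \<ominus>\<^bsub>?S\<^esub> s l) < e / 3"
      using S.cauchy_seqsD[OF s, of "e / 3"] e by auto
    obtain M where M: "1 / real (Suc M) < e / 3" using nat_approx_posE[of "e / 3"] e by auto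
    have small: "1 / real (Suc k) < e / 3" if "M \<le> k" for k
    proof -
      have "1 / real (Suc k) \<le> 1 / real (Suc M)" using that by (simp add: frac_le)
      then show ?thesis using M by linarith
    qed
    have "N (c k \<ominus> c l) < e" if "max K M \<le> k" "max K M \<le> l" for k l
      using c_le[of k l] K[rule_format, of k l] small[of k] small[of l] that by simp
    then show "\<exists>K. \<forall>k\<ge>K. \<forall>l\<ge>K. N (c k \<ominus> c l) < e" by blast
  qed
  have "(\<lambda>n. ?\<nu> (s n \<ominus>\<^bsub>?S\<^esub> c)) \<longlonglongrightarrow> 0"
  proof (rule LIMSEQ_I)
    fix e :: real assume e: "0 < e"
    obtain K where K: "\<forall>k\<ge>K. \<forall>l\<ge>K. N (c k \<ominus> c l) < e / 3" using cauchy_seqsD[OF c, of "e / 3"] e by auto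
    obtain M where M: "1 / real (Suc M) < e / 3" using nat_approx_posE[of "e / 3"] e by auto
    have "norm (?\<nu> (s n \<ominus>\<^bsub>?S\<^esub> c) - 0) < e" if n: "max K M \<le> n" for n
    proof -
      have "(\<lambda>l. N (c n \<ominus> c l)) \<longlonglongrightarrow> ?\<nu> ((\<lambda>l. c n) \<ominus>\<^bsub>?S\<^esub> c)"
        using tendsto_nrm_seq_space[of "(\<lambda>l. c n) \<ominus>\<^bsub>?S\<^esub> c"] S.minus_closed[of "\<lambda>l. c n" c] c cV
        by (simp add: seq_space_minus)
      then have "?\<nu> ((\<lambda>l. c n) \<ominus>\<^bsub>?S\<^esub> c) \<le> e / 3"
        using K n by (intro LIMSEQ_le_const2[where X = "\<lambda>l. N (c n \<ominus> c l)"]) (auto intro!: exI[of _ K] less_imp_le)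
      moreover have "?\<nu> (s n \<ominus>\<^bsub>?S\<^esub> c) \<le> ?\<nu> (s n \<ominus>\<^bsub>?S\<^esub> (\<lambda>l. c n)) + ?\<nu> ((\<lambda>l. c n) \<ominus>\<^bsub>?S\<^esub> c)"
        using c cV sc by (intro S.seminorm_triangle) auto
      moreover have "1 / real (Suc n) \<le> 1 / real (Suc M)" using n by (simp add: frac_le)
      moreover have "0 \<le> ?\<nu> (s n \<ominus>\<^bsub>?S\<^esub> c)" using c sc by (intro S.seminorm_nonneg S.minus_closed) auto
      ultimately show ?thesis using near[of n] M by simp
    qed
    then show "\<exists>K. \<forall>n\<ge>K. norm (?\<nu> (s n \<ominus>\<^bsub>?S\<^esub> c) - 0) < e" by blast
  qed
  then show "\<exists>c\<in>carrier ?S. (\<lambda>n. ?\<nu> (s n \<ominus>\<^bsub>?S\<^esub> c)) \<longlonglongrightarrow> 0" using c by auto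
qed

end

text \<open>
  The quotient of a complete seminormed space by the kernel of its seminorm, with the classes
  represented by chosen elements, which \<open>\<iota>\<close> copies into another type.
\<close>

lemma hausdorff_quotient:
  fixes M :: "('c, 'z) normed_scheme" and \<iota> :: "'c \<Rightarrow> 'x"
  assumes M: "seminormed_space M \<nu>" and complete: "complete_seminorm M \<nu>" and "inj \<iota>"
  shows "\<exists>(X :: 'x normed) \<pi>. banach_space X \<and> carrier X = \<pi> ` carrier M \<and>
    (\<forall>x\<in>carrier M. \<forall>y\<in>carrier M. \<pi> (x \<oplus>\<^bsub>M\<^esub> y) = \<pi> x \<oplus>\<^bsub>X\<^esub> \<pi> y) \<and>
    (\<forall>t. \<forall>x\<in>carrier M. \<pi> (t \<odot>\<^bsub>M\<^esub> x) = t \<odot>\<^bsub>X\<^esub> \<pi> x) \<and>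
    (\<forall>x\<in>carrier M. nrm X (\<pi> x) = \<nu> x)"
proof -
  interpret M: seminormed_space M \<nu> by (rule M)
  define rep where "rep x = (SOME y. y \<in> carrier M \<and> \<nu> (y \<ominus>\<^bsub>M\<^esub> x) = 0)" for x
  define \<pi> where "\<pi> x = \<iota> (rep x)" for x
  define \<sigma> where "\<sigma> a = inv_into UNIV \<iota> a" for a
  have \<sigma>: "\<sigma> (\<pi> x) = rep x" for x by (simp add: \<sigma>_def \<pi>_def \<open>inj \<iota>\<close>)
  have rep: "rep x \<in> carrier M" "\<nu> (rep x \<ominus>\<^bsub>M\<^esub> x) = 0" if "x \<in> carrier M" for x
    using someI[of "\<lambda>y. y \<in> carrier M \<and> \<nu> (y \<ominus>\<^bsub>M\<^esub> x) = 0" x] that by (auto simp: rep_def)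
  have \<pi>_eqI: "\<pi> x = \<pi> y" if xy: "x \<in> carrier M" "y \<in> carrier M" "\<nu> (x \<ominus>\<^bsub>M\<^esub> y) = 0" for x y
  proof -
    have "\<nu> (z \<ominus>\<^bsub>M\<^esub> x) = \<nu> (z \<ominus>\<^bsub>M\<^esub> y)" if z: "z \<in> carrier M" for z
      using M.seminorm_triangle[OF z xy(1,2)] M.seminorm_triangle[OF z xy(2,1)]
        M.seminorm_minus_commute[OF xy(1,2)] xy(3) by simp
    then have "(\<lambda>z. z \<in> carrier M \<and> \<nu> (z \<ominus>\<^bsub>M\<^esub> x) = 0) = (\<lambda>z. z \<in> carrier M \<and> \<nu> (z \<ominus>\<^bsub>M\<^esub> y) = 0)"
      by auto
    then show ?thesis unfolding \<pi>_def rep_def by simp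
  qed
  define X :: "'x normed" where "X = \<lparr>carrier = \<pi> ` carrier M, mult = undefined, one = undefined, zero = \<pi> \<zero>\<^bsub>M\<^esub>,
    add = (\<lambda>a b. \<pi> (\<sigma> a \<oplus>\<^bsub>M\<^esub> \<sigma> b)), smult = (\<lambda>t a. \<pi> (t \<odot>\<^bsub>M\<^esub> \<sigma> a)), nrm = (\<lambda>a. \<nu> (\<sigma> a))\<rparr>"
  have carrier_X: "carrier X = \<pi> ` carrier M" and zero_X: "\<zero>\<^bsub>X\<^esub> = \<pi> \<zero>\<^bsub>M\<^esub>" by (simp_all add: X_def)
  have \<pi>_add: "\<pi> x \<oplus>\<^bsub>X\<^esub> \<pi> y = \<pi> (x \<oplus>\<^bsub>M\<^esub> y)" if x: "x \<in> carrier M" and y: "y \<in> carrier M" for x y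
  proof -
    have "(rep x \<oplus>\<^bsub>M\<^esub> rep y) \<ominus>\<^bsub>M\<^esub> (x \<oplus>\<^bsub>M\<^esub> y) = (rep x \<ominus>\<^bsub>M\<^esub> x) \<oplus>\<^bsub>M\<^esub> (rep y \<ominus>\<^bsub>M\<^esub> y)"
      using x y rep by (simp add: M.minus_eq M.minus_add M.a_ac)
    then have "\<nu> ((rep x \<oplus>\<^bsub>M\<^esub> rep y) \<ominus>\<^bsub>M\<^esub> (x \<oplus>\<^bsub>M\<^esub> y)) \<le> 0"
      using M.seminorm_add[of "rep x \<ominus>\<^bsub>M\<^esub> x" "rep y \<ominus>\<^bsub>M\<^esub> y"] x y rep by simp
    then have "\<pi> (rep x \<oplus>\<^bsub>M\<^esub> rep y) = \<pi> (x \<oplus>\<^bsub>M\<^esub> y)"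
      using x y rep by (intro \<pi>_eqI antisym M.seminorm_nonneg) auto
    then show ?thesis by (simp add: X_def \<sigma>)
  qed
  have \<pi>_scale: "t \<odot>\<^bsub>X\<^esub> \<pi> x = \<pi> (t \<odot>\<^bsub>M\<^esub> x)" if x: "x \<in> carrier M" for t x
  proof -
    have "\<nu> (t \<odot>\<^bsub>M\<^esub> rep x \<ominus>\<^bsub>M\<^esub> t \<odot>\<^bsub>M\<^esub> x) = 0"
      using x rep by (simp add: M.scale_minus[symmetric] M.seminorm_smult)
    then have "\<pi> (t \<odot>\<^bsub>M\<^esub> rep x) = \<pi> (t \<odot>\<^bsub>M\<^esub> x)" using x rep by (intro \<pi>_eqI) auto
    then show ?thesis by (simp add: X_def \<sigma>)
  qed
  have \<pi>_nrm: "nrm X (\<pi> x) = \<nu> x" if x: "x \<in> carrier M" for x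
    using M.seminorm_diff_le[of "rep x" x] x rep by (simp add: X_def \<sigma>)
  have X: "real_space X"
  proof (intro real_space.intro moduleI abelian_groupI cring_real_line)
    fix a assume "a \<in> carrier X"
    then obtain x where x: "x \<in> carrier M" "a = \<pi> x" by (auto simp: carrier_X)
    then have "\<pi> (\<ominus>\<^bsub>M\<^esub> x) \<oplus>\<^bsub>X\<^esub> a = \<zero>\<^bsub>X\<^esub>" by (simp add: \<pi>_add zero_X M.l_neg)
    then show "\<exists>b\<in>carrier X. b \<oplus>\<^bsub>X\<^esub> a = \<zero>\<^bsub>X\<^esub>" using x by (auto simp: carrier_X)
  qed (auto simp: carrier_X zero_X \<pi>_add \<pi>_scale M.a_ac M.scale_add M.add_scale M.scale_scale)
  interpret X: real_space X by (rule X)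
  have \<pi>_carrier: "\<pi> x \<in> carrier X" if "x \<in> carrier M" for x using that by (simp add: carrier_X)
  have \<pi>_minus: "\<pi> x \<ominus>\<^bsub>X\<^esub> \<pi> y = \<pi> (x \<ominus>\<^bsub>M\<^esub> y)" if "x \<in> carrier M" "y \<in> carrier M" for x y
    using that by (simp add: X.minus_eq M.minus_eq X.uminus_conv_scale M.uminus_conv_scale \<pi>_scale \<pi>_add \<pi>_carrier)
  have "banach_space X"
  proof (intro banach_space.intro banach_space_axioms.intro X.module_axioms)
    fix a assume "a \<in> carrier X"
    then obtain x where x: "x \<in> carrier M" "a = \<pi> x" by (auto simp: carrier_X)
    show "0 \<le> nrm X a" using x by (simp add: \<pi>_nrm M.seminorm_nonneg)
    show "nrm X a = 0 \<longleftrightarrow> a = \<zero>\<^bsub>X\<^esub>"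
    proof
      assume "nrm X a = 0"
      then show "a = \<zero>\<^bsub>X\<^esub>"
        unfolding x(2) zero_X using x by (intro \<pi>_eqI) (auto simp: \<pi>_nrm M.minus_eq M.uminus_conv_scale)
    qed (simp add: zero_X \<pi>_nrm)
    show "nrm X (t \<odot>\<^bsub>X\<^esub> a) = \<bar>t\<bar> * nrm X a" for t using x by (simp add: \<pi>_scale \<pi>_nrm M.seminorm_smult)
    fix b assume "b \<in> carrier X"
    then obtain y where y: "y \<in> carrier M" "b = \<pi> y" by (auto simp: carrier_X)
    show "nrm X (a \<oplus>\<^bsub>X\<^esub> b) \<le> nrm X a + nrm X b" using x y by (simp add: \<pi>_add \<pi>_nrm M.seminorm_add)
  next
    fix s :: "nat \<Rightarrow> 'x"
    assume s: "\<And>n. s n \<in> carrier X" and Cauchy: "\<And>e. 0 < e \<Longrightarrow> \<exists>K. \<forall>k\<ge>K. \<forall>l\<ge>K. nrm X (s k \<ominus>\<^bsub>X\<^esub> s l) < e"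
    have "\<forall>n. \<exists>x. x \<in> carrier M \<and> s n = \<pi> x" using s unfolding carrier_X by blast
    then obtain c where c: "\<And>n. c n \<in> carrier M" "\<And>n. s n = \<pi> (c n)" by metis
    have "c \<in> cauchy_seqs M \<nu>"
      unfolding cauchy_seqs_def using c Cauchy by (simp add: \<pi>_minus \<pi>_nrm)
    then obtain x where "x \<in> carrier M" "(\<lambda>n. \<nu> (c n \<ominus>\<^bsub>M\<^esub> x)) \<longlonglongrightarrow> 0"
      using complete unfolding complete_seminorm_def by blast
    then show "\<exists>a\<in>carrier X. (\<lambda>n. nrm X (s n \<ominus>\<^bsub>X\<^esub> a)) \<longlonglongrightarrow> 0"
      using c by (intro bexI[of _ "\<pi> x"]) (auto simp: \<pi>_minus \<pi>_nrm \<pi>_carrier)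
  qed
  then show ?thesis using carrier_X \<pi>_add \<pi>_scale \<pi>_nrm by (intro exI[of _ X] exI[of _ \<pi>]) simp
qed

text \<open>
  \<open>X\<close> is a Hausdorff completion of the seminormed space \<open>V\<close>, where \<open>\<pi>\<close> assigns to a Cauchy sequence its
  limit. A vector of \<open>V\<close> is mapped to \<open>X\<close> as a constant sequence.
\<close>

definition is_completion ::
    "('a, 'z) normed_scheme \<Rightarrow> ('a \<Rightarrow> real) \<Rightarrow> 'x normed \<Rightarrow> ((nat \<Rightarrow> 'a) \<Rightarrow> 'x) \<Rightarrow> bool" where
  "is_completion V N X \<pi> \<longleftrightarrow> banach_space X \<and> carrier X = \<pi> ` cauchy_seqs V N \<and>
    (\<forall>c\<in>cauchy_seqs V N. \<forall>d\<in>cauchy_seqs V N. \<pi> (\<lambda>n. c n \<oplus>\<^bsub>V\<^esub> d n) = \<pi> c \<oplus>\<^bsub>X\<^esub> \<pi> d) \<and>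
    (\<forall>t. \<forall>c\<in>cauchy_seqs V N. \<pi> (\<lambda>n. t \<odot>\<^bsub>V\<^esub> c n) = t \<odot>\<^bsub>X\<^esub> \<pi> c) \<and>
    (\<forall>c\<in>cauchy_seqs V N. (\<lambda>n. N (c n)) \<longlonglongrightarrow> nrm X (\<pi> c))"

lemma is_completion_add:
  "is_completion V N X \<pi> \<Longrightarrow> c \<in> cauchy_seqs V N \<Longrightarrow> d \<in> cauchy_seqs V N \<Longrightarrow>
    \<pi> (\<lambda>n. c n \<oplus>\<^bsub>V\<^esub> d n) = \<pi> c \<oplus>\<^bsub>X\<^esub> \<pi> d"
  and is_completion_smult:
  "is_completion V N X \<pi> \<Longrightarrow> c \<in> cauchy_seqs V N \<Longrightarrow> \<pi> (\<lambda>n. t \<odot>\<^bsub>V\<^esub> c n) = t \<odot>\<^bsub>X\<^esub> \<pi> c"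
  and is_completion_nrm:
  "is_completion V N X \<pi> \<Longrightarrow> c \<in> cauchy_seqs V N \<Longrightarrow> (\<lambda>n. N (c n)) \<longlonglongrightarrow> nrm X (\<pi> c)"
  by (simp_all add: is_completion_def)

lemma (in seminormed_space) exists_completion:
  fixes \<iota> :: "(nat \<Rightarrow> 'a) \<Rightarrow> 'x"
  assumes "inj \<iota>" shows "\<exists>(X :: 'x normed) \<pi>. is_completion V N X \<pi>"
proof -
  obtain X :: "'x normed" and \<pi> where X: "banach_space X" "carrier X = \<pi> ` carrier (seq_space V N)"
    "\<forall>x\<in>carrier (seq_space V N). \<forall>y\<in>carrier (seq_space V N). \<pi> (x \<oplus>\<^bsub>seq_space V N\<^esub> y) = \<pi> x \<oplus>\<^bsub>X\<^esub> \<pi> y"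
    "\<forall>t. \<forall>x\<in>carrier (seq_space V N). \<pi> (t \<odot>\<^bsub>seq_space V N\<^esub> x) = t \<odot>\<^bsub>X\<^esub> \<pi> x"
    "\<forall>x\<in>carrier (seq_space V N). nrm X (\<pi> x) = nrm (seq_space V N) x"
    using hausdorff_quotient[OF seq_space_seminormed seq_space_complete assms] by blast
  have "is_completion V N X \<pi>"
    unfolding is_completion_def using X tendsto_nrm_seq_space by simp
  then show ?thesis by blast
qed

section \<open>Extension of multilinear operators to completions\<close>

text \<open>
  Passing from \<open>y\<close> to \<open>x\<close> one component at a time, every step is a value of \<open>T\<close> at a tuple with one
  component \<open>x k - y k\<close>.
\<close>

lemma multilinear_diff_le:
  assumes T: "T \<in> bounded_multilinear_ops m E F"
    and E: "\<And>j. j \<in> {1..m} \<Longrightarrow> seminormed_space (E j) (N j)" and F: "banach_space F"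
    and K: "0 \<le> K" "\<And>x. x \<in> tuples m E \<Longrightarrow> nrm F (T x) \<le> K * (\<Prod>j=1..m. N j (x j))"
    and x: "x \<in> tuples m E" and y: "y \<in> tuples m E"
    and B: "\<And>j. j \<in> {1..m} \<Longrightarrow> N j (x j) \<le> B" "\<And>j. j \<in> {1..m} \<Longrightarrow> N j (y j) \<le> B"
  shows "nrm F (T x \<ominus>\<^bsub>F\<^esub> T y) \<le> K * B ^ (m - 1) * (\<Sum>j=1..m. N j (x j \<ominus>\<^bsub>E j\<^esub> y j))"
proof -
  interpret F: banach_space F by (rule F)
  have E_real: "real_space (E j)" if "j \<in> {1..m}" for j
    using E[OF that] by (simp add: seminormed_space_def)
  define h where "h J = (\<lambda>j\<in>{1..m}. if j \<in> J then x j else y j)" for J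
  have h: "h J \<in> tuples m E" for J
    unfolding h_def using tuples_carrier[OF x] tuples_carrier[OF y] by (intro restrict_in_tuples) simp
  have Th: "T (h J) \<in> carrier F" for J by (rule multilinear_carrier[OF T h])
  have le: "nrm F (T (h J) \<ominus>\<^bsub>F\<^esub> T y) \<le> K * B ^ (m - 1) * (\<Sum>j\<in>J. N j (x j \<ominus>\<^bsub>E j\<^esub> y j))"
    if "finite J" "J \<subseteq> {1..m}" for J
    using that
  proof (induction J rule: finite_induct)
    case empty
    have "h {} = y" using y by (intro tuples_eqI[OF h y]) (simp add: h_def)
    then show ?case
      using multilinear_carrier[OF T y] F.nrm_eq_0[of "\<zero>\<^bsub>F\<^esub>"] by (simp add: F.minus_eq F.r_neg)
  next
    case (insert k J)
    have k: "k \<in> {1..m}" using insert by simp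
    interpret k: seminormed_space "E k" "N k" by (rule E[OF k])
    note xk = tuples_carrier[OF x k] and yk = tuples_carrier[OF y k]
    have "h (insert k J) = (h J)(k := x k)" "h J = (h J)(k := y k)"
      using insert.hyps k by (auto simp: h_def fun_eq_iff)
    then have "T (h (insert k J)) \<ominus>\<^bsub>F\<^esub> T (h J) = T ((h J)(k := x k \<ominus>\<^bsub>E k\<^esub> y k))"
      using multilinear_minus[OF T E_real F.real_space_axioms h k xk yk, of J] by simp
    also have "nrm F \<dots> \<le> K * (\<Prod>j=1..m. N j (((h J)(k := x k \<ominus>\<^bsub>E k\<^esub> y k)) j))"
      using xk yk by (intro K tuples_update h k) auto
    also have "(\<Prod>j=1..m. N j (((h J)(k := x k \<ominus>\<^bsub>E k\<^esub> y k)) j))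
        = N k (x k \<ominus>\<^bsub>E k\<^esub> y k) * (\<Prod>j\<in>{1..m} - {k}. N j (h J j))"
      using k by (simp add: prod.remove[of _ k])
    also have "K * \<dots> \<le> K * (N k (x k \<ominus>\<^bsub>E k\<^esub> y k) * B ^ (m - 1))"
    proof (intro mult_left_mono K k.seminorm_nonneg)
      have "(\<Prod>j\<in>{1..m} - {k}. N j (h J j)) \<le> (\<Prod>j\<in>{1..m} - {k}. B)"
        using seminormed_space.seminorm_nonneg[OF E tuples_carrier[OF h]] B
        by (intro prod_mono) (auto simp: h_def)
      then show "(\<Prod>j\<in>{1..m} - {k}. N j (h J j)) \<le> B ^ (m - 1)" using k by simp
    qed (use xk yk in auto)
    finally have step: "nrm F (T (h (insert k J)) \<ominus>\<^bsub>F\<^esub> T (h J)) \<le> K * B ^ (m - 1) * N k (x k \<ominus>\<^bsub>E k\<^esub> y k)"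
      by (simp add: mult_ac)
    have Ty: "T y \<in> carrier F" by (rule multilinear_carrier[OF T y])
    have "T (h (insert k J)) \<ominus>\<^bsub>F\<^esub> T y = (T (h (insert k J)) \<ominus>\<^bsub>F\<^esub> T (h J)) \<oplus>\<^bsub>F\<^esub> (T (h J) \<ominus>\<^bsub>F\<^esub> T y)"
      using Th Ty by (simp add: F.minus_eq F.a_assoc F.r_neg1)
    then have "nrm F (T (h (insert k J)) \<ominus>\<^bsub>F\<^esub> T y)
        \<le> nrm F (T (h (insert k J)) \<ominus>\<^bsub>F\<^esub> T (h J)) + nrm F (T (h J) \<ominus>\<^bsub>F\<^esub> T y)"
      using Th Ty by (simp add: F.nrm_triangle)
    then show ?case using step insert by (simp add: distrib_left)
  qed
  have "h {1..m} = x" using x by (intro tuples_eqI[OF h x]) (simp add: h_def)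
  then show ?thesis using le[of "{1..m}"] by simp
qed

lemma banach_space_seminormed: "banach_space V \<Longrightarrow> seminormed_space V (nrm V)"
proof -
  assume "banach_space V"
  then interpret banach_space V .
  show ?thesis by unfold_locales (auto simp: nrm_nonneg nrm_triangle nrm_smult)
qed

lemma null_squeeze:
  fixes a b :: "nat \<Rightarrow> real"
  assumes "\<And>n. \<bar>a n\<bar> \<le> b n" "b \<longlonglongrightarrow> 0" shows "a \<longlonglongrightarrow> 0"
  by (rule Lim_null_comparison[OF _ assms(2)]) (simp add: assms(1))

definition converges_to :: "('a, 'z) normed_scheme \<Rightarrow> (nat \<Rightarrow> 'a) \<Rightarrow> 'a \<Rightarrow> bool" where
  "converges_to V s x \<longleftrightarrow> (\<forall>n. s n \<in> carrier V) \<and> x \<in> carrier V \<and> (\<lambda>n. nrm V (s n \<ominus>\<^bsub>V\<^esub> x)) \<longlonglongrightarrow> 0"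

context banach_space
begin

interpretation S: seminormed_space V "nrm V"
  by (rule banach_space_seminormed) (rule banach_space_axioms)

lemma converges_to_close:
  assumes "converges_to V s x" "\<And>n. s' n \<in> carrier V" "(\<lambda>n. nrm V (s n \<ominus> s' n)) \<longlonglongrightarrow> 0"
  shows "converges_to V s' x"
proof -
  have x: "x \<in> carrier V" and s: "s n \<in> carrier V" for n using assms by (auto simp: converges_to_def)
  have "(\<lambda>n. nrm V (s' n \<ominus> x)) \<longlonglongrightarrow> 0"
  proof (rule null_squeeze)
    show "(\<lambda>n. nrm V (s n \<ominus> s' n) + nrm V (s n \<ominus> x)) \<longlonglongrightarrow> 0"
      using tendsto_add[OF assms(3), of "\<lambda>n. nrm V (s n \<ominus> x)" 0] assms(1) by (simp add: converges_to_def)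
    show "\<bar>nrm V (s' n \<ominus> x)\<bar> \<le> nrm V (s n \<ominus> s' n) + nrm V (s n \<ominus> x)" for n
      using S.seminorm_triangle[OF assms(2) s x, of n n] S.seminorm_minus_commute[OF assms(2) s, of n n]
        nrm_nonneg[of "s' n \<ominus> x"] assms(2) x by simp
  qed
  then show ?thesis using x assms(2) by (simp add: converges_to_def)
qed

lemma converges_to_unique:
  assumes "converges_to V s x" "converges_to V s y" shows "x = y"
proof -
  have x: "x \<in> carrier V" and y: "y \<in> carrier V" and s: "s n \<in> carrier V" for n
    using assms by (simp_all add: converges_to_def)
  have lim: "(\<lambda>n. nrm V (s n \<ominus> x) + nrm V (s n \<ominus> y)) \<longlonglongrightarrow> 0 + 0"
    using assms by (intro tendsto_add) (simp_all add: converges_to_def)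
  have "nrm V (x \<ominus> y) \<le> nrm V (s n \<ominus> x) + nrm V (s n \<ominus> y)" for n
    using S.seminorm_triangle[OF x s y, of n] S.seminorm_minus_commute[OF x s, of n] by linarith
  then have "nrm V (x \<ominus> y) \<le> 0 + 0" by (intro LIMSEQ_le_const[OF lim]) blast
  then have "x \<ominus> y = \<zero>" using nrm_nonneg[of "x \<ominus> y"] nrm_eq_0[of "x \<ominus> y"] x y by simp
  then have "(x \<ominus> y) \<oplus> y = \<zero> \<oplus> y" by simp
  then show ?thesis using x y by (simp add: minus_eq a_assoc l_neg)
qed

lemma converges_to_add:
  assumes "converges_to V s x" "converges_to V s' y" shows "converges_to V (\<lambda>n. s n \<oplus> s' n) (x \<oplus> y)"
proof -
  have x: "x \<in> carrier V" and y: "y \<in> carrier V" and s: "s n \<in> carrier V" "s' n \<in> carrier V" for n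
    using assms by (auto simp: converges_to_def)
  have "(s n \<oplus> s' n) \<ominus> (x \<oplus> y) = (s n \<ominus> x) \<oplus> (s' n \<ominus> y)" for n
    using x y s by (simp add: minus_eq minus_add a_ac)
  then have le: "\<bar>nrm V ((s n \<oplus> s' n) \<ominus> (x \<oplus> y))\<bar> \<le> nrm V (s n \<ominus> x) + nrm V (s' n \<ominus> y)" for n
    using x y s nrm_nonneg[of "(s n \<oplus> s' n) \<ominus> (x \<oplus> y)"] by (simp add: nrm_triangle)
  have "(\<lambda>n. nrm V (s n \<ominus> x) + nrm V (s' n \<ominus> y)) \<longlonglongrightarrow> 0 + 0"
    using assms by (intro tendsto_add) (simp_all add: converges_to_def)
  then have "(\<lambda>n. nrm V (s n \<ominus> x) + nrm V (s' n \<ominus> y)) \<longlonglongrightarrow> 0" by simp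
  from null_squeeze[OF le this] have "(\<lambda>n. nrm V ((s n \<oplus> s' n) \<ominus> (x \<oplus> y))) \<longlonglongrightarrow> 0" .
  then show ?thesis using x y s by (simp add: converges_to_def)
qed

lemma converges_to_scale:
  assumes "converges_to V s x" shows "converges_to V (\<lambda>n. t \<odot> s n) (t \<odot> x)"
proof -
  have x: "x \<in> carrier V" and s: "s n \<in> carrier V" for n using assms by (auto simp: converges_to_def)
  have "(\<lambda>n. \<bar>t\<bar> * nrm V (s n \<ominus> x)) \<longlonglongrightarrow> \<bar>t\<bar> * 0"
    using assms by (intro tendsto_mult_left) (simp add: converges_to_def)
  then show ?thesis
    using x s by (simp add: converges_to_def scale_minus[symmetric] nrm_smult)
qed

lemma converges_to_nrm:
  assumes "converges_to V s x" shows "(\<lambda>n. nrm V (s n)) \<longlonglongrightarrow> nrm V x"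
proof -
  have x: "x \<in> carrier V" and s: "s n \<in> carrier V" for n using assms by (auto simp: converges_to_def)
  have "(\<lambda>n. nrm V (s n) - nrm V x) \<longlonglongrightarrow> 0"
    by (rule null_squeeze[OF S.seminorm_diff_le[OF s x]]) (use assms in \<open>simp add: converges_to_def\<close>)
  then show ?thesis by (rule LIM_zero_cancel)
qed

lemma converges_to_functional:
  assumes "converges_to V s x" and f: "f \<in> carrier (dual_space V)"
  shows "(\<lambda>n. f (s n)) \<longlonglongrightarrow> f x"
proof -
  have x: "x \<in> carrier V" and s: "s n \<in> carrier V" for n using assms by (auto simp: converges_to_def)
  have diff: "f (s n) - f x = f (s n \<ominus> x)" for n
    using dual_space_add[OF f s, of "(-1) \<odot> x" n] dual_space_smult[OF f x, of "-1"] x s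
    by (simp add: minus_eq uminus_conv_scale)
  have "(\<lambda>n. nrm (dual_space V) f * nrm V (s n \<ominus> x)) \<longlonglongrightarrow> nrm (dual_space V) f * 0"
    using assms by (intro tendsto_mult_left) (simp add: converges_to_def)
  then have lim: "(\<lambda>n. nrm (dual_space V) f * nrm V (s n \<ominus> x)) \<longlonglongrightarrow> 0" by simp
  have "\<bar>f (s n) - f x\<bar> \<le> nrm (dual_space V) f * nrm V (s n \<ominus> x)" for n
    unfolding diff using x s by (intro dual_space_le[OF f]) auto
  from null_squeeze[OF this lim] have "(\<lambda>n. f (s n) - f x) \<longlonglongrightarrow> 0" .
  then show ?thesis by (rule LIM_zero_cancel)
qed

lemma cauchy_converges:
  assumes "\<And>n. s n \<in> carrier V" "\<And>e. 0 < e \<Longrightarrow> \<exists>K. \<forall>k\<ge>K. \<forall>l\<ge>K. nrm V (s k \<ominus> s l) < e"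
  shows "\<exists>x. converges_to V s x"
  using nrm_complete[OF assms] assms(1) by (auto simp: converges_to_def)

end

lemma is_completion_eq:
  assumes X: "is_completion V N X \<pi>" and V: "seminormed_space V N"
    and c: "c \<in> cauchy_seqs V N" and d: "d \<in> cauchy_seqs V N" and eq: "\<pi> c = \<pi> d"
  shows "(\<lambda>n. N (c n \<ominus>\<^bsub>V\<^esub> d n)) \<longlonglongrightarrow> 0"
proof -
  interpret V: seminormed_space V N by (rule V)
  interpret X: banach_space X using X by (simp add: is_completion_def)
  have pd: "\<pi> d \<in> carrier X" using X d by (simp add: is_completion_def)
  define e where "e = (\<lambda>n. c n \<oplus>\<^bsub>V\<^esub> (-1) \<odot>\<^bsub>V\<^esub> d n)"
  have md: "(\<lambda>n. (-1) \<odot>\<^bsub>V\<^esub> d n) \<in> cauchy_seqs V N" using d by (rule V.cauchy_seqs_scale)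
  have e: "e \<in> cauchy_seqs V N" unfolding e_def by (rule V.cauchy_seqs_add[OF c md])
  have "\<pi> e = \<pi> c \<oplus>\<^bsub>X\<^esub> (-1) \<odot>\<^bsub>X\<^esub> \<pi> d"
    using X c d md unfolding is_completion_def e_def by simp
  also have "\<dots> = \<zero>\<^bsub>X\<^esub>" using pd by (simp add: eq X.uminus_conv_scale[symmetric] X.r_neg)
  finally have "nrm X (\<pi> e) = 0" using X.nrm_eq_0[of "\<zero>\<^bsub>X\<^esub>"] by simp
  moreover have "(\<lambda>n. N (e n)) \<longlonglongrightarrow> nrm X (\<pi> e)" using X e by (simp add: is_completion_def)
  moreover have "e n = c n \<ominus>\<^bsub>V\<^esub> d n" for n
    using V.cauchy_seqs_carrier[OF d] by (simp add: e_def V.minus_eq V.uminus_conv_scale)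
  ultimately show ?thesis by simp
qed

text \<open>
  A multilinear operator that is bounded with respect to seminorms is uniformly continuous on bounded
  sets, so it maps Cauchy sequences to convergent sequences, with limits that depend only on the
  points represented by the Cauchy sequences.
\<close>

theorem extension_to_completions:
  assumes T: "T \<in> bounded_multilinear_ops m E F"
    and E: "\<And>j. j \<in> {1..m} \<Longrightarrow> seminormed_space (E j) (N j)" and F: "banach_space F"
    and K: "0 \<le> K" "\<And>x. x \<in> tuples m E \<Longrightarrow> nrm F (T x) \<le> K * (\<Prod>j=1..m. N j (x j))"
    and X: "\<And>j. j \<in> {1..m} \<Longrightarrow> is_completion (E j) (N j) (X j) (\<pi> j)"
  shows "\<exists>A\<in>bounded_multilinear_ops m X F. \<forall>c. (\<forall>j\<in>{1..m}. c j \<in> cauchy_seqs (E j) (N j)) \<longrightarrow>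
    converges_to F (\<lambda>n. T (\<lambda>j\<in>{1..m}. c j n)) (A (\<lambda>j\<in>{1..m}. \<pi> j (c j)))"
proof -
  interpret F: banach_space F by (rule F)
  define Cau where "Cau = {c. \<forall>j\<in>{1..m}. c j \<in> cauchy_seqs (E j) (N j)}"
  define S where "S c n = T (\<lambda>j\<in>{1..m}. c j n)" for c :: "nat \<Rightarrow> nat \<Rightarrow> 'a" and n
  have Cau_carrier: "c j n \<in> carrier (E j)" if "c \<in> Cau" "j \<in> {1..m}" for c j n
    using seminormed_space.cauchy_seqs_carrier[OF E] that by (auto simp: Cau_def)
  have tup: "(\<lambda>j\<in>{1..m}. c j n) \<in> tuples m E" if "c \<in> Cau" for c n
    using Cau_carrier[OF that] by (intro restrict_in_tuples)
  have S_carrier: "S c n \<in> carrier F" if "c \<in> Cau" for c n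
    unfolding S_def by (rule multilinear_carrier[OF T tup[OF that]])
  have lim_N: "(\<lambda>n. N j (c j n)) \<longlonglongrightarrow> nrm (X j) (\<pi> j (c j))" if "c \<in> Cau" "j \<in> {1..m}" for c j
    using X[OF that(2)] that by (auto simp: is_completion_def Cau_def)
  have bounded: "\<exists>B. 0 \<le> B \<and> (\<forall>j\<in>{1..m}. \<forall>n. N j (c j n) \<le> B)" if c: "c \<in> Cau" for c
  proof -
    have "\<forall>j\<in>{1..m}. \<exists>B. \<forall>n. \<bar>N j (c j n)\<bar> \<le> B"
      using convergent_imp_Bseq[OF convergentI[OF lim_N[OF c]]] unfolding Bseq_def real_norm_def by blast
    from bchoice[OF this] obtain B where B: "\<forall>j\<in>{1..m}. \<forall>n. \<bar>N j (c j n)\<bar> \<le> B j" by blast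
    have B0: "0 \<le> B j" if "j \<in> {1..m}" for j using B that abs_ge_zero order_trans by blast
    have "N j (c j n) \<le> (\<Sum>j=1..m. B j)" if j: "j \<in> {1..m}" for j n
    proof -
      have "N j (c j n) \<le> B j" using B j by (meson abs_le_D1)
      also have "\<dots> \<le> (\<Sum>j=1..m. B j)" using B0 j by (intro member_le_sum) auto
      finally show ?thesis .
    qed
    then show ?thesis using B0 by (intro exI[of _ "\<Sum>j=1..m. B j"]) (auto intro: sum_nonneg)
  qed
  have diff: "\<exists>D\<ge>0. \<forall>n k. nrm F (S c n \<ominus>\<^bsub>F\<^esub> S d k) \<le> D * (\<Sum>j=1..m. N j (c j n \<ominus>\<^bsub>E j\<^esub> d j k))"
    if c: "c \<in> Cau" and d: "d \<in> Cau" for c d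
  proof -
    obtain B B' where B: "0 \<le> B" "\<forall>j\<in>{1..m}. \<forall>n. N j (c j n) \<le> B" "0 \<le> B'" "\<forall>j\<in>{1..m}. \<forall>n. N j (d j n) \<le> B'"
      using bounded[OF c] bounded[OF d] by blast
    have "nrm F (S c n \<ominus>\<^bsub>F\<^esub> S d k) \<le> K * (B + B') ^ (m - 1) * (\<Sum>j=1..m. N j (c j n \<ominus>\<^bsub>E j\<^esub> d j k))" for n k
    proof -
      have "nrm F (S c n \<ominus>\<^bsub>F\<^esub> S d k) \<le> K * (B + B') ^ (m - 1) *
          (\<Sum>j=1..m. N j ((\<lambda>j\<in>{1..m}. c j n) j \<ominus>\<^bsub>E j\<^esub> (\<lambda>j\<in>{1..m}. d j k) j))"
        unfolding S_def using B by (intro multilinear_diff_le[OF T E F K tup[OF c] tup[OF d]]) (auto intro: add_increasing add_increasing2)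
      also have "(\<Sum>j=1..m. N j ((\<lambda>j\<in>{1..m}. c j n) j \<ominus>\<^bsub>E j\<^esub> (\<lambda>j\<in>{1..m}. d j k) j))
          = (\<Sum>j=1..m. N j (c j n \<ominus>\<^bsub>E j\<^esub> d j k))"
        by (intro sum.cong) auto
      finally show ?thesis .
    qed
    moreover have "0 \<le> K * (B + B') ^ (m - 1)" using K(1) B by simp
    ultimately show ?thesis by blast
  qed
  have exists_lim: "\<exists>z. converges_to F (S c) z" if c: "c \<in> Cau" for c
  proof (rule F.cauchy_converges)
    show "S c n \<in> carrier F" for n by (rule S_carrier[OF c])
    fix e :: real assume e: "0 < e"
    obtain D where D: "0 \<le> D" "\<And>n k. nrm F (S c n \<ominus>\<^bsub>F\<^esub> S c k) \<le> D * (\<Sum>j=1..m. N j (c j n \<ominus>\<^bsub>E j\<^esub> c j k))"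
      using diff[OF c c] by blast
    define \<delta> where "\<delta> = e / ((D + 1) * (real m + 1))"
    have \<delta>: "0 < \<delta>" using e D by (simp add: \<delta>_def)
    have "\<forall>j\<in>{1..m}. \<exists>M. \<forall>k\<ge>M. \<forall>l\<ge>M. N j (c j k \<ominus>\<^bsub>E j\<^esub> c j l) < \<delta>"
      using seminormed_space.cauchy_seqsD[OF E _ \<delta>] c unfolding Cau_def by blast
    from bchoice[OF this] obtain M where M: "\<forall>j\<in>{1..m}. \<forall>k\<ge>M j. \<forall>l\<ge>M j. N j (c j k \<ominus>\<^bsub>E j\<^esub> c j l) < \<delta>" by blast
    define M' where "M' = (\<Sum>j=1..m. M j)"
    have M_le: "M j \<le> M'" if "j \<in> {1..m}" for j unfolding M'_def using that by (intro member_le_sum) auto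
    have "nrm F (S c k \<ominus>\<^bsub>F\<^esub> S c l) < e" if kl: "M' \<le> k" "M' \<le> l" for k l
    proof -
      have "(\<Sum>j=1..m. N j (c j k \<ominus>\<^bsub>E j\<^esub> c j l)) \<le> (\<Sum>j=1..m. \<delta>)"
        using M M_le kl by (intro sum_mono) (meson less_imp_le order_trans)
      then have "nrm F (S c k \<ominus>\<^bsub>F\<^esub> S c l) \<le> D * (real m * \<delta>)"
        using order_trans[OF D(2)[of k l] mult_left_mono[OF _ D(1)]] by simp
      also have "\<dots> \<le> D * ((real m + 1) * \<delta>)"
        using D(1) \<delta> by (intro mult_left_mono mult_right_mono) auto
      also have "\<dots> < (D + 1) * ((real m + 1) * \<delta>)"
        using \<delta> by (intro mult_strict_right_mono mult_pos_pos) auto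
      also have "\<dots> = e" using D(1) by (simp add: \<delta>_def field_simps add_nonneg_eq_0_iff)
      finally show ?thesis .
    qed
    then show "\<exists>M. \<forall>k\<ge>M. \<forall>l\<ge>M. nrm F (S c k \<ominus>\<^bsub>F\<^esub> S c l) < e" by blast
  qed
  have same_lim: "converges_to F (S d) z"
    if c: "c \<in> Cau" and d: "d \<in> Cau" and eq: "\<And>j. j \<in> {1..m} \<Longrightarrow> \<pi> j (c j) = \<pi> j (d j)"
      and z: "converges_to F (S c) z" for c d z
  proof (rule F.converges_to_close[OF z])
    show "S d n \<in> carrier F" for n by (rule S_carrier[OF d])
    obtain D where D: "0 \<le> D" "\<And>n k. nrm F (S c n \<ominus>\<^bsub>F\<^esub> S d k) \<le> D * (\<Sum>j=1..m. N j (c j n \<ominus>\<^bsub>E j\<^esub> d j k))"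
      using diff[OF c d] by blast
    have "(\<lambda>n. N j (c j n \<ominus>\<^bsub>E j\<^esub> d j n)) \<longlonglongrightarrow> 0" if j: "j \<in> {1..m}" for j
      using c d j by (intro is_completion_eq[OF X[OF j] E[OF j] _ _ eq[OF j]]) (auto simp: Cau_def)
    then have "(\<lambda>n. D * (\<Sum>j=1..m. N j (c j n \<ominus>\<^bsub>E j\<^esub> d j n))) \<longlonglongrightarrow> D * (\<Sum>j=1..m. 0)"
      by (intro tendsto_mult_left tendsto_sum) auto
    then have lim: "(\<lambda>n. D * (\<Sum>j=1..m. N j (c j n \<ominus>\<^bsub>E j\<^esub> d j n))) \<longlonglongrightarrow> 0" by simp
    have "\<bar>nrm F (S c n \<ominus>\<^bsub>F\<^esub> S d n)\<bar> \<le> D * (\<Sum>j=1..m. N j (c j n \<ominus>\<^bsub>E j\<^esub> d j n))" for n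
      using D(2)[of n n] F.nrm_nonneg[of "S c n \<ominus>\<^bsub>F\<^esub> S d n"] S_carrier[OF c] S_carrier[OF d] by simp
    from null_squeeze[OF this lim] show "(\<lambda>n. nrm F (S c n \<ominus>\<^bsub>F\<^esub> S d n)) \<longlonglongrightarrow> 0" .
  qed
  define pick where "pick \<xi> j = (SOME c. c \<in> cauchy_seqs (E j) (N j) \<and> \<pi> j c = \<xi> j)" for \<xi> j
  have pick: "pick \<xi> j \<in> cauchy_seqs (E j) (N j)" "\<pi> j (pick \<xi> j) = \<xi> j"
    if "\<xi> \<in> tuples m X" "j \<in> {1..m}" for \<xi> j
  proof -
    have "\<exists>c. c \<in> cauchy_seqs (E j) (N j) \<and> \<pi> j c = \<xi> j"
      using tuples_carrier[OF that] X[OF that(2)] by (auto simp: is_completion_def)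
    from someI_ex[OF this] show "pick \<xi> j \<in> cauchy_seqs (E j) (N j)" "\<pi> j (pick \<xi> j) = \<xi> j"
      by (auto simp: pick_def)
  qed
  have pick_Cau: "pick \<xi> \<in> Cau" if "\<xi> \<in> tuples m X" for \<xi>
    using pick[OF that] by (auto simp: Cau_def)
  define A where "A \<xi> = (SOME z. converges_to F (S (pick \<xi>)) z)" for \<xi>
  have A_pick: "converges_to F (S (pick \<xi>)) (A \<xi>)" if "\<xi> \<in> tuples m X" for \<xi>
    unfolding A_def using someI_ex[OF exists_lim[OF pick_Cau[OF that]]] .
  have proj_tuples: "(\<lambda>j\<in>{1..m}. \<pi> j (c j)) \<in> tuples m X" if "c \<in> Cau" for c
    using that X by (intro restrict_in_tuples) (auto simp: Cau_def is_completion_def)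
  have A: "converges_to F (S c) (A (\<lambda>j\<in>{1..m}. \<pi> j (c j)))" if c: "c \<in> Cau" for c
    using pick(2)[OF proj_tuples[OF c]]
    by (intro same_lim[OF pick_Cau[OF proj_tuples[OF c]] c _ A_pick[OF proj_tuples[OF c]]]) simp
  \<comment> \<open>Replacing one component of a tuple of Cauchy sequences.\<close>
  have upd_Cau: "(pick \<xi>)(j := d) \<in> Cau" if "\<xi> \<in> tuples m X" "d \<in> cauchy_seqs (E j) (N j)" for \<xi> j d
    using pick_Cau[OF that(1)] that by (auto simp: Cau_def)
  have S_upd: "S ((pick \<xi>)(j := d)) n = T ((\<lambda>i\<in>{1..m}. pick \<xi> i n)(j := d n))" if "j \<in> {1..m}" for \<xi> j d n
    unfolding S_def using that by (intro arg_cong[of _ _ T]) auto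
  have A_upd: "converges_to F (S ((pick \<xi>)(j := d))) (A (\<xi>(j := \<pi> j d)))"
    if \<xi>: "\<xi> \<in> tuples m X" and j: "j \<in> {1..m}" and d: "d \<in> cauchy_seqs (E j) (N j)" for \<xi> j d
  proof -
    have "\<pi> j d \<in> carrier (X j)" using X[OF j] d by (simp add: is_completion_def)
    then have "(\<lambda>i\<in>{1..m}. \<pi> i (((pick \<xi>)(j := d)) i)) = \<xi>(j := \<pi> j d)"
      using pick(2)[OF \<xi>] j
      by (intro tuples_eqI[OF proj_tuples[OF upd_Cau[OF \<xi> d]] tuples_update[OF \<xi> j]]) auto
    then show ?thesis using A[OF upd_Cau[OF \<xi> d]] by simp
  qed
  have "A \<in> bounded_multilinear_ops m X F"
    unfolding bounded_multilinear_ops_def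
  proof (intro CollectI conjI ballI allI)
    fix \<xi> assume \<xi>: "\<xi> \<in> tuples m X"
    show "A \<xi> \<in> carrier F" using A_pick[OF \<xi>] by (simp add: converges_to_def)
    fix j assume j: "j \<in> {1..m}"
    fix y assume "y \<in> carrier (X j)"
    then obtain d where d: "d \<in> cauchy_seqs (E j) (N j)" "y = \<pi> j d" using X[OF j] by (auto simp: is_completion_def)
    interpret j: seminormed_space "E j" "N j" by (rule E[OF j])
    have base: "(\<lambda>i\<in>{1..m}. pick \<xi> i n) \<in> tuples m E" for n by (rule tup[OF pick_Cau[OF \<xi>]])
    {
      fix a
      have "(\<lambda>n. a \<odot>\<^bsub>E j\<^esub> d n) \<in> cauchy_seqs (E j) (N j)" by (rule j.cauchy_seqs_scale[OF d(1)])
      moreover have "\<pi> j (\<lambda>n. a \<odot>\<^bsub>E j\<^esub> d n) = a \<odot>\<^bsub>X j\<^esub> y" using X[OF j] d by (simp add: is_completion_def)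
      ultimately have "converges_to F (S ((pick \<xi>)(j := \<lambda>n. a \<odot>\<^bsub>E j\<^esub> d n))) (A (\<xi>(j := a \<odot>\<^bsub>X j\<^esub> y)))"
        using A_upd[OF \<xi> j] by metis
      moreover have "S ((pick \<xi>)(j := \<lambda>n. a \<odot>\<^bsub>E j\<^esub> d n)) = (\<lambda>n. a \<odot>\<^bsub>F\<^esub> S ((pick \<xi>)(j := d)) n)"
        using multilinear_smult[OF T base j j.cauchy_seqs_carrier[OF d(1)]] by (simp add: S_upd[OF j] fun_eq_iff)
      ultimately show "A (\<xi>(j := a \<odot>\<^bsub>X j\<^esub> y)) = a \<odot>\<^bsub>F\<^esub> A (\<xi>(j := y))"
        using F.converges_to_scale[OF A_upd[OF \<xi> j d(1)], of a] F.converges_to_unique d(2) by metis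
    next
      fix z assume "z \<in> carrier (X j)"
      then obtain e where e: "e \<in> cauchy_seqs (E j) (N j)" "z = \<pi> j e" using X[OF j] by (auto simp: is_completion_def)
      have "(\<lambda>n. d n \<oplus>\<^bsub>E j\<^esub> e n) \<in> cauchy_seqs (E j) (N j)" by (rule j.cauchy_seqs_add[OF d(1) e(1)])
      moreover have "\<pi> j (\<lambda>n. d n \<oplus>\<^bsub>E j\<^esub> e n) = y \<oplus>\<^bsub>X j\<^esub> z" using X[OF j] d e by (simp add: is_completion_def)
      ultimately have "converges_to F (S ((pick \<xi>)(j := \<lambda>n. d n \<oplus>\<^bsub>E j\<^esub> e n))) (A (\<xi>(j := y \<oplus>\<^bsub>X j\<^esub> z)))"
        using A_upd[OF \<xi> j] by metis
      moreover have "S ((pick \<xi>)(j := \<lambda>n. d n \<oplus>\<^bsub>E j\<^esub> e n))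
          = (\<lambda>n. S ((pick \<xi>)(j := d)) n \<oplus>\<^bsub>F\<^esub> S ((pick \<xi>)(j := e)) n)"
        using multilinear_add[OF T base j j.cauchy_seqs_carrier[OF d(1)] j.cauchy_seqs_carrier[OF e(1)]]
        by (simp add: S_upd[OF j] fun_eq_iff)
      ultimately show "A (\<xi>(j := y \<oplus>\<^bsub>X j\<^esub> z)) = A (\<xi>(j := y)) \<oplus>\<^bsub>F\<^esub> A (\<xi>(j := z))"
        using F.converges_to_add[OF A_upd[OF \<xi> j d(1)] A_upd[OF \<xi> j e(1)]] F.converges_to_unique d(2) e(2) by metis
    }
  next
    have "nrm F (A \<xi>) \<le> K * (\<Prod>j=1..m. nrm (X j) (\<xi> j))" if \<xi>: "\<xi> \<in> tuples m X" for \<xi>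
    proof (rule LIMSEQ_le)
      show "(\<lambda>n. nrm F (S (pick \<xi>) n)) \<longlonglongrightarrow> nrm F (A \<xi>)" by (rule F.converges_to_nrm[OF A_pick[OF \<xi>]])
      show "(\<lambda>n. K * (\<Prod>j=1..m. N j (pick \<xi> j n))) \<longlonglongrightarrow> K * (\<Prod>j=1..m. nrm (X j) (\<xi> j))"
        using lim_N[OF pick_Cau[OF \<xi>]] pick(2)[OF \<xi>] by (intro tendsto_mult_left tendsto_prod) force
      have "nrm F (S (pick \<xi>) n) \<le> K * (\<Prod>j=1..m. N j (pick \<xi> j n))" for n
      proof -
        have "(\<Prod>j=1..m. N j ((\<lambda>j\<in>{1..m}. pick \<xi> j n) j)) = (\<Prod>j=1..m. N j (pick \<xi> j n))"
          by (intro prod.cong) auto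
        then show ?thesis using K(2)[OF tup[OF pick_Cau[OF \<xi>], of n]] unfolding S_def by metis
      qed
      then show "\<exists>M. \<forall>n\<ge>M. nrm F (S (pick \<xi>) n) \<le> K * (\<Prod>j=1..m. N j (pick \<xi> j n))" by blast
    qed
    then show "\<exists>K. \<forall>\<xi>\<in>tuples m X. nrm F (A \<xi>) \<le> K * (\<Prod>j=1..m. nrm (X j) (\<xi> j))" by blast
  qed
  moreover have "\<forall>c. (\<forall>j\<in>{1..m}. c j \<in> cauchy_seqs (E j) (N j)) \<longrightarrow>
      converges_to F (\<lambda>n. T (\<lambda>j\<in>{1..m}. c j n)) (A (\<lambda>j\<in>{1..m}. \<pi> j (c j)))"
    using A unfolding Cau_def S_def[abs_def] by blast
  ultimately show ?thesis by blast
qed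

section \<open>The factorization theorem\<close>

lemma (in scaled_space) weak_norm_nonneg:
  assumes "1 \<le> q" "\<And>i. i \<in> {1..n} \<Longrightarrow> x i \<in> carrier V" "dual_ball V \<noteq> {}"
  shows "0 \<le> weak_norm V q n x"
proof -
  obtain f where "f \<in> dual_ball V" using assms(3) by blast
  then have "ell_norm q n (\<lambda>i. f (x i)) \<le> weak_norm V q n x" by (intro ell_norm_le_weak_norm assms)
  then show ?thesis using ell_norm_nonneg[of q n "\<lambda>i. f (x i)"] by linarith
qed

lemma weak_norm_dual_lattice_nonneg:
  assumes "banach_lattice F" "1 \<le> r" "\<And>i. i \<in> {1..n} \<Longrightarrow> y i \<in> pos_cone (dual_lattice F)"
  shows "0 \<le> weak_norm (dual_lattice F) r n y"
  using assms dual_lattice_ball_nonempty[OF assms(1)]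
  by (intro scaled_space.weak_norm_nonneg dual_lattice_scaled_space) (auto simp: pos_cone_carrier)

lemma exists_exponent:
  assumes "0 \<le> \<sigma>" "\<sigma> \<le> 1" shows "\<exists>s\<ge>1. recip s = \<sigma>"
proof (cases "\<sigma> = 0")
  case True
  then show ?thesis by (intro exI[of _ \<infinity>]) (simp add: recip_def)
next
  case False
  then have \<sigma>: "0 < \<sigma>" using assms by simp
  have "1 / ennreal (1 / \<sigma>) = ennreal \<sigma>"
    using divide_ennreal[of 1 "1 / \<sigma>"] \<sigma> by simp
  then have "recip (ennreal (1 / \<sigma>)) = \<sigma>" using \<sigma> by (simp add: recip_def)
  moreover have "1 \<le> ennreal (1 / \<sigma>)" using \<sigma> assms by simp
  ultimately show ?thesis by blast
qed

lemma factorization_bounded_multilinear: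
  assumes E: "\<And>j. j \<in> {1..m} \<Longrightarrow> banach_lattice (E j)" and F: "banach_lattice F"
    and fact: "factorization m q ps E F T X A u"
  shows "T \<in> bounded_multilinear_ops m E F"
proof -
  interpret F: banach_lattice F by (rule F)
  have A: "A \<in> bounded_multilinear_ops m X F" using fact by (simp add: factorization_def cohen_positive_def)
  have u: "u j \<in> bounded_ops (E j) (X j)" if "j \<in> {1..m}" for j
    using fact that by (simp add: factorization_def positive_summing_def)
  have T_eq: "T x = A (\<lambda>j\<in>{1..m}. u j (x j))" if "x \<in> tuples m E" for x
    using fact that by (simp add: factorization_def)
  have X: "banach_space (X j)" if "j \<in> {1..m}" for j using fact that by (simp add: factorization_def)
  have E_real: "real_space (E j)" if "j \<in> {1..m}" for j
    using E[OF that] by (simp add: banach_lattice_def banach_space_def real_space_def)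
  have ux: "(\<lambda>j\<in>{1..m}. u j (x j)) \<in> tuples m X" if "x \<in> tuples m E" for x
    using u tuples_carrier[OF that] by (intro restrict_in_tuples) (auto simp: bounded_ops_def)
  have upd: "T (x(j := y)) = A ((\<lambda>i\<in>{1..m}. u i (x i))(j := u j y))"
    if "x \<in> tuples m E" "j \<in> {1..m}" "y \<in> carrier (E j)" for x j y
  proof -
    have "(\<lambda>i\<in>{1..m}. u i ((x(j := y)) i)) = (\<lambda>i\<in>{1..m}. u i (x i))(j := u j y)" using that(2) by auto
    then show ?thesis using T_eq[OF tuples_update[OF that]] by simp
  qed
  obtain K where K: "\<And>x. x \<in> tuples m X \<Longrightarrow> nrm F (A x) \<le> K * (\<Prod>j=1..m. nrm (X j) (x j))"
    using A unfolding bounded_multilinear_ops_def by blast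
  have "\<forall>j\<in>{1..m}. \<exists>K. \<forall>x\<in>carrier (E j). nrm (X j) (u j x) \<le> K * nrm (E j) x"
    using u unfolding bounded_ops_def by blast
  from bchoice[OF this] obtain \<kappa> where \<kappa>: "\<forall>j\<in>{1..m}. \<forall>x\<in>carrier (E j). nrm (X j) (u j x) \<le> \<kappa> j * nrm (E j) x" by blast
  have "nrm F (T x) \<le> (\<bar>K\<bar> * (\<Prod>j=1..m. \<kappa> j)) * (\<Prod>j=1..m. nrm (E j) (x j))" if x: "x \<in> tuples m E" for x
  proof -
    have X_nn: "0 \<le> nrm (X j) (u j (x j))" if "j \<in> {1..m}" for j
      using banach_space.nrm_nonneg[OF X[OF that]] u[OF that] tuples_carrier[OF x that] by (auto simp: bounded_ops_def)
    have "nrm F (T x) \<le> K * (\<Prod>j=1..m. nrm (X j) (u j (x j)))"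
    proof -
      have "(\<Prod>j=1..m. nrm (X j) ((\<lambda>j\<in>{1..m}. u j (x j)) j)) = (\<Prod>j=1..m. nrm (X j) (u j (x j)))"
        by (intro prod.cong) auto
      then show ?thesis using K[OF ux[OF x]] unfolding T_eq[OF x] by metis
    qed
    also have "\<dots> \<le> \<bar>K\<bar> * (\<Prod>j=1..m. nrm (X j) (u j (x j)))"
      using X_nn by (intro mult_right_mono prod_nonneg) auto
    also have "\<dots> \<le> \<bar>K\<bar> * (\<Prod>j=1..m. \<kappa> j * nrm (E j) (x j))"
      using X_nn \<kappa> tuples_carrier[OF x] by (intro mult_left_mono prod_mono) auto
    finally show ?thesis by (simp add: prod.distrib mult.assoc)
  qed
  then have bdd: "\<exists>K. \<forall>x\<in>tuples m E. nrm F (T x) \<le> K * (\<Prod>j=1..m. nrm (E j) (x j))" by blast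
  show ?thesis
    unfolding bounded_multilinear_ops_def
  proof (intro CollectI conjI ballI allI bdd)
    fix x assume x: "x \<in> tuples m E"
    show "T x \<in> carrier F" unfolding T_eq[OF x] by (rule multilinear_carrier[OF A ux[OF x]])
    fix j y assume j: "j \<in> {1..m}" and y: "y \<in> carrier (E j)"
    interpret Ej: real_space "E j" by (rule E_real[OF j])
    have uy: "u j y \<in> carrier (X j)" using u[OF j] y by (simp add: bounded_ops_def)
    show "T (x(j := a \<odot>\<^bsub>E j\<^esub> y)) = a \<odot>\<^bsub>F\<^esub> T (x(j := y))" for a
      using multilinear_smult[OF A ux[OF x] j uy, of a] u[OF j] y
      by (simp add: upd[OF x j] bounded_ops_def)
    fix z assume z: "z \<in> carrier (E j)"
    have uz: "u j z \<in> carrier (X j)" using u[OF j] z by (simp add: bounded_ops_def)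
    show "T (x(j := y \<oplus>\<^bsub>E j\<^esub> z)) = T (x(j := y)) \<oplus>\<^bsub>F\<^esub> T (x(j := z))"
      using multilinear_add[OF A ux[OF x] j uy uz] u[OF j] y z
      by (simp add: upd[OF x j] bounded_ops_def)
  qed
qed

text \<open>
  Scaling the first argument by nonnegative weights turns the Cohen inequality into a bound for
  weighted sums, and the converse of the Hoelder inequality recovers the \<open>\<ell>\<^sub>p\<close>-norm from them.
\<close>

theorem dominated_of_factorization:
  fixes E :: "nat \<Rightarrow> ('e, 'y) normed_lattice_scheme" and F :: "('f, 'z) normed_lattice_scheme"
  assumes "1 \<le> m" "1 \<le> r" and "1 \<le> p" and ps: "\<And>j. j \<in> {1..m} \<Longrightarrow> 1 \<le> ps j"
    and exps: "1 / p = (\<Sum>j=1..m. 1 / ps j) + 1 / r"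
    and E: "\<And>j. j \<in> {1..m} \<Longrightarrow> banach_lattice (E j)" and F: "banach_lattice F"
    and fact: "factorization m (conj_exp r) ps E F T X A u"
    and CA: "0 \<le> CA" "cohen_positive_bound m (conj_exp r) X F A CA"
    and Cu: "\<And>j. j \<in> {1..m} \<Longrightarrow> 0 \<le> Cu j"
      "\<And>j. j \<in> {1..m} \<Longrightarrow> positive_summing_bound (ps j) (E j) (X j) (u j) (Cu j)"
  shows "positive_dominated_bound m p ps r E F T (CA * (\<Prod>j=1..m. Cu j))"
  unfolding positive_dominated_bound_def
proof (intro allI impI, elim conjE)
  fix n and x :: "nat \<Rightarrow> nat \<Rightarrow> 'e" and y :: "nat \<Rightarrow> 'f \<Rightarrow> real"
  assume x_pos: "\<forall>i\<in>{1..n}. x i \<in> (\<Pi>\<^sub>E j\<in>{1..m}. pos_cone (E j))"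
    and y_pos: "\<forall>i\<in>{1..n}. y i \<in> pos_cone (dual_lattice F)"
  have A: "A \<in> bounded_multilinear_ops m X F" using fact by (simp add: factorization_def cohen_positive_def)
  have X: "banach_space (X j)" if "j \<in> {1..m}" for j using fact that by (simp add: factorization_def)
  have u: "u j z \<in> carrier (X j)" if "j \<in> {1..m}" "z \<in> carrier (E j)" for j z
    using fact that by (auto simp: factorization_def positive_summing_def bounded_ops_def)
  define \<sigma> where "\<sigma> = (\<Sum>j=1..m. recip (ps j))"
  have recip_p: "recip p = \<sigma> + recip r"
    unfolding \<sigma>_def by (rule recip_sum[OF \<open>1 \<le> r\<close> \<open>1 \<le> p\<close> ps exps])
  have "0 \<le> \<sigma>" unfolding \<sigma>_def using recip_bounds[OF ps] by (intro sum_nonneg) auto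
  \<comment> \<open>The exponent of the product of the norms of the images under the summing operators.\<close>
  then obtain s where s: "1 \<le> s" "recip s = \<sigma>"
    using exists_exponent[of \<sigma>] recip_p recip_bounds[OF \<open>1 \<le> p\<close>] recip_bounds[OF \<open>1 \<le> r\<close>] by auto
  have x: "x i \<in> tuples m E" if "i \<in> {1..n}" for i
    using x_pos that by (auto simp: tuples_def PiE_def Pi_def pos_cone_def)
  define \<xi> where "\<xi> i = (\<lambda>j\<in>{1..m}. u j (x i j))" for i
  have \<xi>: "\<xi> i \<in> tuples m X" if "i \<in> {1..n}" for i
    unfolding \<xi>_def using u tuples_carrier[OF x[OF that]] by (intro restrict_in_tuples) auto
  define b where "b i = (\<Prod>j=1..m. nrm (X j) (u j (x i j)))" for i
  have y: "y i \<in> carrier (dual_space F)" if "i \<in> {1..n}" for i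
    using y_pos that by (simp add: pos_cone_dual_lattice)
  let ?w = "weak_norm (dual_lattice F) r n y"
  have w: "0 \<le> ?w" using y_pos by (intro weak_norm_dual_lattice_nonneg F \<open>1 \<le> r\<close>) auto
  have one: "1 \<in> {1..m}" using \<open>1 \<le> m\<close> by simp
  have "ell_norm p n (\<lambda>i. \<bar>y i (T (x i))\<bar>) \<le> CA * ell_norm s n b * ?w"
  proof (rule ell_norm_le_by_duality[OF \<open>1 \<le> p\<close>])
    show "0 \<le> CA * ell_norm s n b * ?w" using CA(1) w ell_norm_nonneg by simp
    fix l :: "nat \<Rightarrow> real" assume l: "\<And>i. i \<in> {1..n} \<Longrightarrow> 0 \<le> l i"
    define \<eta> where "\<eta> i = (\<xi> i)(1 := l i \<odot>\<^bsub>X 1\<^esub> \<xi> i 1)" for i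
    interpret X1: banach_space "X 1" by (rule X[OF one])
    have \<xi>1: "\<xi> i 1 \<in> carrier (X 1)" if "i \<in> {1..n}" for i by (rule tuples_carrier[OF \<xi>[OF that] one])
    have \<eta>: "\<eta> i \<in> tuples m X" if "i \<in> {1..n}" for i
      unfolding \<eta>_def using \<xi>1[OF that] by (intro tuples_update \<xi> that one) auto
    have "(\<Sum>i=1..n. l i * \<bar>y i (T (x i))\<bar>) = (\<Sum>i=1..n. \<bar>y i (A (\<eta> i))\<bar>)"
    proof (intro sum.cong refl)
      fix i assume i: "i \<in> {1..n}"
      have "T (x i) = A (\<xi> i)" using fact x[OF i] by (simp add: factorization_def \<xi>_def)
      moreover have "A (\<eta> i) = l i \<odot>\<^bsub>F\<^esub> A (\<xi> i)"
        unfolding \<eta>_def using multilinear_smult[OF A \<xi>[OF i] one \<xi>1[OF i]] by simp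
      ultimately show "l i * \<bar>y i (T (x i))\<bar> = \<bar>y i (A (\<eta> i))\<bar>"
        using dual_space_smult[OF y[OF i] multilinear_carrier[OF A \<xi>[OF i]]] l[OF i] by (simp add: abs_mult)
    qed
    also have "\<dots> \<le> CA * ell_norm (conj_exp r) n (\<lambda>i. \<Prod>j=1..m. nrm (X j) (\<eta> i j)) * ?w"
    proof -
      have "(\<forall>i\<in>{1..n}. \<eta> i \<in> tuples m X) \<and> (\<forall>i\<in>{1..n}. y i \<in> pos_cone (dual_lattice F))"
        using \<eta> y_pos by blast
      then show ?thesis
        using CA(2) unfolding cohen_positive_bound_def conj_exp(2)[OF \<open>1 \<le> r\<close>] by blast
    qed
    also have "ell_norm (conj_exp r) n (\<lambda>i. \<Prod>j=1..m. nrm (X j) (\<eta> i j)) = ell_norm (conj_exp r) n (\<lambda>i. l i * b i)"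
    proof (intro ell_norm_cong arg_cong[of _ _ abs])
      fix i assume i: "i \<in> {1..n}"
      have "(\<Prod>j\<in>{1..m} - {1}. nrm (X j) (\<eta> i j)) = (\<Prod>j\<in>{1..m} - {1}. nrm (X j) (u j (x i j)))"
        by (intro prod.cong) (auto simp: \<eta>_def \<xi>_def)
      moreover have "nrm (X 1) (\<eta> i 1) = l i * nrm (X 1) (u 1 (x i 1))"
        using X1.nrm_smult[OF \<xi>1[OF i]] l[OF i] one by (simp add: \<eta>_def \<xi>_def)
      ultimately show "(\<Prod>j=1..m. nrm (X j) (\<eta> i j)) = l i * b i"
        unfolding b_def using one by (simp add: prod.remove[of _ 1])
    qed
    also have "ell_norm (conj_exp r) n (\<lambda>i. l i * b i) \<le> ell_norm (conj_exp p) n l * ell_norm s n b"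
      using recip_p s by (intro ell_norm_mult_le conj_exp_ge_1) (auto simp: recip_conj_exp \<open>1 \<le> p\<close> \<open>1 \<le> r\<close>)
    finally show "(\<Sum>i=1..n. l i * \<bar>y i (T (x i))\<bar>) \<le> CA * ell_norm s n b * ?w * ell_norm (conj_exp p) n l"
      using CA(1) w by (simp add: mult_left_mono mult_right_mono mult_ac)
  qed auto
  also have "ell_norm s n b \<le> (\<Prod>j=1..m. ell_norm (ps j) n (\<lambda>i. nrm (X j) (u j (x i j))))"
    unfolding b_def using s ps by (intro ell_norm_prod_le) (auto simp: \<sigma>_def)
  also have "\<dots> \<le> (\<Prod>j=1..m. Cu j * weak_norm (E j) (ps j) n (\<lambda>i. x i j))"
  proof (intro prod_mono conjI ell_norm_nonneg)
    fix j assume j: "j \<in> {1..m}"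
    have "\<forall>i\<in>{1..n}. x i j \<in> pos_cone (E j)" using x_pos j by (meson PiE_mem)
    then show "ell_norm (ps j) n (\<lambda>i. nrm (X j) (u j (x i j))) \<le> Cu j * weak_norm (E j) (ps j) n (\<lambda>i. x i j)"
      using Cu(2)[OF j] unfolding positive_summing_bound_def
      by (elim allE[of _ n] allE[of _ "\<lambda>i. x i j"]) blast
  qed
  finally have "ell_norm p n (\<lambda>i. \<bar>y i (T (x i))\<bar>)
      \<le> CA * (\<Prod>j=1..m. Cu j * weak_norm (E j) (ps j) n (\<lambda>i. x i j)) * ?w"
    using CA(1) w by (simp add: mult_left_mono mult_right_mono)
  moreover have "ell_norm p n (\<lambda>i. \<bar>y i (T (x i))\<bar>) = ell_norm p n (\<lambda>i. y i (T (x i)))"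
    by (intro ell_norm_cong) simp
  ultimately show "ell_norm p n (\<lambda>i. y i (T (x i)))
      \<le> CA * (\<Prod>j=1..m. Cu j) * (\<Prod>j=1..m. weak_norm (E j) (ps j) n (\<lambda>i. x i j)) * ?w"
    by (simp add: prod.distrib mult.assoc)
qed

text \<open>
  Let \<open>g\<^sub>j\<close> and \<open>H\<close> be the summing functions that dominate \<open>T\<close>. The space \<open>X\<^sub>j\<close> is the completion of
  \<open>E\<^sub>j\<close> in the seminorm \<open>cone_norm\<close> of \<open>g\<^sub>j\<close>, and \<open>u\<^sub>j\<close> is the canonical map, which inherits the summing
  inequality from \<open>g\<^sub>j\<close>. The operator \<open>A\<close> is the extension of \<open>T\<close>; by continuity it satisfies
  \<open>\<bar>y (A \<xi>)\<bar> \<le> C * H y * \<Prod>\<^sub>j nrm (\<xi> j)\<close>, and the Cohen inequality follows by Hoelder's inequality for \<open>r\<^sup>*\<close> and \<open>r\<close>.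
\<close>

theorem factorization_of_dominated:
  fixes E :: "nat \<Rightarrow> ('e, 'y) normed_lattice_scheme" and F :: "('f, 'z) normed_lattice_scheme"
    and \<iota> :: "(nat \<Rightarrow> 'e) \<Rightarrow> 'x"
  assumes "1 \<le> r" and "1 \<le> p" and ps: "\<And>j. j \<in> {1..m} \<Longrightarrow> 1 \<le> ps j"
    and exps: "1 / p = (\<Sum>j=1..m. 1 / ps j) + 1 / r"
    and E: "\<And>j. j \<in> {1..m} \<Longrightarrow> banach_lattice (E j)" and F: "banach_lattice F" and "inj \<iota>"
    and T: "T \<in> bounded_multilinear_ops m E F" and C: "0 < C"
    and bound: "positive_dominated_bound m p ps r E F T C"
  shows "\<exists>(X :: nat \<Rightarrow> 'x normed) A u. factorization m (conj_exp r) ps E F T X A u \<and>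
    cohen_positive_bound m (conj_exp r) X F A C \<and>
    (\<forall>j\<in>{1..m}. positive_summing_bound (ps j) (E j) (X j) (u j) 1)"
proof -
  interpret F: banach_lattice F by (rule F)
  have "\<exists>g H. (\<forall>j\<in>{1..m}. summing_function (ps j) (E j) (g j) \<and>
        (\<forall>x\<in>carrier (E j). \<forall>y\<in>carrier (E j). g j (x \<oplus>\<^bsub>E j\<^esub> y) \<le> g j x + g j y)) \<and>
      summing_function r (dual_lattice F) H \<and>
      (\<forall>x\<in>(\<Pi>\<^sub>E j\<in>{1..m}. pos_cone (E j)). \<forall>y\<in>pos_cone (dual_lattice F).
         \<bar>y (T x)\<bar> \<le> C * (\<Prod>j=1..m. g j (x j)) * H y)"
    by (rule dominated_by_summing_functions[OF \<open>1 \<le> r\<close> \<open>1 \<le> p\<close> ps exps E F T C bound])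
  then obtain g H where gs: "\<forall>j\<in>{1..m}. summing_function (ps j) (E j) (g j) \<and>
        (\<forall>x\<in>carrier (E j). \<forall>y\<in>carrier (E j). g j (x \<oplus>\<^bsub>E j\<^esub> y) \<le> g j x + g j y)"
    and H: "summing_function r (dual_lattice F) H"
    and doms: "\<forall>x\<in>(\<Pi>\<^sub>E j\<in>{1..m}. pos_cone (E j)). \<forall>y\<in>pos_cone (dual_lattice F).
         \<bar>y (T x)\<bar> \<le> C * (\<Prod>j=1..m. g j (x j)) * H y"
    by (elim exE conjE)
  have g: "summing_function (ps j) (E j) (g j)" if "j \<in> {1..m}" for j using gs that by blast
  have g_add: "g j (x \<oplus>\<^bsub>E j\<^esub> y) \<le> g j x + g j y"
    if "j \<in> {1..m}" "x \<in> carrier (E j)" "y \<in> carrier (E j)" for j x y using gs that by blast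
  have dom: "\<bar>y (T x)\<bar> \<le> C * (\<Prod>j=1..m. g j (x j)) * H y"
    if "x \<in> (\<Pi>\<^sub>E j\<in>{1..m}. pos_cone (E j))" "y \<in> pos_cone (dual_lattice F)" for x y
    using doms that by blast
  define N where "N j = cone_norm (E j) (g j)" for j
  have cone: "cone_seminorm (E j) (g j)" if j: "j \<in> {1..m}" for j
    using E[OF j] g[OF j] g_add[OF j]
    by (intro cone_seminorm.intro cone_seminorm_axioms.intro) (auto simp: summing_function_def)
  have N: "seminormed_space (E j) (N j)" if j: "j \<in> {1..m}" for j
  proof -
    interpret cone_seminorm "E j" "g j" by (rule cone[OF j])
    show ?thesis unfolding N_def by (rule cone.seminormed_space_axioms)
  qed
  have H_nonneg: "0 \<le> H y" and H_le: "H y \<le> nrm (dual_space F) y" if "y \<in> pos_cone (dual_lattice F)" for y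
    using H that by (auto simp: summing_function_def pos_cone_dual_lattice dual_lattice_simps)
  have N_dom: "\<bar>y (T x)\<bar> \<le> C * H y * (\<Prod>j=1..m. N j (x j))"
    if x: "x \<in> tuples m E" and y: "y \<in> pos_cone (dual_lattice F)" for x y
    unfolding N_def
  proof (rule multilinear_cone_norm_bound[OF T cone F.real_space_axioms _ _ _ x])
    show "y \<in> carrier (dual_space F)" using y by (simp add: pos_cone_dual_lattice)
    show "0 \<le> C * H y" using C H_nonneg[OF y] by simp
    show "\<bar>y (T z)\<bar> \<le> C * H y * (\<Prod>j=1..m. g j (z j))" if "z \<in> (\<Pi>\<^sub>E j\<in>{1..m}. pos_cone (E j))" for z
      using dom[OF that y] by (simp add: mult_ac)
  qed
  have N_nonneg: "0 \<le> N j z" if "j \<in> {1..m}" "z \<in> carrier (E j)" for j z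
    using seminormed_space.seminorm_nonneg[OF N] that by blast
  have T_le: "nrm F (T x) \<le> (2 * C) * (\<Prod>j=1..m. N j (x j))" if x: "x \<in> tuples m E" for x
  proof -
    have prod_nn: "0 \<le> (\<Prod>j=1..m. N j (x j))" using N_nonneg tuples_carrier[OF x] by (intro prod_nonneg) auto
    have "\<bar>y (T x)\<bar> \<le> C * (\<Prod>j=1..m. N j (x j))" if y: "y \<in> pos_cone (dual_lattice F)" "y \<in> dual_ball F" for y
    proof -
      have "H y \<le> 1" using H_le[OF y(1)] y(2) by (simp add: dual_ball_def)
      then have "C * H y * (\<Prod>j=1..m. N j (x j)) \<le> C * 1 * (\<Prod>j=1..m. N j (x j))"
        using C prod_nn by (intro mult_right_mono mult_left_mono) auto
      then show ?thesis using N_dom[OF x y(1)] by simp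
    qed
    then have "nrm F (T x) \<le> 2 * (C * (\<Prod>j=1..m. N j (x j)))"
      by (rule F.nrm_le_by_positive_functionals[OF multilinear_carrier[OF T x]])
    then show ?thesis by simp
  qed
  have "\<forall>j\<in>{1..m}. \<exists>X\<pi>. is_completion (E j) (N j) (fst X\<pi> :: 'x normed) (snd X\<pi>)"
  proof
    fix j assume "j \<in> {1..m}"
    then obtain X :: "'x normed" and \<pi> where "is_completion (E j) (N j) X \<pi>"
      using seminormed_space.exists_completion[OF N \<open>inj \<iota>\<close>] by blast
    then show "\<exists>X\<pi>. is_completion (E j) (N j) (fst X\<pi> :: 'x normed) (snd X\<pi>)"
      by (intro exI[of _ "(X, \<pi>)"]) simp
  qed
  from bchoice[OF this] obtain X\<pi> :: "nat \<Rightarrow> 'x normed \<times> ((nat \<Rightarrow> 'e) \<Rightarrow> 'x)"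
    where X\<pi>: "\<forall>j\<in>{1..m}. is_completion (E j) (N j) (fst (X\<pi> j)) (snd (X\<pi> j))" by blast
  define X where "X j = fst (X\<pi> j)" for j
  define \<pi> where "\<pi> j = snd (X\<pi> j)" for j
  have comp: "is_completion (E j) (N j) (X j) (\<pi> j)" if "j \<in> {1..m}" for j
    using X\<pi> that by (simp add: X_def \<pi>_def)
  have "\<exists>A\<in>bounded_multilinear_ops m X F. \<forall>c. (\<forall>j\<in>{1..m}. c j \<in> cauchy_seqs (E j) (N j)) \<longrightarrow>
      converges_to F (\<lambda>n. T (\<lambda>j\<in>{1..m}. c j n)) (A (\<lambda>j\<in>{1..m}. \<pi> j (c j)))"
    by (rule extension_to_completions[OF T N F.banach_space_axioms _ T_le comp]) (use C in auto)
  then obtain A where A: "A \<in> bounded_multilinear_ops m X F"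
    and lims: "\<forall>c. (\<forall>j\<in>{1..m}. c j \<in> cauchy_seqs (E j) (N j)) \<longrightarrow>
      converges_to F (\<lambda>n. T (\<lambda>j\<in>{1..m}. c j n)) (A (\<lambda>j\<in>{1..m}. \<pi> j (c j)))"
    by (elim bexE)
  have lim: "converges_to F (\<lambda>n. T (\<lambda>j\<in>{1..m}. c j n)) (A (\<lambda>j\<in>{1..m}. \<pi> j (c j)))"
    if "\<And>j. j \<in> {1..m} \<Longrightarrow> c j \<in> cauchy_seqs (E j) (N j)" for c
    using lims that by blast
  define u where "u j x = \<pi> j (\<lambda>n. x)" for j x
  have const: "(\<lambda>n. x) \<in> cauchy_seqs (E j) (N j)" if "j \<in> {1..m}" "x \<in> carrier (E j)" for j x
    using seminormed_space.cauchy_seqs_const[OF N] that by blast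
  have nrm_u: "nrm (X j) (u j x) = N j x" if "j \<in> {1..m}" "x \<in> carrier (E j)" for j x
  proof -
    show ?thesis
      using is_completion_nrm[OF comp[OF that(1)] const[OF that]] by (simp add: u_def LIMSEQ_const_iff)
  qed
  have u_summing: "positive_summing_bound (ps j) (E j) (X j) (u j) 1" if j: "j \<in> {1..m}" for j
    unfolding positive_summing_bound_def
  proof (intro allI impI)
    fix n and x :: "nat \<Rightarrow> 'e" assume x: "\<forall>i\<in>{1..n}. x i \<in> pos_cone (E j)"
    interpret cone_seminorm "E j" "g j" by (rule cone[OF j])
    have "ell_norm (ps j) n (\<lambda>i. nrm (X j) (u j (x i))) \<le> ell_norm (ps j) n (\<lambda>i. g j (x i))"
    proof (rule ell_norm_mono[OF ps[OF j]])
      fix i assume "i \<in> {1..n}"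
      then have "x i \<in> pos_cone (E j)" using x by blast
      then show "\<bar>nrm (X j) (u j (x i))\<bar> \<le> \<bar>g j (x i)\<bar>"
        using cone_norm_on_cone[of "x i"] cone_norm_nonneg[of "x i"] nrm_u[OF j, of "x i"]
        by (simp add: N_def pos_cone_carrier)
    qed
    also have "\<dots> \<le> weak_norm (E j) (ps j) n x"
      using g[OF j] x by (auto simp: summing_function_def pos_cone_carrier)
    finally show "ell_norm (ps j) n (\<lambda>i. nrm (X j) (u j (x i))) \<le> 1 * weak_norm (E j) (ps j) n x" by simp
  qed
  have u_bounded: "u j \<in> bounded_ops (E j) (X j)" if j: "j \<in> {1..m}" for j
  proof -
    interpret cone_seminorm "E j" "g j" by (rule cone[OF j])
    have "u j x \<in> carrier (X j)" if "x \<in> carrier (E j)" for x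
      using comp[OF j] const[OF j that] by (auto simp: is_completion_def u_def)
    moreover have "u j (x \<oplus>\<^bsub>E j\<^esub> y) = u j x \<oplus>\<^bsub>X j\<^esub> u j y" if "x \<in> carrier (E j)" "y \<in> carrier (E j)" for x y
      unfolding u_def by (rule is_completion_add[OF comp[OF j] const[OF j that(1)] const[OF j that(2)]])
    moreover have "u j (t \<odot>\<^bsub>E j\<^esub> x) = t \<odot>\<^bsub>X j\<^esub> u j x" if "x \<in> carrier (E j)" for t x
      unfolding u_def by (rule is_completion_smult[OF comp[OF j] const[OF j that]])
    moreover have "nrm (X j) (u j x) \<le> 3 * nrm (E j) x" if "x \<in> carrier (E j)" for x
      using cone_norm_le_nrm[OF that] nrm_u[OF j that] by (simp add: N_def)
    ultimately show ?thesis unfolding bounded_ops_def by blast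
  qed
  have T_eq: "T x = A (\<lambda>j\<in>{1..m}. u j (x j))" if x: "x \<in> tuples m E" for x
  proof -
    have "(\<lambda>j\<in>{1..m}. x j) = x"
      by (rule tuples_eqI[OF restrict_in_tuples x]) (auto intro: tuples_carrier[OF x, unfolded atLeastAtMost_iff])
    then have "converges_to F (\<lambda>n. T x) (A (\<lambda>j\<in>{1..m}. u j (x j)))"
      using lim[of "\<lambda>j n. x j"] const tuples_carrier[OF x] by (simp add: u_def)
    moreover have "converges_to F (\<lambda>n. T x) (T x)"
      using multilinear_carrier[OF T x] F.nrm_eq_0[of "\<zero>\<^bsub>F\<^esub>"] by (simp add: converges_to_def F.minus_eq F.r_neg)
    ultimately show ?thesis using F.converges_to_unique by blast
  qed
  have A_dom: "\<bar>y (A \<xi>)\<bar> \<le> C * H y * (\<Prod>j=1..m. nrm (X j) (\<xi> j))"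
    if \<xi>: "\<xi> \<in> tuples m X" and y: "y \<in> pos_cone (dual_lattice F)" for \<xi> y
  proof -
    have "\<forall>j\<in>{1..m}. \<exists>c. c \<in> cauchy_seqs (E j) (N j) \<and> \<pi> j c = \<xi> j"
    proof
      fix j assume j: "j \<in> {1..m}"
      have "\<xi> j \<in> \<pi> j ` cauchy_seqs (E j) (N j)"
        using comp[OF j] tuples_carrier[OF \<xi> j] by (simp add: is_completion_def)
      then obtain c where "\<xi> j = \<pi> j c" "c \<in> cauchy_seqs (E j) (N j)" by (elim imageE)
      then show "\<exists>c. c \<in> cauchy_seqs (E j) (N j) \<and> \<pi> j c = \<xi> j" by (intro exI[of _ c]) simp
    qed
    from bchoice[OF this] obtain c where c: "\<forall>j\<in>{1..m}. c j \<in> cauchy_seqs (E j) (N j) \<and> \<pi> j (c j) = \<xi> j" by blast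
    have \<xi>_eq: "(\<lambda>j\<in>{1..m}. \<pi> j (c j)) = \<xi>"
      by (rule tuples_eqI[OF restrict_in_tuples \<xi>])
        (use c tuples_carrier[OF \<xi>] in auto)
    have tup: "(\<lambda>j\<in>{1..m}. c j n) \<in> tuples m E" for n
      using c seminormed_space.cauchy_seqs_carrier[OF N] by (intro restrict_in_tuples) auto
    have lim_T: "(\<lambda>n. \<bar>y (T (\<lambda>j\<in>{1..m}. c j n))\<bar>) \<longlonglongrightarrow> \<bar>y (A \<xi>)\<bar>"
      using F.converges_to_functional[OF lim, of c y] c y \<xi>_eq
      by (intro tendsto_rabs) (auto simp: pos_cone_dual_lattice)
    have lim_N: "(\<lambda>n. C * H y * (\<Prod>j=1..m. N j (c j n))) \<longlonglongrightarrow> C * H y * (\<Prod>j=1..m. nrm (X j) (\<xi> j))"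
    proof (intro tendsto_mult_left tendsto_prod)
      fix j assume j: "j \<in> {1..m}"
      show "(\<lambda>n. N j (c j n)) \<longlonglongrightarrow> nrm (X j) (\<xi> j)"
        using is_completion_nrm[OF comp[OF j], of "c j"] c j by auto
    qed
    have "\<bar>y (T (\<lambda>j\<in>{1..m}. c j n))\<bar> \<le> C * H y * (\<Prod>j=1..m. N j (c j n))" for n
    proof -
      have eq: "(\<Prod>j=1..m. N j ((\<lambda>j\<in>{1..m}. c j n) j)) = (\<Prod>j=1..m. N j (c j n))"
        by (intro prod.cong) auto
      show ?thesis using N_dom[OF tup y, of n] by (simp only: eq)
    qed
    then show ?thesis by (intro LIMSEQ_le[OF lim_T lim_N]) blast
  qed
  have A_cohen: "cohen_positive_bound m (conj_exp r) X F A C"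
    unfolding cohen_positive_bound_def
  proof (intro allI impI, elim conjE)
    fix n and \<xi> :: "nat \<Rightarrow> nat \<Rightarrow> 'x" and y :: "nat \<Rightarrow> 'f \<Rightarrow> real"
    assume \<xi>: "\<forall>i\<in>{1..n}. \<xi> i \<in> tuples m X" and y: "\<forall>i\<in>{1..n}. y i \<in> pos_cone (dual_lattice F)"
    define b where "b i = (\<Prod>j=1..m. nrm (X j) (\<xi> i j))" for i
    have b: "0 \<le> b i" if "i \<in> {1..n}" for i
      unfolding b_def
    proof (intro prod_nonneg)
      fix j assume j: "j \<in> {1..m}"
      interpret banach_space "X j" using comp[OF j] by (simp add: is_completion_def)
      show "0 \<le> nrm (X j) (\<xi> i j)" using \<xi> that j by (intro nrm_nonneg tuples_carrier[of "\<xi> i" m X]) auto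
    qed
    have "(\<Sum>i=1..n. \<bar>y i (A (\<xi> i))\<bar>) \<le> (\<Sum>i=1..n. C * (b i * H (y i)))"
      using A_dom \<xi> y by (intro sum_mono) (auto simp: b_def mult_ac)
    also have "\<dots> = C * ell_norm 1 n (\<lambda>i. b i * H (y i))"
      unfolding ell_norm_1 sum_distrib_left
      using b H_nonneg y by (intro sum.cong refl) (simp add: abs_mult)
    also have "\<dots> \<le> C * (ell_norm (conj_exp r) n b * ell_norm r n (\<lambda>i. H (y i)))"
      using C \<open>1 \<le> r\<close> by (intro mult_left_mono ell_norm_mult_le conj_exp_ge_1) (auto simp: recip_conj_exp)
    also have "ell_norm r n (\<lambda>i. H (y i)) \<le> weak_norm (dual_lattice F) r n y"
      using H y by (auto simp: summing_function_def pos_cone_carrier)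
    finally show "(\<Sum>i=1..n. \<bar>y i (A (\<xi> i))\<bar>)
        \<le> C * ell_norm (conj_exp r) n (\<lambda>i. \<Prod>j=1..m. nrm (X j) (\<xi> i j))
          * weak_norm (dual_lattice F) (conj_exp (conj_exp r)) n y"
      using C ell_norm_nonneg[of "conj_exp r" n b]
      by (simp add: conj_exp(2)[OF \<open>1 \<le> r\<close>] b_def[abs_def] mult_left_mono mult.assoc)
  qed
  have "factorization m (conj_exp r) ps E F T X A u"
    unfolding factorization_def cohen_positive_def positive_summing_def
  proof (intro conjI ballI CollectI)
    show "\<exists>C>0. cohen_positive_bound m (conj_exp r) X F A C" using C A_cohen by blast
    show "\<exists>C>0. positive_summing_bound (ps j) (E j) (X j) (u j) C" if "j \<in> {1..m}" for j
      using u_summing[OF that] zero_less_one by blast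
    show "banach_space (X j)" if "j \<in> {1..m}" for j using comp[OF that] by (simp add: is_completion_def)
  qed (use A u_bounded T_eq in auto)
  then show ?thesis using A_cohen u_summing by blast
qed

lemma Inf_positive_bounds_nonneg:
  fixes P :: "real \<Rightarrow> bool"
  assumes "\<exists>C>0. P C" shows "0 \<le> Inf {C. 0 < C \<and> P C}"
  using assms by (intro cInf_greatest) auto

lemma Inf_positive_bounds_le:
  fixes P :: "real \<Rightarrow> bool"
  assumes "0 < C" "P C" shows "Inf {C. 0 < C \<and> P C} \<le> C"
  using assms by (intro cInf_lower bdd_belowI[where m = 0]) auto

lemma Inf_positive_bounds_approx:
  fixes P :: "real \<Rightarrow> bool"
  assumes "\<exists>C>0. P C" "0 < \<epsilon>" shows "\<exists>C>0. P C \<and> C < Inf {C. 0 < C \<and> P C} + \<epsilon>"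
proof -
  have ne: "{C. 0 < C \<and> P C} \<noteq> {}" using assms(1) by blast
  have "Inf {C. 0 < C \<and> P C} < Inf {C. 0 < C \<and> P C} + \<epsilon>" using assms(2) by simp
  from cInf_lessD[OF ne this] show ?thesis by blast
qed

text \<open>
  The infima in the definitions of the norms may be \<open>0\<close>, where the bounds have to be positive; they are
  therefore approximated from above.
\<close>

lemma dominated_norm_le_factorization:
  fixes E :: "nat \<Rightarrow> ('e, 'y) normed_lattice_scheme" and F :: "('f, 'z) normed_lattice_scheme"
  assumes "1 \<le> m" "1 \<le> r" and "1 \<le> p" and ps: "\<And>j. j \<in> {1..m} \<Longrightarrow> 1 \<le> ps j"
    and exps: "1 / p = (\<Sum>j=1..m. 1 / ps j) + 1 / r"
    and E: "\<And>j. j \<in> {1..m} \<Longrightarrow> banach_lattice (E j)" and F: "banach_lattice F"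
    and fact: "factorization m (conj_exp r) ps E F T X A u"
  shows "T \<in> positive_dominated m p ps r E F"
    and "positive_dominated_norm m p ps r E F T
      \<le> cohen_positive_norm m (conj_exp r) X F A * (\<Prod>j=1..m. positive_summing_norm (ps j) (E j) (X j) (u j))"
proof -
  let ?a = "cohen_positive_norm m (conj_exp r) X F A"
  let ?b = "\<lambda>j. positive_summing_norm (ps j) (E j) (X j) (u j)"
  have A_ex: "\<exists>C>0. cohen_positive_bound m (conj_exp r) X F A C"
    using fact by (simp add: factorization_def cohen_positive_def)
  have u_ex: "\<exists>C>0. positive_summing_bound (ps j) (E j) (X j) (u j) C" if "j \<in> {1..m}" for j
    using fact that by (simp add: factorization_def positive_summing_def)
  have approx: "\<exists>C>0. positive_dominated_bound m p ps r E F T C \<and> C \<le> (?a + \<epsilon>) * (\<Prod>j=1..m. ?b j + \<epsilon>)"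
    if \<epsilon>: "0 < \<epsilon>" for \<epsilon>
  proof -
    obtain CA where CA: "0 < CA" "cohen_positive_bound m (conj_exp r) X F A CA" "CA < ?a + \<epsilon>"
      using Inf_positive_bounds_approx[OF A_ex \<epsilon>] unfolding cohen_positive_norm_def by blast
    have "\<forall>j\<in>{1..m}. \<exists>C. 0 < C \<and> positive_summing_bound (ps j) (E j) (X j) (u j) C \<and> C < ?b j + \<epsilon>"
      using Inf_positive_bounds_approx[OF u_ex \<epsilon>] unfolding positive_summing_norm_def by blast
    from bchoice[OF this] obtain Cu where
      Cu: "\<forall>j\<in>{1..m}. 0 < Cu j \<and> positive_summing_bound (ps j) (E j) (X j) (u j) (Cu j) \<and> Cu j < ?b j + \<epsilon>"
      by blast
    have "positive_dominated_bound m p ps r E F T (CA * (\<Prod>j=1..m. Cu j))"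
      by (rule dominated_of_factorization[OF assms(1-3) ps exps E F fact])
        (use CA Cu in \<open>auto simp: less_imp_le\<close>)
    moreover have "0 < CA * (\<Prod>j=1..m. Cu j)" using CA(1) Cu by (intro mult_pos_pos prod_pos) auto
    moreover have "CA * (\<Prod>j=1..m. Cu j) \<le> (?a + \<epsilon>) * (\<Prod>j=1..m. ?b j + \<epsilon>)"
    proof (intro mult_mono prod_mono)
      show "0 \<le> Cu j \<and> Cu j \<le> ?b j + \<epsilon>" if "j \<in> {1..m}" for j
        using Cu that by (meson less_imp_le)
      show "0 \<le> (\<Prod>j=1..m. Cu j)" using Cu by (intro prod_nonneg) (meson less_imp_le)
    qed (use CA in auto)
    ultimately show ?thesis by blast
  qed
  obtain C where C: "0 < C" "positive_dominated_bound m p ps r E F T C" using approx[of 1] by auto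
  then show "T \<in> positive_dominated m p ps r E F"
    using factorization_bounded_multilinear[OF E F fact] by (auto simp: positive_dominated_def)
  have le: "positive_dominated_norm m p ps r E F T \<le> (?a + \<epsilon>) * (\<Prod>j=1..m. ?b j + \<epsilon>)" if \<epsilon>: "0 < \<epsilon>" for \<epsilon>
  proof -
    obtain C where C: "0 < C" "positive_dominated_bound m p ps r E F T C"
      "C \<le> (?a + \<epsilon>) * (\<Prod>j=1..m. ?b j + \<epsilon>)" using approx[OF \<epsilon>] by blast
    have "positive_dominated_norm m p ps r E F T \<le> C"
      unfolding positive_dominated_norm_def by (rule Inf_positive_bounds_le, rule C(1), rule C(2))
    then show ?thesis using C(3) by linarith
  qed
  have "((\<lambda>\<epsilon>. (?a + \<epsilon>) * (\<Prod>j=1..m. ?b j + \<epsilon>)) \<longlongrightarrow> (?a + 0) * (\<Prod>j=1..m. ?b j + 0)) (at_right 0)"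
    by (intro tendsto_intros)
  then have "positive_dominated_norm m p ps r E F T \<le> (?a + 0) * (\<Prod>j=1..m. ?b j + 0)"
    by (rule tendsto_lowerbound) (use le in \<open>auto simp: eventually_at_filter\<close>)
  then show "positive_dominated_norm m p ps r E F T \<le> ?a * (\<Prod>j=1..m. ?b j)" by simp
qed

theorem theorem3p6:
  fixes E :: "nat \<Rightarrow> 'e normed_lattice" and F :: "'f normed_lattice"
    and m :: nat and r p :: ennreal and ps :: "nat \<Rightarrow> ennreal"
    and \<iota> :: "(nat \<Rightarrow> 'e) \<Rightarrow> 'x"
  assumes "1 \<le> m"
    and "1 \<le> r" and "1 \<le> p" and "\<And>j. j \<in> {1..m} \<Longrightarrow> 1 \<le> ps j"
    and "1 / p = (\<Sum>j=1..m. 1 / ps j) + 1 / r"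
    and "\<And>j. j \<in> {1..m} \<Longrightarrow> banach_lattice (E j)" and "banach_lattice F"
    and "inj \<iota>" \<comment> \<open>the type \<open>'x\<close> carrying the Banach spaces \<open>X j\<close> is large enough\<close>
  shows
    "(\<forall>T \<in> bounded_multilinear_ops m E F.
        T \<in> positive_dominated m p ps r E F \<longleftrightarrow>
          (\<exists>(X :: nat \<Rightarrow> 'x normed) A u. factorization m (conj_exp r) ps E F T X A u)) \<and>
     positive_dominated m p ps r E F =
       {T. \<exists>(X :: nat \<Rightarrow> 'x normed) A u. factorization m (conj_exp r) ps E F T X A u} \<and>
     (\<forall>T \<in> positive_dominated m p ps r E F.
        positive_dominated_norm m p ps r E F T =
          Inf {cohen_positive_norm m (conj_exp r) X F A *
                 (\<Prod>j=1..m. positive_summing_norm (ps j) (E j) (X j) (u j)) |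
               (X :: nat \<Rightarrow> 'x normed) A u. factorization m (conj_exp r) ps E F T X A u})"
proof -
  define norm_of where "norm_of X A u = cohen_positive_norm m (conj_exp r) X F A *
    (\<Prod>j=1..m. positive_summing_norm (ps j) (E j) (X j) (u j))"
    for X :: "nat \<Rightarrow> 'x normed" and A u
  let ?fact = "\<lambda>T (X :: nat \<Rightarrow> 'x normed) A u. factorization m (conj_exp r) ps E F T X A u"
  have in_dominated: "T \<in> positive_dominated m p ps r E F"
    and norm_le: "positive_dominated_norm m p ps r E F T \<le> norm_of X A u"
    if "?fact T X A u" for T X A u
    using dominated_norm_le_factorization[OF assms(1-3) _ assms(5) _ assms(7) that] assms(4,6)
    unfolding norm_of_def by blast+
  have factors: "\<exists>X A u. ?fact T X A u \<and> norm_of X A u \<le> C"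
    if T: "T \<in> bounded_multilinear_ops m E F" and C: "0 < C" "positive_dominated_bound m p ps r E F T C" for T C
  proof -
    have "\<exists>(X :: nat \<Rightarrow> 'x normed) A u. factorization m (conj_exp r) ps E F T X A u \<and>
        cohen_positive_bound m (conj_exp r) X F A C \<and>
        (\<forall>j\<in>{1..m}. positive_summing_bound (ps j) (E j) (X j) (u j) 1)"
      by (rule factorization_of_dominated[OF assms(2-8) T C])
    then obtain X :: "nat \<Rightarrow> 'x normed" and A u where fact: "?fact T X A u"
      and A: "cohen_positive_bound m (conj_exp r) X F A C"
      and u: "\<forall>j\<in>{1..m}. positive_summing_bound (ps j) (E j) (X j) (u j) 1"
      by (elim exE conjE)
    have "cohen_positive_norm m (conj_exp r) X F A \<le> C"
      unfolding cohen_positive_norm_def by (rule Inf_positive_bounds_le, rule C(1), rule A)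
    moreover have "0 \<le> positive_summing_norm (ps j) (E j) (X j) (u j)
        \<and> positive_summing_norm (ps j) (E j) (X j) (u j) \<le> 1" if "j \<in> {1..m}" for j
      unfolding positive_summing_norm_def using u that
      by (intro conjI Inf_positive_bounds_nonneg Inf_positive_bounds_le) (auto intro: exI[of _ 1])
    then have "(\<Prod>j=1..m. positive_summing_norm (ps j) (E j) (X j) (u j)) \<le> 1"
      and "0 \<le> (\<Prod>j=1..m. positive_summing_norm (ps j) (E j) (X j) (u j))"
      by (auto intro!: prod_le_1 prod_nonneg)
    ultimately have "norm_of X A u \<le> C * 1"
      unfolding norm_of_def using C(1) by (intro mult_mono) auto
    then show ?thesis using fact by auto
  qed
  have eq: "positive_dominated m p ps r E F = {T. \<exists>X A u. ?fact T X A u}"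
  proof (intro equalityI subsetI CollectI)
    fix T assume "T \<in> positive_dominated m p ps r E F"
    then obtain C where "T \<in> bounded_multilinear_ops m E F" "0 < C" "positive_dominated_bound m p ps r E F T C"
      by (auto simp: positive_dominated_def)
    then show "\<exists>X A u. ?fact T X A u" using factors by blast
  qed (use in_dominated in blast)
  moreover have "positive_dominated_norm m p ps r E F T = Inf {norm_of X A u | X A u. ?fact T X A u}" (is "_ = Inf ?S")
    if T: "T \<in> positive_dominated m p ps r E F" for T
  proof (rule antisym)
    have "?S \<noteq> {}" using T eq by blast
    then show "positive_dominated_norm m p ps r E F T \<le> Inf ?S"
      using norm_le by (intro cInf_greatest) auto
    have bdd: "bdd_below ?S" using norm_le by (intro bdd_belowI) auto
    have "T \<in> bounded_multilinear_ops m E F" and ex: "\<exists>C>0. positive_dominated_bound m p ps r E F T C"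
      using T by (auto simp: positive_dominated_def)
    then have "Inf ?S \<le> C" if C: "0 < C" "positive_dominated_bound m p ps r E F T C" for C
    proof -
      obtain X A u where "?fact T X A u" "norm_of X A u \<le> C"
        using factors[OF \<open>T \<in> bounded_multilinear_ops m E F\<close> C] by blast
      then show ?thesis by (intro cInf_lower2[OF _ _ bdd]) auto
    qed
    then show "Inf ?S \<le> positive_dominated_norm m p ps r E F T"
      unfolding positive_dominated_norm_def using ex by (intro cInf_greatest) auto
  qed
  ultimately show ?thesis unfolding norm_of_def by (intro conjI) auto
qed

end
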